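(* Every cusped (finite-area strictly) convex real projective surface has discrete length spectrum.
   Context: Let $S_{g,m}$ be a connected oriented surface of genus $g$ with $m\ge1$ punctures, $2g-2+m>0$. A cusped convex real projective surface is a quotient $\Sigma=\Omega/\rho(\pi_1(S_{g,m}))$ of finite area, where $\Omega\subset\mathbb{RP}^2$ is a strictly convex open domain (closure contained in an affine chart, no segment in $\partial\Omega$), $\rho:\pi_1(S_{g,m})\to\operatorname{PGL}_3(\mathbb{R})$ is discrete and faithful with image preserving $\Omega$ and acting properly discontinuously, and the holonomy around every puncture is unipotent. Lengths are with respect to the Hilbert metric, induced from $d(x,y)=\frac12\log\frac{|x-p_y||y-p_x|}{|y-p_y||x-p_x|}$ on $\Omega$, where the line through $x,y$ meets $\partial\Omega$ at $p_x$ (nearer $x$) and $p_y$ (nearer $y$). The length spectrum is the collection of lengths of closed geodesics on $\Sigma$ (not necessarily simple; geodesic representatives of non-peripheral closed curves). It is discrete if for every $L>0$ there are only finitely many closed geodesics of length at most $L$. *)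

theory Defs
  imports "HOL-Analysis.Analysis" "HOL-Homology.Homology"
begin

section \<open>Surfaces of genus g with m punctures\<close>

definition topological_surface :: "'a::topological_space set \<Rightarrow> bool" where
  "topological_surface X \<longleftrightarrow>
     Hausdorff_space (top_of_set X) \<and> second_countable (top_of_set X) \<and>
     (\<forall>x\<in>X. \<exists>V. openin (top_of_set X) V \<and> x \<in> V \<and> V homeomorphic (UNIV :: (real^2) set))"

text \<open>Existence of a fundamental class: a class in \<open>H\<^sub>2(X)\<close> restricting to a generator of every
  local homology group \<open>H\<^sub>2(X, X - x)\<close>.\<close>

definition orientable_closed_surface :: "'a::topological_space set \<Rightarrow> bool" where
  "orientable_closed_surface X \<longleftrightarrow>
     (\<exists>\<mu>\<in>carrier (homology_group 2 (top_of_set X)). \<forall>x\<in>X.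
        generate (relative_homology_group 2 (top_of_set X) (X - {x}))
          {hom_induced 2 (top_of_set X) {} (top_of_set X) (X - {x}) id \<mu>}
        = carrier (relative_homology_group 2 (top_of_set X) (X - {x})))"

definition closed_oriented_surface :: "nat \<Rightarrow> 'a::topological_space set \<Rightarrow> bool" where
  "closed_oriented_surface g X \<longleftrightarrow>
     topological_surface X \<and> compact X \<and> connected X \<and> X \<noteq> {} \<and> orientable_closed_surface X \<and>
     homology_group 1 (top_of_set X) \<cong> free_Abelian_group {..<2 * g}"

text \<open>The surface itself is \<open>X - P\<close>.\<close>

definition punctured_surface :: "nat \<Rightarrow> nat \<Rightarrow> 'a::topological_space set \<Rightarrow> 'a set \<Rightarrow> bool" where
  "punctured_surface g m X P \<longleftrightarrow>
     closed_oriented_surface g X \<and> P \<subseteq> X \<and> finite P \<and> card P = m"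

definition path_class :: "'a::topological_space set \<Rightarrow> (real \<Rightarrow> 'a) \<Rightarrow> (real \<Rightarrow> 'a) set" where
  "path_class S p = {q. homotopic_paths S p q}"

definition fundamental_group :: "'a::topological_space set \<Rightarrow> 'a \<Rightarrow> (real \<Rightarrow> 'a) set monoid" where
  "fundamental_group S b =
     \<lparr>carrier = path_class S ` {p. path p \<and> path_image p \<subseteq> S \<and> pathstart p = b \<and> pathfinish p = b},
      monoid.mult = (\<lambda>\<alpha> \<beta>. \<Union>p\<in>\<alpha>. \<Union>q\<in>\<beta>. path_class S (p +++ q)),
      one = path_class S (\<lambda>_. b)\<rparr>"

text \<open>\<open>h\<close> parametrises a closed disc in \<open>X\<close>, centred at the puncture \<open>p\<close> and containing no other.\<close>

definition puncture_disc ::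
    "'a::topological_space set \<Rightarrow> 'a set \<Rightarrow> 'a \<Rightarrow> (complex \<Rightarrow> 'a) \<Rightarrow> bool" where
  "puncture_disc X P p h \<longleftrightarrow>
     (\<exists>k. homeomorphism (cball 0 1) (h ` cball 0 1) h k) \<and>
     h ` cball 0 1 \<subseteq> X \<and> h 0 = p \<and> h ` cball 0 1 \<inter> P = {p}"

text \<open>The elements freely homotopic to the boundary circle of such a disc (hence closed under
  conjugation).\<close>

definition puncture_elements ::
    "'a::topological_space set \<Rightarrow> 'a set \<Rightarrow> 'a \<Rightarrow> 'a \<Rightarrow> (real \<Rightarrow> 'a) set set" where
  "puncture_elements X P b p =
     {\<alpha> \<in> carrier (fundamental_group (X - P) b).
        \<exists>h. puncture_disc X P p h \<and>
          (\<exists>q\<in>\<alpha>. homotopic_loops (X - P) q (\<lambda>t. h (cis (2 * pi * t))))}"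

text \<open>The elements freely homotopic into a punctured disc around a puncture, i.e. to a multiple of
  the boundary circle, including the trivial one.\<close>

definition peripheral_elements ::
    "'a::topological_space set \<Rightarrow> 'a set \<Rightarrow> 'a \<Rightarrow> (real \<Rightarrow> 'a) set set" where
  "peripheral_elements X P b =
     {\<alpha> \<in> carrier (fundamental_group (X - P) b).
        \<exists>p\<in>P. \<exists>h q r. puncture_disc X P p h \<and> q \<in> \<alpha> \<and>
          homotopic_loops (X - P) q r \<and> path_image r \<subseteq> h ` cball 0 1 - {p}}"


section \<open>The projective plane and its automorphism group\<close>

text \<open>The quotient topology on a set \<open>Q\<close> of pairwise disjoint classes with open union.\<close>

definition class_topology :: "'a::topological_space set set \<Rightarrow> 'a set topology" where
  "class_topology Q = topology (\<lambda>V. V \<subseteq> Q \<and> open (\<Union>V))"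

lemma openin_class_topology:
  assumes "disjoint Q"
  shows "openin (class_topology Q) V \<longleftrightarrow> V \<subseteq> Q \<and> open (\<Union>V)"
proof -
  have "istopology (\<lambda>V. V \<subseteq> Q \<and> open (\<Union>V))"
    unfolding istopology_def
  proof (intro conjI allI impI)
    fix S T assume S: "S \<subseteq> Q \<and> open (\<Union>S)" and T: "T \<subseteq> Q \<and> open (\<Union>T)"
    have "c = d" if "c \<in> S" "d \<in> T" "x \<in> c" "x \<in> d" for c d x
    proof (rule ccontr)
      assume "c \<noteq> d"
      moreover have "c \<in> Q" "d \<in> Q"
        using that S T by auto
      ultimately have "c \<inter> d = {}"
        using assms by (simp add: disjointD)
      with that show False
        by auto
    qed
    then have "\<Union>S \<inter> \<Union>T \<subseteq> \<Union>(S \<inter> T)"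
      by blast
    then have "\<Union>(S \<inter> T) = \<Union>S \<inter> \<Union>T"
      by (intro equalityI Int_greatest Union_mono) simp_all
    then show "open (\<Union>(S \<inter> T))"
      using S T by (simp add: open_Int)
    show "S \<inter> T \<subseteq> Q"
      using S by auto
  next
    fix K assume K: "\<forall>S\<in>K. S \<subseteq> Q \<and> open (\<Union>S)"
    have "\<Union>(\<Union>K) = (\<Union>S\<in>K. \<Union>S)"
      by blast
    also have "open \<dots>"
      using K by (intro open_UN) simp
    finally show "open (\<Union>(\<Union>K))" .
    show "\<Union>K \<subseteq> Q"
      using K by auto
  qed
  then show ?thesis
    by (simp add: class_topology_def)
qed

text \<open>A point of the plane is a line through the origin with the origin removed.\<close>

definition proj_point :: "real^3 \<Rightarrow> (real^3) set" where
  "proj_point v = {c *\<^sub>R v |c. c \<noteq> 0}"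

definition RP2 :: "(real^3) set set" where
  "RP2 = proj_point ` (- {0})"

definition RP2_topology :: "(real^3) set topology" where
  "RP2_topology = class_topology RP2"

definition GL3 :: "(real^3^3) monoid" where
  "GL3 = \<lparr>carrier = {A. invertible A}, monoid.mult = (**), one = mat 1\<rparr>"

definition scalars3 :: "(real^3^3) set" where
  "scalars3 = {c *\<^sub>R mat 1 |c. c \<noteq> 0}"

definition PGL3 :: "(real^3^3) set monoid" where
  "PGL3 = GL3 Mod scalars3"

definition PGL3_topology :: "(real^3^3) set topology" where
  "PGL3_topology = class_topology (carrier PGL3)"

definition proj_act :: "(real^3^3) set \<Rightarrow> (real^3) set \<Rightarrow> (real^3) set" where
  "proj_act c l = (\<Union>A\<in>c. (*v) A ` l)"

text \<open>Powers are written as iterated linear maps since \<open>^\<close> on matrices is componentwise.\<close>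

definition unipotent :: "(real^3^3) set \<Rightarrow> bool" where
  "unipotent c \<longleftrightarrow> (\<exists>A\<in>c. \<exists>k. ((*v) (A - mat 1)) ^^ k = (\<lambda>_. 0))"

lemma disjoint_RP2: "disjoint RP2"
proof -
  have "proj_point v = proj_point w" if "x \<in> proj_point v" "x \<in> proj_point w" for v w x
  proof -
    obtain a b where ab: "a \<noteq> 0" "b \<noteq> 0" "x = a *\<^sub>R v" "x = b *\<^sub>R w"
      using \<open>x \<in> proj_point v\<close> \<open>x \<in> proj_point w\<close> by (auto simp: proj_point_def)
    have v: "v = (b / a) *\<^sub>R w"
    proof -
      have "(1 / a) *\<^sub>R (a *\<^sub>R v) = (1 / a) *\<^sub>R (b *\<^sub>R w)"
        using ab(3,4) by metis
      then show ?thesis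
        using ab(1) by simp
    qed
    have "\<exists>d. d \<noteq> 0 \<and> c *\<^sub>R v = d *\<^sub>R w" if "c \<noteq> 0" for c
      using ab(1,2) that by (intro exI[of _ "c * (b / a)"]) (simp add: v)
    moreover have "\<exists>d. d \<noteq> 0 \<and> c *\<^sub>R w = d *\<^sub>R v" if "c \<noteq> 0" for c
      using ab(1,2) that by (intro exI[of _ "c * (a / b)"]) (simp add: v)
    ultimately show ?thesis
      by (auto simp: proj_point_def)
  qed
  then show ?thesis
    unfolding RP2_def disjoint_def by blast
qed

lemma group_GL3: "group GL3"
proof (rule groupI)
  fix A assume "A \<in> carrier GL3"
  then obtain B where "A ** B = mat 1" "B ** A = mat 1"
    by (auto simp: GL3_def invertible_def)
  then show "\<exists>B\<in>carrier GL3. B \<otimes>\<^bsub>GL3\<^esub> A = \<one>\<^bsub>GL3\<^esub>"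
    by (auto simp: GL3_def invertible_def)
next
  show "\<one>\<^bsub>GL3\<^esub> \<in> carrier GL3"
    by (auto simp: GL3_def invertible_def intro: exI[of _ "mat 1"])
qed (simp_all add: GL3_def invertible_mult matrix_mul_assoc)

lemma scalar_matrix_mult:
  fixes A :: "real^3^3"
  shows "(c *\<^sub>R mat 1) ** A = c *\<^sub>R A" and "A ** (c *\<^sub>R mat 1) = c *\<^sub>R A"
  using scalar_matrix_assoc[of c "mat 1" A] matrix_scalar_ac[of A c "mat 1"] by simp_all

lemma normal_scalars3: "scalars3 \<lhd> GL3"
proof -
  interpret group GL3 by (rule group_GL3)
  have sub: "scalars3 \<subseteq> carrier GL3"
  proof
    fix A assume "A \<in> scalars3"
    then obtain c where c: "c \<noteq> 0" "A = c *\<^sub>R mat 1"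
      by (auto simp: scalars3_def)
    then have "A ** ((1 / c) *\<^sub>R mat 1) = mat 1" "((1 / c) *\<^sub>R mat 1) ** A = mat 1"
      by (simp_all add: scalar_matrix_mult)
    then show "A \<in> carrier GL3"
      by (auto simp: GL3_def invertible_def)
  qed
  have "subgroup scalars3 GL3"
  proof (rule subgroupI)
    show "scalars3 \<subseteq> carrier GL3" by (rule sub)
    show "scalars3 \<noteq> {}"
      by (auto simp: scalars3_def)
    fix A assume "A \<in> scalars3"
    then obtain c where c: "c \<noteq> 0" "A = c *\<^sub>R mat 1"
      by (auto simp: scalars3_def)
    let ?B = "(1 / c) *\<^sub>R mat 1 :: real^3^3"
    have B: "?B \<in> scalars3"
      using c by (auto simp: scalars3_def)
    have "?B \<otimes>\<^bsub>GL3\<^esub> A = \<one>\<^bsub>GL3\<^esub>"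
      using c by (simp add: GL3_def scalar_matrix_mult)
    then have "inv\<^bsub>GL3\<^esub> A = ?B"
      using B sub \<open>A \<in> scalars3\<close> by (intro inv_equality) auto
    with B show "inv\<^bsub>GL3\<^esub> A \<in> scalars3"
      by simp
    fix A' assume "A' \<in> scalars3"
    then obtain c' where "c' \<noteq> 0" "A' = c' *\<^sub>R mat 1"
      by (auto simp: scalars3_def)
    then show "A \<otimes>\<^bsub>GL3\<^esub> A' \<in> scalars3"
      using c by (auto simp: GL3_def scalar_matrix_mult scalars3_def)
  qed
  moreover have "scalars3 #>\<^bsub>GL3\<^esub> A = A <#\<^bsub>GL3\<^esub> scalars3" for A
  proof -
    have "B ** A = A ** B" if "B \<in> scalars3" for B
      using that by (auto simp: scalars3_def scalar_matrix_mult)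
    then show ?thesis
      by (simp add: r_coset_def l_coset_def GL3_def)
  qed
  ultimately show ?thesis
    by (simp add: normal_def normal_axioms_def group_axioms group_GL3)
qed

lemma group_PGL3: "group PGL3"
  unfolding PGL3_def by (rule normal.factorgroup_is_group[OF normal_scalars3])

lemma disjoint_PGL3: "disjoint (carrier PGL3)"
proof -
  have "carrier PGL3 = rcosets\<^bsub>GL3\<^esub> scalars3"
    by (simp only: PGL3_def FactGroup_def partial_object.simps)
  then show ?thesis
    using group.rcos_disjoint[OF group_GL3 normal_imp_subgroup[OF normal_scalars3]] by (simp only:)
qed


section \<open>Strictly convex domains and their Hilbert geometry\<close>

text \<open>For invertible \<open>M\<close> these are the affine charts of the projective plane.\<close>

definition affine_chart :: "real^3^3 \<Rightarrow> real^2 \<Rightarrow> (real^3) set" where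
  "affine_chart M v = proj_point (M *v vector [v$1, v$2, 1])"

text \<open>\<open>\<Omega>\<close> is a strictly convex domain whose closure lies in the affine chart given by \<open>M\<close>. The
  Hilbert metric and area computed in such a chart do not depend on the chart.\<close>

definition strictly_convex_domain :: "real^3^3 \<Rightarrow> (real^3) set set \<Rightarrow> bool" where
  "strictly_convex_domain M \<Omega> \<longleftrightarrow>
     invertible M \<and> openin RP2_topology \<Omega> \<and> \<Omega> \<noteq> {} \<and>
     Abstract_Topology.closure_of RP2_topology \<Omega> \<subseteq> range (affine_chart M) \<and>
     convex (affine_chart M -` \<Omega>) \<and>
     (\<forall>x y. x \<noteq> y \<longrightarrow>
        \<not> affine_chart M ` closed_segment x y \<subseteq> RP2_topology frontier_of \<Omega>)"

text \<open>The point where the ray from \<open>x\<close> through \<open>y\<close> leaves the bounded convex open set \<open>U\<close>.\<close>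

definition exit_point :: "(real^2) set \<Rightarrow> real^2 \<Rightarrow> real^2 \<Rightarrow> real^2" where
  "exit_point U x y = (THE p. p \<in> frontier U \<and> (\<exists>t>0. p = x + t *\<^sub>R (y - x)))"

definition hilbert_dist :: "(real^2) set \<Rightarrow> real^2 \<Rightarrow> real^2 \<Rightarrow> real" where
  "hilbert_dist U x y =
     (if x = y then 0
      else let p\<^sub>x = exit_point U y x; p\<^sub>y = exit_point U x y in
        1 / 2 * ln ((dist x p\<^sub>y * dist y p\<^sub>x) / (dist y p\<^sub>y * dist x p\<^sub>x)))"

text \<open>The Finsler norm of the Hilbert metric, i.e. the derivative of \<open>t \<mapsto> hilbert_dist U x (x + t v)\<close>
  at \<open>0\<^sup>+\<close>.\<close>

definition hilbert_norm :: "(real^2) set \<Rightarrow> real^2 \<Rightarrow> real^2 \<Rightarrow> real" where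
  "hilbert_norm U x v =
     (if v = 0 then 0
      else norm v / 2 * (1 / dist x (exit_point U x (x + v)) + 1 / dist x (exit_point U x (x - v))))"

text \<open>The Busemann area (the two-dimensional Hausdorff measure of the Hilbert metric): Lebesgue measure
  rescaled so that each unit ball of the Finsler norm has area \<open>\<pi>\<close>.\<close>

definition hilbert_area :: "(real^2) set \<Rightarrow> (real^2) set \<Rightarrow> ennreal" where
  "hilbert_area U D =
     (\<integral>\<^sup>+x\<in>D. ennreal (pi / measure lborel {v. hilbert_norm U x v < 1}) \<partial>lborel)"

definition proj_dist :: "real^3^3 \<Rightarrow> (real^3) set set \<Rightarrow> (real^3) set \<Rightarrow> (real^3) set \<Rightarrow> real" where
  "proj_dist M \<Omega> x y =
     hilbert_dist (affine_chart M -` \<Omega>) (inv_into UNIV (affine_chart M) x) (inv_into UNIV (affine_chart M) y)"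

definition proj_orbit :: "(real^3^3) set set \<Rightarrow> (real^3) set \<Rightarrow> (real^3) set set" where
  "proj_orbit \<Gamma> x = (\<lambda>c. proj_act c x) ` \<Gamma>"

text \<open>The area of the quotient of \<open>\<Omega>\<close> by a freely acting group \<open>\<Gamma>\<close> is that of a Borel set meeting
  every orbit exactly once.\<close>

definition finite_area_quotient :: "real^3^3 \<Rightarrow> (real^3) set set \<Rightarrow> (real^3^3) set set \<Rightarrow> bool" where
  "finite_area_quotient M \<Omega> \<Gamma> \<longleftrightarrow>
     (\<exists>D\<in>sets borel. D \<subseteq> affine_chart M -` \<Omega> \<and>
        (\<forall>x\<in>\<Omega>. \<exists>!y. y \<in> D \<and> affine_chart M y \<in> proj_orbit \<Gamma> x) \<and>
        hilbert_area (affine_chart M -` \<Omega>) D < \<infinity>)"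


section \<open>Cusped convex projective surfaces and their closed geodesics\<close>

definition properly_discontinuous :: "(real^3) set set \<Rightarrow> (real^3^3) set set \<Rightarrow> bool" where
  "properly_discontinuous \<Omega> \<Gamma> \<longleftrightarrow>
     (\<forall>K. compactin RP2_topology K \<and> K \<subseteq> \<Omega> \<longrightarrow> finite {c\<in>\<Gamma>. proj_act c ` K \<inter> K \<noteq> {}})"

definition cusped_convex_projective_surface ::
    "'a::topological_space set \<Rightarrow> 'a set \<Rightarrow> 'a \<Rightarrow> real^3^3 \<Rightarrow> (real^3) set set \<Rightarrow>
     ((real \<Rightarrow> 'a) set \<Rightarrow> (real^3^3) set) \<Rightarrow> bool" where
  "cusped_convex_projective_surface X P b M \<Omega> \<rho> \<longleftrightarrow>
     (let \<pi>\<^sub>1 = fundamental_group (X - P) b; \<Gamma> = \<rho> ` carrier \<pi>\<^sub>1 in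
        strictly_convex_domain M \<Omega> \<and>
        \<rho> \<in> hom \<pi>\<^sub>1 PGL3 \<and>
        inj_on \<rho> (carrier \<pi>\<^sub>1) \<and>
        subtopology PGL3_topology \<Gamma> = discrete_topology \<Gamma> \<and>
        (\<forall>c\<in>\<Gamma>. proj_act c ` \<Omega> = \<Omega>) \<and>
        properly_discontinuous \<Omega> \<Gamma> \<and>
        finite_area_quotient M \<Omega> \<Gamma> \<and>
        (\<forall>p\<in>P. \<forall>\<alpha>\<in>puncture_elements X P b p. unipotent (\<rho> \<alpha>)))"

definition hilbert_geodesic :: "real^3^3 \<Rightarrow> (real^3) set set \<Rightarrow> (real \<Rightarrow> (real^3) set) \<Rightarrow> bool" where
  "hilbert_geodesic M \<Omega> \<sigma> \<longleftrightarrow>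
     range \<sigma> \<subseteq> \<Omega> \<and>
     (\<forall>t. \<exists>\<epsilon>>0. \<forall>s\<in>ball t \<epsilon>. \<forall>s'\<in>ball t \<epsilon>. proj_dist M \<Omega> (\<sigma> s) (\<sigma> s') = \<bar>s - s'\<bar>)"

text \<open>\<open>\<gamma>\<close> is a unit-speed parametrisation, of period \<open>l\<close>, of a closed geodesic in the quotient in the
  free homotopy class of a non-peripheral \<open>\<alpha>\<close>: it lifts to a geodesic \<open>\<sigma>\<close> of \<open>\<Omega>\<close> with
  \<open>\<sigma> (t + l) = \<rho> \<alpha> (\<sigma> t)\<close>.\<close>

definition closed_geodesic_param ::
    "'a::topological_space set \<Rightarrow> 'a set \<Rightarrow> 'a \<Rightarrow> real^3^3 \<Rightarrow> (real^3) set set \<Rightarrow>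
     ((real \<Rightarrow> 'a) set \<Rightarrow> (real^3^3) set) \<Rightarrow> real \<Rightarrow> (real \<Rightarrow> (real^3) set set) \<Rightarrow> bool" where
  "closed_geodesic_param X P b M \<Omega> \<rho> l \<gamma> \<longleftrightarrow>
     l > 0 \<and>
     (\<exists>\<alpha>\<in>carrier (fundamental_group (X - P) b) - peripheral_elements X P b. \<exists>\<sigma>.
        hilbert_geodesic M \<Omega> \<sigma> \<and>
        (\<forall>t. \<sigma> (t + l) = proj_act (\<rho> \<alpha>) (\<sigma> t)) \<and>
        (\<forall>t. \<gamma> t = proj_orbit (\<rho> ` carrier (fundamental_group (X - P) b)) (\<sigma> t)))"

text \<open>A closed geodesic is its length together with its unit-speed parametrisations up to the choice
  of starting point, so that iterates of a closed geodesic are distinct closed geodesics.\<close>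

definition closed_geodesics ::
    "'a::topological_space set \<Rightarrow> 'a set \<Rightarrow> 'a \<Rightarrow> real^3^3 \<Rightarrow> (real^3) set set \<Rightarrow>
     ((real \<Rightarrow> 'a) set \<Rightarrow> (real^3^3) set) \<Rightarrow> (real \<times> (real \<Rightarrow> (real^3) set set) set) set" where
  "closed_geodesics X P b M \<Omega> \<rho> =
     {(l, range (\<lambda>a t. \<gamma> (t + a))) |l \<gamma>. closed_geodesic_param X P b M \<Omega> \<rho> l \<gamma>}"

definition discrete_length_spectrum ::
    "'a::topological_space set \<Rightarrow> 'a set \<Rightarrow> 'a \<Rightarrow> real^3^3 \<Rightarrow> (real^3) set set \<Rightarrow>
     ((real \<Rightarrow> 'a) set \<Rightarrow> (real^3^3) set) \<Rightarrow> bool" where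
  "discrete_length_spectrum X P b M \<Omega> \<rho> \<longleftrightarrow>
     (\<forall>L>0. finite {G\<in>closed_geodesics X P b M \<Omega> \<rho>. fst G \<le> L})"

end

theory Submission
  imports Defs
begin

text \<open>
  Lift the domain to an open convex cone \<open>C\<close> in three-space and the group to the group \<open>G\<close> of matrices
  of determinant \<open>\<plusminus>1\<close> preserving \<open>C\<close>; the Hilbert metric is then expressed by the order of \<open>C\<close>. A closed
  geodesic is the axis of an element \<open>B\<close> with two boundary eigenvectors, and it is determined by \<open>B\<close>
  up to conjugation. So finitely many conjugacy classes have to account for all \<open>B\<close> of translation
  length at most \<open>L\<close>.

  Call a point thick if no nontrivial element of \<open>G\<close> is close to the identity in the operator norm
  given by the order-unit norm of the point. By a packing argument in the space of matrices a
  bounded number of elements move a thick point a bounded distance, so finite area allows only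
  finitely many disjoint patches around thick points: the thick part is cocompact. If the axis of
  \<open>B\<close> meets the thick part, proper discontinuity leaves finitely many \<open>B\<close>. Otherwise let \<open>A\<close> be an
  almost smallest nontrivial element at a point of the axis. Commutators of \<open>A\<close> with small elements are
  much smaller than \<open>A\<close>, hence trivial; so \<open>A\<close> commutes with its conjugates by powers of \<open>B\<close>, and this
  forces \<open>A\<close> to have the same axis. Moving from the axis towards a thick point, the almost smallest
  elements at consecutive points commute and therefore share this axis, until the thick part is
  reached: up to conjugation only finitely many axes occur.
\<close>

section \<open>Strictly convex cones\<close>

text \<open>The obstacle is that \<open>B\<close> is not small: only its translation length is
  bounded, so an almost smallest \<open>A\<close> has no direct reason to commute with it. What
  commutes with \<open>A\<close> are its conjugates by \<open>mpow B n\<close>, as long as these are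
  small, and at a fixed point of the axis such a conjugation increases sizes by at most
  \<open>(b / a) ^ (2 * n)\<close>. The span of the conjugates stabilises within 9 steps, the
  dimension of the space of matrices, so smallness for \<open>n \<le> 9\<close> gives commutation
  for all \<open>n\<close>; hence the factor \<open>(b / a) ^ 18\<close>. The axis is then recovered
  by letting \<open>n\<close> tend to infinity. The other constants: for displacements
  \<open>a\<close> and \<open>b\<close> up to \<open>1/2\<close> the commutator has displacement at
  most \<open>8 * a * b\<close>, so an element of size \<open>1/16\<close> halves the size; passing
  to a point comparable with factor 2 costs a factor 4, hence \<open>1/64\<close>. The normalisation
  of the determinant removes the ambiguity of scale in projective classes: by a volume argument,
  bounds up to a scalar become bounds between vectors.\<close>

locale strict_cone =
  fixes C :: "(real^3) set"
  assumes open_C: "open C" and ne_C: "C \<noteq> {}" and convex_C: "convex C"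
    and scale_C: "x \<in> C \<Longrightarrow> t > 0 \<Longrightarrow> t *\<^sub>R x \<in> C"
    and pointed: "x \<in> closure C \<Longrightarrow> - x \<in> closure C \<Longrightarrow> x = 0"
    and strict: "x \<in> closure C \<Longrightarrow> y \<in> closure C \<Longrightarrow> x \<noteq> 0 \<Longrightarrow> y \<noteq> 0 \<Longrightarrow> x + y \<notin> C \<Longrightarrow>
      \<exists>k>0. y = k *\<^sub>R x"
begin

abbreviation K where "K \<equiv> closure C"

lemma C_K: "x \<in> C \<Longrightarrow> x \<in> K"
  using closure_subset by blast

lemma add_C: "x \<in> C \<Longrightarrow> y \<in> C \<Longrightarrow> x + y \<in> C"
  using scale_C[of "(1/2) *\<^sub>R x + (1/2) *\<^sub>R y" 2] convexD[OF convex_C, of x y "1/2" "1/2"]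
  by (simp add: algebra_simps)

lemma zero_K: "0 \<in> K"
proof -
  obtain x where x: "x \<in> C" using ne_C by auto
  have "(\<lambda>n. inverse (real (Suc n)) *\<^sub>R x) \<longlonglongrightarrow> 0 *\<^sub>R x"
    by (intro tendsto_intros LIMSEQ_inverse_real_of_nat)
  moreover have "inverse (real (Suc n)) *\<^sub>R x \<in> C" for n
    using x by (intro scale_C) auto
  ultimately show ?thesis
    unfolding closure_sequential by (intro exI[of _ "\<lambda>n. inverse (real (Suc n)) *\<^sub>R x"]) simp
qed

lemma scale_K: assumes "x \<in> K" "t \<ge> 0" shows "t *\<^sub>R x \<in> K"
proof (cases "t = 0")
  case False
  then have "(*\<^sub>R) t ` C \<subseteq> C"
    using assms scale_C by auto
  then have "(*\<^sub>R) t ` K \<subseteq> K"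
    by (metis closure_mono closure_scaleR)
  then show ?thesis using assms by auto
qed (simp add: zero_K)

lemma convex_K: "convex K"
  by (rule convex_closure[OF convex_C])

lemma add_K: "x \<in> K \<Longrightarrow> y \<in> K \<Longrightarrow> x + y \<in> K"
  using scale_K[of "(1/2) *\<^sub>R x + (1/2) *\<^sub>R y" 2] convexD[OF convex_K, of x y "1/2" "1/2"]
  by (simp add: algebra_simps)

text \<open>\<open>C\<close> is open, so the error of approximating \<open>y\<close> by some
  \<open>y'\<close> in \<open>C\<close> can be absorbed by the summand \<open>x\<close>.\<close>

lemma add_CK: assumes "x \<in> C" "y \<in> K" shows "x + y \<in> C"
proof -
  obtain e where e: "e > 0" "ball x e \<subseteq> C"
    using open_C assms open_contains_ball by blast
  obtain y' where y': "y' \<in> C" "dist y' y < e"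
    using assms(2) e(1) by (meson closure_approachable)
  have "x + y - y' \<in> ball x e"
    using y'(2) by (simp add: dist_norm norm_minus_commute)
  then have "x + y - y' \<in> C" using e by blast
  from add_C[OF this y'(1)] show ?thesis by simp
qed

lemma zero_notin: "0 \<notin> C"
proof
  assume "0 \<in> C"
  then obtain e where e: "e > 0" "ball 0 e \<subseteq> C"
    using open_C open_contains_ball by blast
  let ?v = "(e/2) *\<^sub>R (axis 1 1 :: real^3)"
  have "norm ?v < e" using e by (simp add: norm_axis_1)
  then have "?v \<in> K" "- ?v \<in> K"
    using e(2) C_K by (auto simp: dist_norm subset_eq)
  from pointed[OF this] e(1) show False by (simp add: axis_eq_0_iff)
qed

lemma neg_C: "x \<in> C \<Longrightarrow> - x \<notin> K"
  using add_CK[of x "-x"] zero_notin by auto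

lemma lim_K: "f \<longlonglongrightarrow> l \<Longrightarrow> (\<And>n. f n \<in> K) \<Longrightarrow> l \<in> K"
  using closed_sequentially[OF closed_closure] by blast

section \<open>The order of the cone and its order-unit norms\<close>

definition le :: "real^3 \<Rightarrow> real^3 \<Rightarrow> bool" (infix "\<sqsubseteq>" 50) where
  "x \<sqsubseteq> y \<longleftrightarrow> y - x \<in> K"

lemma le_refl [simp]: "x \<sqsubseteq> x" by (simp add: le_def zero_K)

lemma le_trans [trans]: "x \<sqsubseteq> y \<Longrightarrow> y \<sqsubseteq> z \<Longrightarrow> x \<sqsubseteq> z"
  using add_K[of "y - x" "z - y"] by (simp add: le_def)

lemma le_scale: "x \<sqsubseteq> y \<Longrightarrow> t \<ge> 0 \<Longrightarrow> t *\<^sub>R x \<sqsubseteq> t *\<^sub>R y"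
  using scale_K[of "y - x" t] by (simp add: le_def algebra_simps)

lemma le_add: "x \<sqsubseteq> y \<Longrightarrow> x' \<sqsubseteq> y' \<Longrightarrow> x + x' \<sqsubseteq> y + y'"
  using add_K[of "y - x" "y' - x'"] by (simp add: le_def algebra_simps)

lemma le_scalar: "x \<in> K \<Longrightarrow> s \<le> t \<Longrightarrow> s *\<^sub>R x \<sqsubseteq> t *\<^sub>R x"
  using scale_K[of x "t - s"] by (simp add: le_def algebra_simps)

lemma le_C: "x \<in> C \<Longrightarrow> x \<sqsubseteq> y \<Longrightarrow> y \<in> C"
  using add_CK[of x "y - x"] by (simp add: le_def)

lemma scalar_pos: "x \<in> C \<Longrightarrow> y \<in> K \<Longrightarrow> x \<sqsubseteq> t *\<^sub>R y \<Longrightarrow> t > 0"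
proof (rule ccontr)
  assume a: "x \<in> C" "y \<in> K" "x \<sqsubseteq> t *\<^sub>R y" "\<not> t > 0"
  then have "t *\<^sub>R y \<in> C" using le_C by blast
  moreover have "- (t *\<^sub>R y) \<in> K" using scale_K[of y "-t"] a by simp
  ultimately show False using neg_C by blast
qed

lemma le_scalar_iff: assumes "x \<in> C" shows "s *\<^sub>R x \<sqsubseteq> t *\<^sub>R x \<longleftrightarrow> s \<le> t"
proof
  assume a: "s *\<^sub>R x \<sqsubseteq> t *\<^sub>R x"
  show "s \<le> t"
  proof (rule ccontr)
    assume "\<not> s \<le> t"
    then have "(s - t) *\<^sub>R x \<in> C" using assms by (intro scale_C) auto
    from neg_C[OF this] a show False by (simp add: le_def algebra_simps)
  qed
qed (use le_scalar C_K assms in auto)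

text \<open>Membership in the order interval \<open>[- l y, l y]\<close>, i.e. the order-unit norm of \<open>v\<close> with respect
  to \<open>y\<close> is at most \<open>l\<close>.\<close>

definition order_ball :: "real^3 \<Rightarrow> real \<Rightarrow> real^3 \<Rightarrow> bool" where
  "order_ball y l v \<longleftrightarrow> l *\<^sub>R y - v \<in> K \<and> l *\<^sub>R y + v \<in> K"

lemma order_ball_add: "order_ball y l v \<Longrightarrow> order_ball y m w \<Longrightarrow> order_ball y (l + m) (v + w)"
  using add_K[of "l *\<^sub>R y - v" "m *\<^sub>R y - w"] add_K[of "l *\<^sub>R y + v" "m *\<^sub>R y + w"]
  by (simp add: order_ball_def algebra_simps)

lemma order_ball_neg: "order_ball y l (- v) \<longleftrightarrow> order_ball y l v"
  by (auto simp: order_ball_def)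

lemma order_ball_diff: "order_ball y l v \<Longrightarrow> order_ball y m w \<Longrightarrow> order_ball y (l + m) (v - w)"
  using order_ball_add[of y l v m "-w"] order_ball_neg by simp

lemma order_ball_scale: assumes "order_ball y l v" shows "order_ball y (\<bar>t\<bar> * l) (t *\<^sub>R v)"
proof -
  have "order_ball y (\<bar>t\<bar> * l) (\<bar>t\<bar> *\<^sub>R v)"
    using assms scale_K[of "l *\<^sub>R y - v" "\<bar>t\<bar>"] scale_K[of "l *\<^sub>R y + v" "\<bar>t\<bar>"]
    by (simp add: order_ball_def scaleR_diff_right scaleR_add_right)
  then show ?thesis using order_ball_neg[of y "\<bar>t\<bar> * l" "t *\<^sub>R v"] by (cases "t \<ge> 0") auto
qed

lemma order_ball_mono: "y \<in> K \<Longrightarrow> order_ball y l v \<Longrightarrow> l \<le> m \<Longrightarrow> order_ball y m v"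
  using add_K[of "l *\<^sub>R y - v" "(m - l) *\<^sub>R y"] add_K[of "l *\<^sub>R y + v" "(m - l) *\<^sub>R y"] scale_K[of y "m - l"]
  by (simp add: order_ball_def algebra_simps)

lemma order_ball_le: assumes "y \<sqsubseteq> R *\<^sub>R z" "order_ball y l v" "l \<ge> 0" shows "order_ball z (R * l) v"
proof -
  have "l *\<^sub>R (R *\<^sub>R z - y) \<in> K" using assms by (intro scale_K) (auto simp: le_def)
  from add_K[OF this, of "l *\<^sub>R y - v"] add_K[OF this, of "l *\<^sub>R y + v"] assms(2)
  show ?thesis by (simp add: order_ball_def algebra_simps)
qed

lemma order_ball_nonneg: assumes "y \<in> C" "order_ball y l v" shows "l \<ge> 0"
proof (rule ccontr)
  assume "\<not> l \<ge> 0"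
  then have c: "(-2 * l) *\<^sub>R y \<in> C" using assms by (intro scale_C) auto
  have "(l *\<^sub>R y - v) + (l *\<^sub>R y + v) \<in> K"
    using add_K assms(2) unfolding order_ball_def by blast
  also have "(l *\<^sub>R y - v) + (l *\<^sub>R y + v) = - ((-2 * l) *\<^sub>R y)"
    by (simp add: vec_eq_iff)
  finally show False using neg_C[OF c] by simp
qed

text \<open>The Euclidean norm dominates the order-unit norm of an interior point. Stating this for
  all \<open>l\<close>, with \<open>l = 0\<close> allowed, saves case distinctions later.\<close>

lemma ex_order_ball: assumes "y \<in> C" shows "\<exists>e>0. \<forall>v l. norm v \<le> e * l \<longrightarrow> order_ball y l v"
proof -
  obtain e where e: "e > 0" "cball y e \<subseteq> C"
    using open_C assms open_contains_cball by blast
  have "order_ball y l v" if "norm v \<le> e * l" for v l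
  proof (cases "l > 0")
    case True
    have "norm ((1/l) *\<^sub>R v) \<le> e" using that True by (simp add: field_simps)
    then have "y - (1/l) *\<^sub>R v \<in> cball y e" "y + (1/l) *\<^sub>R v \<in> cball y e"
      by (auto simp: dist_norm)
    then have "y - (1/l) *\<^sub>R v \<in> C" "y + (1/l) *\<^sub>R v \<in> C"
      using e(2) by blast+
    then have "y - (1/l) *\<^sub>R v \<in> K" "y + (1/l) *\<^sub>R v \<in> K"
      using C_K by auto
    from this[THEN scale_K, of l] True show ?thesis by (simp add: order_ball_def algebra_simps)
  next
    case False
    with that e(1) have "norm v \<le> 0" "l = 0"
      by (smt (verit) mult_nonneg_nonpos norm_ge_zero, smt (verit) mult_pos_neg norm_ge_zero)
    then show ?thesis by (simp add: order_ball_def zero_K)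
  qed
  with e show ?thesis by blast
qed

lemma order_ball_zero: assumes "\<And>n::nat. order_ball y (c / 2 ^ n) v" shows "v = 0"
proof -
  have "(\<lambda>n. c / 2 ^ n) \<longlonglongrightarrow> 0" by real_asymp
  then have "(\<lambda>n. (c / 2 ^ n) *\<^sub>R y - v) \<longlonglongrightarrow> 0 *\<^sub>R y - v" "(\<lambda>n. (c / 2 ^ n) *\<^sub>R y + v) \<longlonglongrightarrow> 0 *\<^sub>R y + v"
    by (intro tendsto_intros; assumption)+
  then have "0 *\<^sub>R y - v \<in> K" "0 *\<^sub>R y + v \<in> K"
    using assms unfolding order_ball_def by (auto elim!: lim_K)
  then show ?thesis using pointed[of v] by simp
qed

text \<open>Along an unbounded sequence the unit directions would have a limit \<open>u\<close> with
  both \<open>u\<close> and \<open>- u\<close> in \<open>K\<close>, against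
  \<open>pointed\<close>.\<close>

lemma bounded_order_ball: "bounded {v. order_ball y l v}"
proof (rule ccontr)
  assume "\<not> ?thesis"
  then have "\<exists>v. order_ball y l v \<and> norm v \<ge> real (Suc n)" for n
    unfolding bounded_iff by (metis linorder_le_cases mem_Collect_eq)
  then obtain v where v: "\<And>n. order_ball y l (v n)" "\<And>n. norm (v n) \<ge> real (Suc n)"
    by metis
  define w where "w n = (1 / norm (v n)) *\<^sub>R v n" for n
  have pos: "norm (v n) > 0" for n using v(2)[of n] by (meson less_le_trans of_nat_0_less_iff zero_less_Suc)
  have "norm (w n) = 1" for n using pos[of n] by (simp add: w_def)
  then have "w n \<in> sphere 0 1" for n by simp
  then obtain u r where u: "u \<in> sphere 0 1" "strict_mono r" "(w \<circ> r) \<longlonglongrightarrow> u"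
    using compact_sphere[of "0::real^3" 1] unfolding compact_def by metis
  have "(\<lambda>n. 1 / norm (v n)) \<longlonglongrightarrow> 0"
  proof (rule tendsto_sandwich[of "\<lambda>_. 0" _ _ "\<lambda>n. inverse (real (Suc n))"])
    show "\<forall>\<^sub>F n in sequentially. 1 / norm (v n) \<le> inverse (real (Suc n))"
      using v(2) pos by (intro always_eventually allI) (simp add: field_simps)
  qed (use LIMSEQ_inverse_real_of_nat in auto)
  from LIMSEQ_subseq_LIMSEQ[OF this u(2)] have t: "(\<lambda>n. (l * (1 / norm (v (r n)))) *\<^sub>R y) \<longlonglongrightarrow> (l * 0) *\<^sub>R y"
    by (intro tendsto_intros) (simp add: o_def)
  have "(l * (1 / norm (v n))) *\<^sub>R y - w n \<in> K \<and> (l * (1 / norm (v n))) *\<^sub>R y + w n \<in> K" for n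
    using v(1)[of n] scale_K[of "l *\<^sub>R y - v n" "1 / norm (v n)"] scale_K[of "l *\<^sub>R y + v n" "1 / norm (v n)"]
    by (simp add: order_ball_def w_def algebra_simps)
  moreover have "(\<lambda>n. (l * (1 / norm (v (r n)))) *\<^sub>R y - w (r n)) \<longlonglongrightarrow> (l * 0) *\<^sub>R y - u"
    "(\<lambda>n. (l * (1 / norm (v (r n)))) *\<^sub>R y + w (r n)) \<longlonglongrightarrow> (l * 0) *\<^sub>R y + u"
    using tendsto_diff[OF t u(3)[unfolded o_def]] tendsto_add[OF t u(3)[unfolded o_def]] by auto
  ultimately have "(l * 0) *\<^sub>R y - u \<in> K" "(l * 0) *\<^sub>R y + u \<in> K"
    by (auto elim!: lim_K)
  then have "u = 0" using pointed[of u] by simp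
  with u(1) show False by simp
qed

lemma closed_order_ball: "closed {v. order_ball y l v}"
proof -
  have "{v. order_ball y l v} = (\<lambda>v. l *\<^sub>R y - v) -` K \<inter> (\<lambda>v. l *\<^sub>R y + v) -` K"
    by (auto simp: order_ball_def)
  then show ?thesis
    by (auto intro!: closed_Int closed_vimage continuous_intros)
qed

lemma compact_order_ball: "compact {v. order_ball y l v}"
  using bounded_order_ball closed_order_ball compact_eq_bounded_closed by blast

lemma order_ball_volume: assumes "y \<in> C"
  shows "{v. order_ball y l v} \<in> lmeasurable" and "measure lebesgue {v. order_ball y 1 v} > 0"
proof -
  show m: "{v. order_ball y l v} \<in> lmeasurable" for l
    by (rule lmeasurable_compact[OF compact_order_ball])
  obtain e where e: "e > 0" "\<And>v l. norm v \<le> e * l \<Longrightarrow> order_ball y l v"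
    using ex_order_ball[OF assms] by blast
  have "ball 0 e \<subseteq> {v. order_ball y 1 v}" using e(2)[of _ 1] by auto
  then have "measure lebesgue (ball (0::real^3) e) \<le> measure lebesgue {v. order_ball y 1 v}"
    by (intro measure_mono_fmeasurable m) auto
  moreover have "measure lebesgue (ball (0::real^3) e) > 0"
    using content_ball_pos[OF e(1)] by simp
  ultimately show "measure lebesgue {v. order_ball y 1 v} > 0" by linarith
qed

text \<open>Compares the volume of the order interval of \<open>y\<close> with that of its image.\<close>

lemma det_le: assumes "y \<in> C" "\<And>v. order_ball y 1 v \<Longrightarrow> order_ball y R (A *v v)" "\<bar>det A\<bar> = 1" "R > 0" shows "R \<ge> 1"
proof -
  let ?I = "{v. order_ball y 1 v}"
  have "(*v) A ` ?I \<subseteq> (*\<^sub>R) R ` ?I"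
  proof
    fix w assume "w \<in> (*v) A ` ?I"
    then have "order_ball y R w" using assms by auto
    then have "order_ball y 1 ((1/R) *\<^sub>R w)" using order_ball_scale[of y R w "1/R"] assms by simp
    then show "w \<in> (*\<^sub>R) R ` ?I" using assms by (intro image_eqI[of _ _ "(1/R) *\<^sub>R w"]) auto
  qed
  moreover have "(*\<^sub>R) R ` ?I = {v. order_ball y R v}"
  proof -
    have "v \<in> (*\<^sub>R) R ` ?I" if "order_ball y R v" for v
      using order_ball_scale[OF that, of "1/R"] assms by (intro image_eqI[of _ _ "(1/R) *\<^sub>R v"]) auto
    then show ?thesis using order_ball_scale[of y 1 _ R] assms by auto
  qed
  ultimately have "measure lebesgue ((*v) A ` ?I) \<le> measure lebesgue ((*\<^sub>R) R ` ?I)"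
    using order_ball_volume(1)[OF assms(1)] assms
    by (intro measure_mono_fmeasurable) (auto intro!: fmeasurableD measurable_linear_image)
  also have "\<dots> = R ^ 3 * measure lebesgue ?I"
    using measure_lebesgue_affine[of R 0 ?I] assms by simp
  also have "measure lebesgue ((*v) A ` ?I) = measure lebesgue ?I"
    using measure_linear_image[of "(*v) A" ?I] order_ball_volume(1)[OF assms(1)] assms
    by simp
  finally have "1 \<le> R ^ 3" using order_ball_volume(2)[OF assms(1)] by simp
  show ?thesis
  proof (rule ccontr)
    assume "\<not> R \<ge> 1"
    then have "R ^ 3 < 1" using assms by (simp add: power_less_one_iff)
    with \<open>1 \<le> R ^ 3\<close> show False by simp
  qed
qed

text \<open>Thompson's part metric of the cone is at most \<open>ln R\<close>; this bounds the
  Hilbert distance of the two rays. Unlike the Hilbert metric it depends on the scale of the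
  vectors, which \<open>comparable_normalize\<close> repairs for points of one orbit.\<close>

definition comparable :: "real \<Rightarrow> real^3 \<Rightarrow> real^3 \<Rightarrow> bool" where
  "comparable R x y \<longleftrightarrow> x \<sqsubseteq> R *\<^sub>R y \<and> y \<sqsubseteq> R *\<^sub>R x"

lemma comparable_sym: "comparable R x y \<longleftrightarrow> comparable R y x"
  by (auto simp: comparable_def)

lemma comparable_trans: assumes "comparable R x y" "comparable S y z" "R \<ge> 0" "S \<ge> 0" shows "comparable (R * S) x z"
  using le_trans[of x "R *\<^sub>R y" "(R * S) *\<^sub>R z"] le_trans[of z "S *\<^sub>R y" "(R * S) *\<^sub>R x"] assms
    le_scale[of y "S *\<^sub>R z" R] le_scale[of y "R *\<^sub>R x" S]
  by (simp add: comparable_def mult.commute)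

lemma comparable_mono: "comparable R x y \<Longrightarrow> R \<le> S \<Longrightarrow> x \<in> K \<Longrightarrow> y \<in> K \<Longrightarrow> comparable S x y"
  unfolding comparable_def by (meson le_scalar le_trans)

lemma comparable_scale: "comparable R x y \<Longrightarrow> t > 0 \<Longrightarrow> comparable R (t *\<^sub>R x) (t *\<^sub>R y)"
  using le_scale[of x "R *\<^sub>R y" t] le_scale[of y "R *\<^sub>R x" t] by (simp add: comparable_def mult.commute)

lemma ex_comparable: assumes "x \<in> C" "y \<in> C" shows "\<exists>R\<ge>1. comparable R x y"
proof -
  have "\<exists>R\<ge>1. a \<sqsubseteq> R *\<^sub>R b" if b: "b \<in> C" for a b
  proof -
    obtain e where e: "e > 0" "\<And>v l. norm v \<le> e * l \<Longrightarrow> order_ball b l v"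
      using ex_order_ball[OF b] by blast
    define t where "t = e / (norm a + 1)"
    have t: "t > 0" "norm (t *\<^sub>R a) \<le> e"
      using e(1) by (auto simp: t_def field_simps add_pos_nonneg)
    then have "order_ball b 1 (t *\<^sub>R a)" using e(2)[of _ 1] by simp
    from order_ball_scale[OF this, of "1/t"] t have "order_ball b (1/t) a" by simp
    then have "a \<sqsubseteq> (1/t) *\<^sub>R b" by (simp add: order_ball_def le_def)
    moreover have "(1/t) *\<^sub>R b \<sqsubseteq> max 1 (1/t) *\<^sub>R b" using b C_K by (intro le_scalar) auto
    ultimately have "a \<sqsubseteq> max 1 (1/t) *\<^sub>R b" by (rule le_trans)
    then show ?thesis by (intro exI[of _ "max 1 (1/t)"]) simp
  qed
  from this[OF assms(1), of y] this[OF assms(2), of x] obtain R S where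
    "R \<ge> 1" "S \<ge> 1" "y \<sqsubseteq> R *\<^sub>R x" "x \<sqsubseteq> S *\<^sub>R y" by blast
  moreover have "R *\<^sub>R x \<sqsubseteq> max R S *\<^sub>R x" "S *\<^sub>R y \<sqsubseteq> max R S *\<^sub>R y"
    using assms C_K by (auto intro!: le_scalar)
  ultimately have "y \<sqsubseteq> max R S *\<^sub>R x" "x \<sqsubseteq> max R S *\<^sub>R y"
    using le_trans[of y "R *\<^sub>R x"] le_trans[of x "S *\<^sub>R y"] by blast+
  with \<open>R \<ge> 1\<close> show ?thesis unfolding comparable_def by (intro exI[of _ "max R S"]) simp
qed

text \<open>Strict convexity makes boundary rays extreme: \<open>z\<close> and
  \<open>R *\<^sub>R q - z\<close> lie in \<open>K\<close> and their sum is a boundary vector, so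
  \<open>strict\<close> makes them parallel unless the second one vanishes.\<close>

lemma extreme_ray: assumes "q \<in> K" "q \<notin> C" "z \<in> K" "z \<noteq> 0" "z \<sqsubseteq> R *\<^sub>R q" "R > 0" "q \<noteq> 0"
  shows "\<exists>t>0. z = t *\<^sub>R q"
proof (cases "R *\<^sub>R q - z = 0")
  case False
  have "R *\<^sub>R q \<notin> C" using scale_C[of "R *\<^sub>R q" "1 / R"] assms by auto
  then obtain k where k: "k > 0" "R *\<^sub>R q - z = k *\<^sub>R z"
    using strict[of z "R *\<^sub>R q - z"] assms False by (auto simp: le_def)
  then have "R *\<^sub>R q = (1 + k) *\<^sub>R z" by (simp add: algebra_simps)
  then have "z = (R / (1 + k)) *\<^sub>R q"
    using k by (metis add_pos_pos divide_inverse_commute less_numeral_extra(3) scaleR_one scaleR_scaleR left_inverse zero_less_one)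
  then show ?thesis using k assms by (intro exI[of _ "R / (1 + k)"]) auto
qed (use assms in auto)

text \<open>The convex hull of the unit vectors of \<open>K\<close> avoids 0, because pointedness
  makes \<open>K - {0}\<close> convex; so it can be separated from 0. The functional provides the
  compact section of the cone in \<open>eigenvector_exists\<close>.\<close>

lemma positive_functional: "\<exists>f e. e > 0 \<and> (\<forall>v\<in>K. f \<bullet> v \<ge> e * norm v)"
proof -
  let ?S = "K \<inter> sphere 0 1"
  have "convex (K - {0})"
  proof (rule convexI)
    fix x y and u v :: real assume a: "x \<in> K - {0}" "y \<in> K - {0}" "0 \<le> u" "0 \<le> v" "u + v = 1"
    then have K: "u *\<^sub>R x \<in> K" "v *\<^sub>R y \<in> K" using scale_K by auto
    have "u *\<^sub>R x + v *\<^sub>R y \<noteq> 0"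
    proof
      assume z: "u *\<^sub>R x + v *\<^sub>R y = 0"
      then have "- (u *\<^sub>R x) = v *\<^sub>R y" by (simp add: minus_unique)
      then have "u *\<^sub>R x = 0" using pointed[of "u *\<^sub>R x"] K by simp
      then have "v *\<^sub>R y = 0" "u = 0" using z a by auto
      then show False using a by auto
    qed
    then show "u *\<^sub>R x + v *\<^sub>R y \<in> K - {0}" using add_K K by simp
  qed
  then have "convex hull ?S \<subseteq> K - {0}"
    by (intro hull_minimal) auto
  moreover have "compact ?S" by (intro closed_Int_compact) auto
  then have "closed (convex hull ?S)" by (intro compact_imp_closed compact_convex_hull)
  ultimately have "\<exists>f b. f \<noteq> 0 \<and> 0 < b \<and> (\<forall>x\<in>convex hull ?S. b < f \<bullet> x)"
    by (intro separating_hyperplane_closed_0 convex_convex_hull) auto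
  then obtain f b where f: "b > 0" "\<And>x. x \<in> convex hull ?S \<Longrightarrow> f \<bullet> x > b" by blast
  have "f \<bullet> v \<ge> b * norm v" if "v \<in> K" for v
  proof (cases "v = 0")
    case False
    have "(1 / norm v) *\<^sub>R v \<in> ?S" using that False scale_K by simp
    then have "f \<bullet> ((1 / norm v) *\<^sub>R v) > b" by (intro f(2) hull_inc)
    then show ?thesis using False by (simp add: field_simps)
  qed simp
  with f(1) show ?thesis by blast
qed

lemma segment_chain: assumes "x \<in> C" "z \<in> C"
  shows "\<exists>n y. y 0 = x \<and> y n = z \<and> (\<forall>i\<le>n. y i \<in> C) \<and> (\<forall>i<n. comparable 2 (y i) (y (Suc i)))"
proof -
  obtain M where M: "M \<ge> 1" "comparable M x z" using ex_comparable assms by blast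
  \<comment> \<open>With \<open>n\<close> at least \<open>2 * M\<close>, both \<open>z / n\<close>
    and \<open>2 * x / n\<close> are below every point of the segment in the order; these are the
    two bounds that the factor 2 needs.\<close>
  obtain n :: nat where n: "real n \<ge> 2 * M" using real_arch_simple by blast
  then have n0: "real n > 0" using M by linarith
  define y where "y i = (1 - real i / real n) *\<^sub>R x + (real i / real n) *\<^sub>R z" for i
  have K: "x \<in> K" "z \<in> K" using assms C_K by auto
  have yC: "y i \<in> C" if "i \<le> n" for i
    unfolding y_def using convexD[OF convex_C assms, of "1 - real i / real n" "real i / real n"] that n0 by simp
  have b: "x \<sqsubseteq> M *\<^sub>R y i" "z \<sqsubseteq> M *\<^sub>R y i" if "i \<le> n" for i
  proof -
    define t where "t = real i / real n"
    have t: "0 \<le> t" "t \<le> 1" using that n0 by (auto simp: t_def)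
    have xz: "x \<sqsubseteq> M *\<^sub>R z" "z \<sqsubseteq> M *\<^sub>R x" using M by (auto simp: comparable_def)
    have "(1 - t) *\<^sub>R x + t *\<^sub>R x \<sqsubseteq> (1 - t) *\<^sub>R (M *\<^sub>R x) + t *\<^sub>R (M *\<^sub>R z)"
      using t xz le_scalar[OF K(1), of 1 M] M by (intro le_add le_scale) auto
    then show "x \<sqsubseteq> M *\<^sub>R y i" by (simp add: y_def t_def[symmetric] algebra_simps)
    have "(1 - t) *\<^sub>R z + t *\<^sub>R z \<sqsubseteq> (1 - t) *\<^sub>R (M *\<^sub>R x) + t *\<^sub>R (M *\<^sub>R z)"
      using t xz le_scalar[OF K(2), of 1 M] M by (intro le_add le_scale) auto
    then show "z \<sqsubseteq> M *\<^sub>R y i" by (simp add: y_def t_def[symmetric] algebra_simps)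
  qed
  have "comparable 2 (y i) (y (Suc i))" if "i < n" for i
  proof -
    let ?w = "y i" and ?e = "1 / real n"
    have w: "?w \<in> K" using yC[of i] that C_K by simp
    have s: "y (Suc i) = ?w + ?e *\<^sub>R (z - x)"
      by (simp add: y_def add_divide_distrib algebra_simps)
    have "?e *\<^sub>R z \<sqsubseteq> ?e *\<^sub>R (M *\<^sub>R ?w)" using b(2)[of i] that by (intro le_scale) auto
    also have "\<dots> = (M / n) *\<^sub>R ?w" by simp
    also have "\<dots> \<sqsubseteq> 1 *\<^sub>R ?w" using n n0 M by (intro le_scalar w) (simp add: field_simps)
    finally have "1 *\<^sub>R ?w - ?e *\<^sub>R z \<in> K" by (simp add: le_def)
    moreover have "?e *\<^sub>R x \<in> K" using K n0 by (intro scale_K) auto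
    ultimately have "1 *\<^sub>R ?w - ?e *\<^sub>R z + ?e *\<^sub>R x \<in> K" by (rule add_K)
    then have 1: "y (Suc i) \<sqsubseteq> 2 *\<^sub>R ?w" unfolding le_def s
      by (rule back_subst[of "\<lambda>x. x \<in> K"]) (simp add: vec_eq_iff field_simps)
    have "(2 * ?e) *\<^sub>R x \<sqsubseteq> (2 * ?e) *\<^sub>R (M *\<^sub>R ?w)" using b(1)[of i] that by (intro le_scale) auto
    also have "\<dots> = (2 * M / n) *\<^sub>R ?w" by simp
    also have "\<dots> \<sqsubseteq> 1 *\<^sub>R ?w" using n n0 M by (intro le_scalar w) (simp add: field_simps)
    finally have "1 *\<^sub>R ?w - (2 * ?e) *\<^sub>R x \<in> K" by (simp add: le_def)
    moreover have "(2 * ?e) *\<^sub>R z \<in> K" using K n0 by (intro scale_K) auto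
    ultimately have "1 *\<^sub>R ?w - (2 * ?e) *\<^sub>R x + (2 * ?e) *\<^sub>R z \<in> K" by (rule add_K)
    then have 2: "?w \<sqsubseteq> 2 *\<^sub>R y (Suc i)" unfolding le_def s
      by (rule back_subst[of "\<lambda>x. x \<in> K"]) (simp add: vec_eq_iff field_simps)
    from 1 2 show ?thesis by (simp add: comparable_def)
  qed
  with yC show ?thesis using n0 by (intro exI[of _ n] exI[of _ y]) (simp add: y_def)
qed

end

section \<open>Discrete groups preserving a cone\<close>

lemma matrix_mult_add_right: "((A::real^3^3) + B) ** M = A ** M + B ** M"
  by (simp add: vec_eq_iff matrix_matrix_mult_def sum.distrib distrib_right)

definition mpow :: "real^3^3 \<Rightarrow> nat \<Rightarrow> real^3^3" where
  "mpow A n = ((**) A ^^ n) (mat 1)"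

lemma mpow_0 [simp]: "mpow A 0 = mat 1" by (simp add: mpow_def)

lemma mpow_Suc: "mpow A (Suc n) = A ** mpow A n" by (simp add: mpow_def)

lemma mpow_add: "mpow A (m + n) = mpow A m ** mpow A n"
  by (induction m) (simp_all add: mpow_Suc matrix_mul_assoc)

lemma mpow_eigen: "A *v x = a *\<^sub>R x \<Longrightarrow> mpow A n *v x = a ^ n *\<^sub>R x"
  by (induction n) (simp_all add: mpow_Suc matrix_vector_mul_assoc[symmetric] matrix_vector_mult_scaleR)

lemma matrix_mult_scaleR: fixes A B :: "real^3^3"
  shows "(c *\<^sub>R A) ** B = c *\<^sub>R (A ** B)" "A ** (c *\<^sub>R B) = c *\<^sub>R (A ** B)"
  by (simp_all add: vec_eq_iff matrix_matrix_mult_def sum_distrib_left mult_ac)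

lemma norm_matrix_vector_le: fixes M :: "real^3^3" shows "norm (M *v v) \<le> 3 * norm M * norm v"
proof -
  have "\<bar>(M *v v) $ i\<bar> \<le> norm M * norm v" for i
  proof -
    have "(M *v v) $ i = (M $ i) \<bullet> v" by (simp add: matrix_vector_mult_def inner_vec_def)
    also have "\<bar>\<dots>\<bar> \<le> norm (M $ i) * norm v" by (rule Cauchy_Schwarz_ineq2)
    also have "\<dots> \<le> norm M * norm v" by (intro mult_right_mono Finite_Cartesian_Product.norm_nth_le) simp
    finally show ?thesis .
  qed
  then have "(\<Sum>i\<in>UNIV. \<bar>(M *v v) $ i\<bar>) \<le> (\<Sum>i\<in>(UNIV::3 set). norm M * norm v)" by (intro sum_mono)
  also have "\<dots> = 3 * norm M * norm v" by simp
  finally show ?thesis using norm_le_l1_cart[of "M *v v"] by linarith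
qed

text \<open>Otherwise one more vector than the dimension would be independent.\<close>

lemma prefix_span: fixes X :: "nat \<Rightarrow> 'a::euclidean_space"
  shows "\<exists>k\<le>DIM('a). X k \<in> span (X ` {..<k})"
proof (rule ccontr)
  assume "\<not> ?thesis"
  then have n: "X k \<notin> span (X ` {..<k})" if "k \<le> DIM('a)" for k using that by blast
  have "independent (X ` {..<k}) \<and> card (X ` {..<k}) = k" if "k \<le> Suc DIM('a)" for k
    using that
  proof (induction k)
    case (Suc k)
    have "X k \<notin> X ` {..<k}" using n[of k] Suc span_base by (metis Suc_le_mono)
    then show ?case using Suc n[of k] by (simp add: lessThan_Suc independent_insert)
  qed (simp add: independent_empty)
  from this[of "Suc DIM('a)"] independent_bound[of "X ` {..<Suc DIM('a)}"] show False by simp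
qed

text \<open>\<open>map_C\<close> and \<open>det_G\<close> leave at most one matrix in each
  projective class. \<open>proper\<close> is discreteness in metric form: only finitely many
  elements move a given point by a bounded amount.\<close>

locale cone_group = strict_cone C for C +
  fixes G :: "(real^3^3) set"
  assumes one_G: "mat 1 \<in> G"
    and mult_G: "A \<in> G \<Longrightarrow> B \<in> G \<Longrightarrow> A ** B \<in> G"
    and inv_G: "A \<in> G \<Longrightarrow> \<exists>B\<in>G. A ** B = mat 1"
    and map_C: "A \<in> G \<Longrightarrow> x \<in> C \<Longrightarrow> A *v x \<in> C"
    and det_G: "A \<in> G \<Longrightarrow> \<bar>det A\<bar> = 1"
    and proper: "y \<in> C \<Longrightarrow> finite {A\<in>G. comparable R y (A *v y)}"
begin

section \<open>The action on the cone and its order\<close>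

definition minv :: "real^3^3 \<Rightarrow> real^3^3" where
  "minv A = (SOME B. B \<in> G \<and> A ** B = mat 1)"

lemma minv: assumes "A \<in> G" shows "minv A \<in> G" "A ** minv A = mat 1" "minv A ** A = mat 1"
proof -
  have "minv A \<in> G \<and> A ** minv A = mat 1"
    using inv_G[OF assms] unfolding minv_def by (metis (mono_tags, lifting) someI_ex)
  then show "minv A \<in> G" "A ** minv A = mat 1" "minv A ** A = mat 1"
    using matrix_left_right_inverse[of A "minv A"] by auto
qed

lemma minv_vec: assumes "A \<in> G" shows "A *v (minv A *v x) = x" "minv A *v (A *v x) = x"
  using minv[OF assms] by (simp_all add: matrix_vector_mul_assoc)

lemma mpow_G: "A \<in> G \<Longrightarrow> mpow A n \<in> G"
  by (induction n) (auto simp: mpow_Suc one_G mult_G)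

lemma map_K: assumes "A \<in> G" "x \<in> K" shows "A *v x \<in> K"
proof -
  have "(*v) A ` K \<subseteq> K"
    using assms map_C C_K by (intro image_closure_subset continuous_intros) auto
  then show ?thesis using assms by auto
qed

lemma map_le: "A \<in> G \<Longrightarrow> x \<sqsubseteq> y \<Longrightarrow> A *v x \<sqsubseteq> A *v y"
  using map_K[of A "y - x"] by (simp add: le_def matrix_vector_mult_diff_distrib)

lemma map_order_ball: "A \<in> G \<Longrightarrow> order_ball y l v \<Longrightarrow> order_ball (A *v y) l (A *v v)"
  using map_K[of A "l *\<^sub>R y - v"] map_K[of A "l *\<^sub>R y + v"]
  by (simp add: order_ball_def matrix_vector_mult_diff_distrib matrix_vector_right_distrib matrix_vector_mult_scaleR)

lemma map_comparable: "A \<in> G \<Longrightarrow> comparable R x y \<Longrightarrow> comparable R (A *v x) (A *v y)"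
  using map_le[of A x "R *\<^sub>R y"] map_le[of A y "R *\<^sub>R x"] by (simp add: comparable_def matrix_vector_mult_scaleR)

text \<open>\<open>A\<close> maps the order interval of \<open>y\<close> into \<open>R\<close> times
  itself while preserving volume.\<close>

lemma upper_ge_1: assumes "A \<in> G" "y \<in> C" "A *v y \<sqsubseteq> R *\<^sub>R y" shows "R \<ge> 1"
proof (rule det_le[OF assms(2)])
  show "R > 0" using scalar_pos[OF map_C[OF assms(1,2)] _ assms(3)] C_K assms by auto
  show "order_ball y R (A *v v)" if "order_ball y 1 v" for v
    using order_ball_le[OF assms(3) map_order_ball[OF assms(1) that]] by simp
qed (use det_G assms in auto)

lemma lower_le_1: assumes "A \<in> G" "y \<in> C" "r *\<^sub>R y \<sqsubseteq> A *v y" shows "r \<le> 1"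
proof (cases "r > 0")
  case True
  have "r *\<^sub>R (minv A *v y) \<sqsubseteq> y"
    using map_le[OF minv(1)[OF assms(1)] assms(3)] assms by (simp add: minv_vec matrix_vector_mult_scaleR)
  from le_scale[OF this, of "1/r"] True have "minv A *v y \<sqsubseteq> (1/r) *\<^sub>R y" by simp
  from upper_ge_1[OF minv(1)[OF assms(1)] assms(2) this] True show ?thesis by simp
qed simp

text \<open>The volume bounds for \<open>A\<close> pin the unknown scale \<open>s\<close> between
  \<open>1 / R\<close> and \<open>R\<close>, which costs a second factor \<open>R\<close>.\<close>

lemma comparable_normalize: assumes "A \<in> G" "y \<in> C" "s > 0" "R \<ge> 1" "comparable R (s *\<^sub>R y) (A *v y)"
  shows "comparable (R\<^sup>2) y (A *v y)"
proof -
  have 1: "A *v y \<sqsubseteq> (R * s) *\<^sub>R y" using assms by (simp add: comparable_def)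
  have "s *\<^sub>R y \<sqsubseteq> R *\<^sub>R (A *v y)" using assms by (simp add: comparable_def)
  from le_scale[OF this, of "1/R"] assms have 2: "(s / R) *\<^sub>R y \<sqsubseteq> A *v y" by simp
  have 3: "R * s \<ge> 1" "s / R \<le> 1" using upper_ge_1[OF _ _ 1] lower_le_1[OF _ _ 2] assms by auto
  have "R * s \<le> R\<^sup>2" using 3 assms by (simp add: field_simps power2_eq_square)
  with 1 have a: "A *v y \<sqsubseteq> R\<^sup>2 *\<^sub>R y"
    using le_trans[OF 1 le_scalar[of y "R * s" "R\<^sup>2"]] C_K assms by auto
  have "y \<sqsubseteq> (R / s) *\<^sub>R (A *v y)"
    using le_scale[OF 2, of "R / s"] assms by simp
  moreover have "R / s \<le> R\<^sup>2" using 3 assms by (simp add: field_simps power2_eq_square)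
  ultimately have "y \<sqsubseteq> R\<^sup>2 *\<^sub>R (A *v y)"
    using le_trans[OF _ le_scalar[of "A *v y" "R / s" "R\<^sup>2"]] C_K map_C assms by auto
  with a show ?thesis by (simp add: comparable_def)
qed

text \<open>The operator norm of \<open>f\<close> with respect to the order-unit norm of \<open>y\<close> is at most \<open>k\<close>.\<close>

definition op_bound :: "real^3 \<Rightarrow> real \<Rightarrow> (real^3 \<Rightarrow> real^3) \<Rightarrow> bool" where
  "op_bound y k f \<longleftrightarrow> (\<forall>l v. order_ball y l v \<longrightarrow> order_ball y (k * l) (f v))"

section \<open>Displacements, commutators and core elements\<close>

abbreviation displ :: "real^3^3 \<Rightarrow> real^3 \<Rightarrow> real^3" where
  "displ A v \<equiv> A *v v - v"

lemma op_bound_mono: "op_bound y k f \<Longrightarrow> k \<le> m \<Longrightarrow> y \<in> C \<Longrightarrow> op_bound y m f"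
  unfolding op_bound_def by (meson C_K mult_right_mono order_ball_mono order_ball_nonneg)

text \<open>One factor \<open>R\<close> is paid for measuring the argument at the new point, another
  for measuring the value.\<close>

lemma op_bound_comparable: assumes "op_bound y k f" "comparable R y z" "y \<in> C" "z \<in> C" "k \<ge> 0" "R \<ge> 0" shows "op_bound z (R\<^sup>2 * k) f"
  unfolding op_bound_def
proof (intro allI impI)
  fix l v assume v: "order_ball z l v"
  have l: "l \<ge> 0" using order_ball_nonneg v assms by blast
  have "order_ball y (R * l) v" using order_ball_le[OF _ v l] assms by (simp add: comparable_def)
  then have "order_ball y (k * (R * l)) (f v)" using assms by (simp add: op_bound_def)
  then have "order_ball z (R * (k * (R * l))) (f v)" using order_ball_le[of y R z] assms l by (simp add: comparable_def)
  then show "order_ball z (R\<^sup>2 * k * l) (f v)" by (simp add: power2_eq_square algebra_simps)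
qed

lemma displ_bounds: assumes "op_bound y k (displ A)" "y \<in> C"
  shows "(1 - k) *\<^sub>R y \<sqsubseteq> A *v y" "A *v y \<sqsubseteq> (1 + k) *\<^sub>R y"
proof -
  have "order_ball y 1 y" using zero_K scale_K[of y 2] assms C_K by (auto simp: order_ball_def scaleR_2)
  then have "order_ball y (k * 1) (displ A y)" using assms unfolding op_bound_def by blast
  then show "(1 - k) *\<^sub>R y \<sqsubseteq> A *v y" "A *v y \<sqsubseteq> (1 + k) *\<^sub>R y"
    by (auto simp: order_ball_def le_def algebra_simps)
qed

lemma displ_comparable: assumes "op_bound y k (displ A)" "y \<in> C" "k \<le> 1/2" "A \<in> G" shows "comparable 2 y (A *v y)"
proof -
  have "(1/2) *\<^sub>R y \<sqsubseteq> (1 - k) *\<^sub>R y" "(1 + k) *\<^sub>R y \<sqsubseteq> 2 *\<^sub>R y"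
    using assms C_K by (auto intro!: le_scalar)
  with displ_bounds[OF assms(1,2)] have "(1/2) *\<^sub>R y \<sqsubseteq> A *v y" "A *v y \<sqsubseteq> 2 *\<^sub>R y"
    by (blast intro: le_trans)+
  then show ?thesis using le_scale[of "(1/2) *\<^sub>R y" "A *v y" 2] by (simp add: comparable_def)
qed

lemma minv_order_ball: assumes "op_bound y k (displ A)" "y \<in> C" "k \<le> 1/2" "A \<in> G" "order_ball y l v"
  shows "order_ball y (2 * l) (minv A *v v)"
proof -
  have "y \<sqsubseteq> 2 *\<^sub>R (A *v y)" using displ_comparable[OF assms(1-4)] by (simp add: comparable_def)
  then have "minv A *v y \<sqsubseteq> 2 *\<^sub>R y"
    using map_le[OF minv(1)[OF assms(4)]] minv_vec[OF assms(4)] by (metis matrix_vector_mult_scaleR)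
  from order_ball_le[OF this map_order_ball[OF minv(1)[OF assms(4)] assms(5)]] order_ball_nonneg[OF assms(2,5)]
  show ?thesis by simp
qed

text \<open>Writing \<open>N = A - 1\<close> and \<open>N' = B - 1\<close>, the commutator minus 1
  equals \<open>(N N' - N' N)\<close> times the two inverses. The bracket contributes
  \<open>2 * a * b\<close>, and each inverse has norm at most 2.\<close>

lemma commutator_bound:
  assumes "op_bound y a (displ A)" "op_bound y b (displ B)" "y \<in> C" "a \<le> 1/2" "b \<le> 1/2" "A \<in> G" "B \<in> G"
  shows "op_bound y (8 * a * b) (displ (A ** B ** minv A ** minv B))"
  unfolding op_bound_def
proof (intro allI impI)
  fix l v assume v: "order_ball y l v"
  define w where "w = minv A *v (minv B *v v)"
  have w: "order_ball y (4 * l) w"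
    using minv_order_ball[OF assms(1,3,4,6) minv_order_ball[OF assms(2,3,5,7) v]] by (simp add: w_def)
  have Bw: "B *v (A *v w) = v" by (simp add: w_def minv_vec assms)
  have "order_ball y (a * (b * (4 * l))) (displ A (displ B w))" "order_ball y (b * (a * (4 * l))) (displ B (displ A w))"
    using assms w unfolding op_bound_def by blast+
  from order_ball_diff[OF this] have "order_ball y (8 * a * b * l) (displ A (displ B w) - displ B (displ A w))"
    by (simp add: algebra_simps)
  also have "displ A (displ B w) - displ B (displ A w) = A *v (B *v w) - B *v (A *v w)"
    by (simp add: algebra_simps)
  also have "\<dots> = displ (A ** B ** minv A ** minv B) v"
    by (simp add: Bw) (simp add: w_def matrix_vector_mul_assoc matrix_mul_assoc)
  finally show "order_ball y (8 * a * b * l) (displ (A ** B ** minv A ** minv B) v)" .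
qed

lemma op_bound_zero: assumes "\<And>n::nat. op_bound y (c / 2 ^ n) (displ A)" "y \<in> C" shows "A = mat 1"
proof -
  have "displ A v = 0" for v
  proof -
    obtain e where e: "e > 0" "\<And>v l. norm v \<le> e * l \<Longrightarrow> order_ball y l v"
      using ex_order_ball[OF assms(2)] by blast
    define l where "l = norm v / e"
    have "order_ball y l v" using e by (intro e(2)) (simp add: l_def)
    then have "order_ball y ((c * l) / 2 ^ n) (displ A v)" for n
      using assms(1)[of n] unfolding op_bound_def by (metis times_divide_eq_left)
    then show ?thesis by (rule order_ball_zero)
  qed
  then show ?thesis by (auto simp: matrix_eq)
qed

lemma finite_small: assumes "y \<in> C" "k \<le> 1/2" shows "finite {A\<in>G. op_bound y k (displ A)}"
  by (rule finite_subset[OF _ proper[OF assms(1), of 2]]) (auto intro: displ_comparable[OF _ assms(1,2)])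

definition small :: "real^3 \<Rightarrow> real \<Rightarrow> real^3^3 \<Rightarrow> bool" where
  "small y k A \<longleftrightarrow> A \<in> G \<and> A \<noteq> mat 1 \<and> op_bound y k (displ A)"

text \<open>The threshold \<open>1/16\<close> is independent of \<open>k\<close>: this leaves room
  for elements that grow under conjugation or under a change of the base point.\<close>

definition core :: "real^3 \<Rightarrow> real \<Rightarrow> real^3^3 \<Rightarrow> bool" where
  "core y k A \<longleftrightarrow> small y k A \<and> (\<forall>X\<in>G. op_bound y (1/16) (displ X) \<longrightarrow> A ** X = X ** A)"

text \<open>Properness leaves finitely many candidates, and each nontrivial one is excluded at some
  dyadic scale. Hence any prescribed point becomes thick once the threshold is lowered
  enough.\<close>

lemma not_small: assumes "y \<in> C" "k \<le> 1/2" "k > 0" shows "\<exists>n::nat. \<nexists>A. small y (k / 2 ^ n) A"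
proof -
  let ?S = "{A\<in>G. op_bound y k (displ A)} - {mat 1}"
  have dec: "op_bound y (k / 2 ^ n) (displ A) \<Longrightarrow> m \<le> n \<Longrightarrow> op_bound y (k / 2 ^ m) (displ A)" for A and m n :: nat
    by (erule op_bound_mono) (use assms in \<open>auto intro!: divide_left_mono power_increasing\<close>)
  have "\<forall>A\<in>?S. \<exists>n. \<not> op_bound y (k / 2 ^ n) (displ A)"
  proof
    fix A assume "A \<in> ?S"
    then have "A \<noteq> mat 1" by simp
    then show "\<exists>n. \<not> op_bound y (k / 2 ^ n) (displ A)" using op_bound_zero[OF _ assms(1), of k A] by auto
  qed
  from bchoice[OF this] obtain N where N: "\<And>A. A \<in> ?S \<Longrightarrow> \<not> op_bound y (k / 2 ^ (N A)) (displ A)" by blast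
  have fin: "finite ?S" using finite_small assms by simp
  have "\<not> small y (k / 2 ^ (Max (N ` ?S))) A" for A
  proof
    assume "small y (k / 2 ^ (Max (N ` ?S))) A"
    then have b: "A \<in> G" "A \<noteq> mat 1" "op_bound y (k / 2 ^ (Max (N ` ?S))) (displ A)"
      unfolding small_def by auto
    have "op_bound y k (displ A)" using dec[OF b(3), of 0] by simp
    with b have S: "A \<in> ?S" by simp
    have "N A \<le> Max (N ` ?S)" by (rule Max_ge) (use fin S in auto)
    from dec[OF b(3) this] N[OF S] show False by simp
  qed
  then show ?thesis by blast
qed

text \<open>An element that is smallest up to a factor \<open>2\<close>: its commutator with an element of size
  \<open>1/16\<close> is at most half as large, hence trivial.\<close>

lemma core_exists: assumes "small y k A0" "y \<in> C" "k \<le> 1/16" "k > 0" shows "\<exists>A. core y k A"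
proof -
  define P where "P n \<longleftrightarrow> (\<exists>A. small y (k / 2 ^ n) A)" for n :: nat
  have "\<exists>n. \<not> P n" using not_small[of y k] assms by (simp add: P_def)
  moreover have "P 0" using assms unfolding P_def by auto
  ultimately have "\<exists>n. P n \<and> \<not> P (Suc n)" using nat_induct[of P] by blast
  then obtain n A where n: "\<not> P (Suc n)" and A: "small y (k / 2 ^ n) A" unfolding P_def by blast
  have kn: "k / 2 ^ n \<le> k" "k / 2 ^ n > 0" using assms by (simp_all add: field_simps)
  have "A ** X = X ** A" if X: "X \<in> G" "op_bound y (1/16) (displ X)" for X
  proof -
    let ?Z = "A ** X ** minv A ** minv X"
    have "k / 2 ^ n \<le> 1/2" using kn assms by linarith
    \<comment> \<open>Here \<open>8 * (1/16) = 1/2\<close>, so the commutator drops to the scale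
      \<open>Suc n\<close>, at which only the identity is left.\<close>
    then have "op_bound y (8 * (k / 2 ^ n) * (1/16)) (displ ?Z)"
      using A X assms(2) unfolding small_def by (intro commutator_bound) simp_all
    then have "op_bound y (k / 2 ^ Suc n) (displ ?Z)" by (simp add: field_simps)
    moreover have "?Z \<in> G" using A X minv mult_G by (auto simp: small_def)
    ultimately have "?Z = mat 1" using n by (auto simp: P_def small_def)
    then have "?Z ** X ** A = X ** A" by simp
    moreover have "?Z ** X ** A = A ** X ** minv A ** (minv X ** X) ** A" by (simp only: matrix_mul_assoc)
    moreover have "\<dots> = A ** X ** (minv A ** A)" using minv[OF X(1)] by (simp add: matrix_mul_assoc)
    ultimately show ?thesis using minv A by (simp add: small_def)
  qed
  moreover have "small y k A" using A op_bound_mono[OF _ kn(1) assms(2), of "displ A"] by (simp add: small_def)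
  ultimately have "core y k A" by (simp add: core_def)
  then show ?thesis by blast
qed

text \<open>\<open>B\<close> translates the segment from \<open>p\<close> to \<open>q\<close> towards \<open>q\<close> by the Hilbert distance \<open>ln (b / a) / 2\<close>.\<close>

definition hyperbolic :: "real^3^3 \<Rightarrow> real^3 \<Rightarrow> real^3 \<Rightarrow> real \<Rightarrow> real \<Rightarrow> bool" where
  "hyperbolic B p q a b \<longleftrightarrow> B \<in> G \<and> p \<in> K \<and> q \<in> K \<and> p \<noteq> 0 \<and> q \<noteq> 0 \<and> p + q \<in> C \<and>
     B *v p = a *\<^sub>R p \<and> B *v q = b *\<^sub>R q \<and> 0 < a \<and> a < b"

section \<open>Dynamics of hyperbolic elements and uniqueness of the axis\<close>

lemma mpow_hyperbolic: "hyperbolic B p q a b \<Longrightarrow> mpow B n *v (p + q) = a ^ n *\<^sub>R p + b ^ n *\<^sub>R q"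
  by (simp add: hyperbolic_def matrix_vector_right_distrib mpow_eigen)

lemma mpow_hyperbolic_norm: assumes "hyperbolic B p q a b"
  shows "(1 / b ^ n) *\<^sub>R (mpow B n *v (p + q)) = (a / b) ^ n *\<^sub>R p + q"
  using assms by (simp add: mpow_hyperbolic[OF assms] scaleR_add_right power_divide) (simp add: hyperbolic_def)

lemma ratio_tendsto: assumes "hyperbolic B p q a b" shows "(\<lambda>n. (a / b) ^ n) \<longlonglongrightarrow> 0"
  using assms by (intro LIMSEQ_realpow_zero) (auto simp: hyperbolic_def)

lemma minv_eigen: "B \<in> G \<Longrightarrow> B *v p = a *\<^sub>R p \<Longrightarrow> a \<noteq> 0 \<Longrightarrow> minv B *v p = (1 / a) *\<^sub>R p"
  using minv_vec(2)[of B "(1 / a) *\<^sub>R p"] by (simp add: matrix_vector_mult_scaleR)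

lemma hyperbolic_minv: assumes "hyperbolic B p q a b" shows "hyperbolic (minv B) q p (1 / b) (1 / a)"
  using assms minv_eigen[of B p a] minv_eigen[of B q b] minv(1)[of B]
  by (auto simp: hyperbolic_def add.commute frac_less2)

text \<open>No vector of \<open>C\<close> grows more slowly than \<open>b ^ n\<close>: a multiple of
  \<open>y\<close> dominates \<open>p + q\<close>, whose rescaled images tend to \<open>q\<close>
  and not to 0.\<close>

lemma no_decay: assumes h: "hyperbolic B p q a b" and y: "y \<in> C"
    and lim: "(\<lambda>n. (1 / b ^ n) *\<^sub>R (mpow B n *v y)) \<longlonglongrightarrow> 0"
  shows False
proof -
  have B: "B \<in> G" and b: "b > 0" and pq: "p + q \<in> C" and q: "q \<in> K" "q \<noteq> 0" using h by (auto simp: hyperbolic_def)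
  obtain R where "R \<ge> 1" "comparable R (p + q) y" using ex_comparable pq y by blast
  then have le: "p + q \<sqsubseteq> R *\<^sub>R y" by (simp add: comparable_def)
  have "R *\<^sub>R ((1 / b ^ n) *\<^sub>R (mpow B n *v y)) - ((a / b) ^ n *\<^sub>R p + q) \<in> K" for n
    using le_scale[OF map_le[OF mpow_G[OF B, of n] le], of "1 / b ^ n"] b
    unfolding matrix_vector_mult_scaleR mpow_hyperbolic_norm[OF h, symmetric] by (simp add: le_def mult.commute)
  moreover have "(\<lambda>n. R *\<^sub>R ((1 / b ^ n) *\<^sub>R (mpow B n *v y)) - ((a / b) ^ n *\<^sub>R p + q)) \<longlonglongrightarrow>
      R *\<^sub>R 0 - (0 *\<^sub>R p + q)"
    by (intro tendsto_intros lim ratio_tendsto[OF h])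
  ultimately have "- q \<in> K" using lim_K by fastforce
  with pointed q show False by blast
qed

lemma no_eigen_lt: assumes "hyperbolic B p q a b" "y \<in> C" "B *v y = c *\<^sub>R y" "0 < c" "c < b" shows False
proof (rule no_decay[OF assms(1,2)])
  have "(1 / b ^ n) *\<^sub>R (mpow B n *v y) = (c / b) ^ n *\<^sub>R y" for n
    using assms by (simp add: mpow_eigen[OF assms(3)] power_divide)
  moreover have "(\<lambda>n. (c / b) ^ n *\<^sub>R y) \<longlonglongrightarrow> 0 *\<^sub>R y"
    using assms by (intro tendsto_intros LIMSEQ_realpow_zero) auto
  ultimately show "(\<lambda>n. (1 / b ^ n) *\<^sub>R (mpow B n *v y)) \<longlonglongrightarrow> 0" by simp
qed

text \<open>By growth the eigenvalue \<open>c\<close> would have to be at least \<open>b\<close>,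
  and by the same argument for the inverse at most \<open>a\<close>.\<close>

lemma no_eigen: assumes "hyperbolic B p q a b" "y \<in> C" "B *v y = c *\<^sub>R y" shows False
proof -
  have B: "B \<in> G" and ab: "0 < a" "a < b" using assms by (auto simp: hyperbolic_def)
  have c: "c > 0"
    using scalar_pos[OF map_C[OF B assms(2)], of y c] assms C_K by simp
  show False
  proof (cases "c < b")
    case False
    then have "1 / c < 1 / a" using ab c by (simp add: frac_less2)
    then show False
      using no_eigen_lt[OF hyperbolic_minv[OF assms(1)] assms(2) minv_eigen[OF B assms(3)]] c by simp
  qed (use no_eigen_lt assms c in blast)
qed

lemma hyperbolic_ends: assumes "hyperbolic B p q a b" shows "p \<notin> C" "q \<notin> C"
  using no_eigen[OF assms] assms by (auto simp: hyperbolic_def)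

text \<open>If \<open>b' < b\<close>, the images of the vector \<open>p' + q'\<close> of
  \<open>C\<close>, divided by \<open>b ^ n\<close>, would tend to 0, against
  \<open>no_decay\<close>.\<close>

lemma axis_exponents: assumes "hyperbolic B p q a b" "hyperbolic B p' q' a' b'" shows "b \<le> b'"
proof (rule ccontr)
  assume "\<not> b \<le> b'"
  then have lt: "0 < a'" "a' < b" "b' < b" "a' < b'" using assms by (auto simp: hyperbolic_def)
  have "(1 / b ^ n) *\<^sub>R (mpow B n *v (p' + q')) = (a' / b) ^ n *\<^sub>R p' + (b' / b) ^ n *\<^sub>R q'" for n
    using lt by (simp add: mpow_hyperbolic[OF assms(2)] scaleR_add_right power_divide)
  moreover have "(\<lambda>n. (a' / b) ^ n *\<^sub>R p' + (b' / b) ^ n *\<^sub>R q') \<longlonglongrightarrow> 0 *\<^sub>R p' + 0 *\<^sub>R q'"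
    using lt by (intro tendsto_intros LIMSEQ_realpow_zero) auto
  ultimately have "(\<lambda>n. (1 / b ^ n) *\<^sub>R (mpow B n *v (p' + q'))) \<longlonglongrightarrow> 0" by simp
  with no_decay[OF assms(1)] assms(2) show False by (auto simp: hyperbolic_def)
qed

text \<open>The sum \<open>u + v\<close> is again an eigenvector, hence outside \<open>C\<close> by
  \<open>no_eigen\<close>, and \<open>strict\<close> applies.\<close>

lemma eigen_ray: assumes "hyperbolic B p q a b" "u \<in> K" "v \<in> K" "u \<noteq> 0" "v \<noteq> 0" "B *v u = c *\<^sub>R u" "B *v v = c *\<^sub>R v"
  shows "\<exists>s>0. v = s *\<^sub>R u"
proof (rule strict)
  have "B *v (u + v) = c *\<^sub>R (u + v)" using assms by (simp add: matrix_vector_right_distrib scaleR_add_right)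
  then show "u + v \<notin> C" using no_eigen[OF assms(1)] by blast
qed (use assms in auto)

text \<open>Growth rates compared in both directions give \<open>b' = b\<close>, and those of the
  inverses give \<open>a' = a\<close>. It follows that a closed geodesic is determined by the matrix
  alone.\<close>

lemma axis_unique: assumes "hyperbolic B p q a b" "hyperbolic B p' q' a' b'"
  shows "a' = a" "b' = b" "\<exists>s>0. p' = s *\<^sub>R p" "\<exists>t>0. q' = t *\<^sub>R q"
proof -
  show b: "b' = b" using axis_exponents assms by (meson order_antisym)
  have "1 / a \<le> 1 / a'" "1 / a' \<le> 1 / a" using axis_exponents hyperbolic_minv assms by blast+
  then show a: "a' = a" by simp
  show "\<exists>s>0. p' = s *\<^sub>R p" "\<exists>t>0. q' = t *\<^sub>R q"
    using eigen_ray[OF assms(1), of p p' a] eigen_ray[OF assms(1), of q q' b] assms a b by (auto simp: hyperbolic_def)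
qed

lemma inj_G: "A \<in> G \<Longrightarrow> A *v x = 0 \<longleftrightarrow> x = 0"
  by (metis matrix_vector_mult_0_right minv_vec(2))

lemma hyperbolic_conj: assumes "hyperbolic B p q a b" "A \<in> G" shows "hyperbolic (A ** B ** minv A) (A *v p) (A *v q) a b"
proof -
  have "A ** B ** minv A *v (A *v x) = A *v (B *v x)" for x
    using assms minv_vec[of A] by (simp add: matrix_vector_mul_assoc[symmetric])
  then show ?thesis using assms minv(1)[of A] map_K[of A] map_C[of A "p + q"] mult_G inj_G[of A]
    by (auto simp: hyperbolic_def matrix_vector_mult_scaleR matrix_vector_right_distrib)
qed

text \<open>Conjugation by \<open>A\<close> carries the axis of \<open>B\<close> to its image under
  \<open>A\<close> but leaves \<open>B\<close> unchanged.\<close>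

lemma comm_axis: assumes "hyperbolic B p q a b" "A \<in> G" "A ** B = B ** A"
  shows "\<exists>s>0. A *v p = s *\<^sub>R p" "\<exists>t>0. A *v q = t *\<^sub>R q"
proof -
  have "A ** B ** minv A = B"
    using assms minv[of A] by (metis matrix_mul_assoc matrix_mul_rid)
  with hyperbolic_conj[OF assms(1,2)] have "hyperbolic B (A *v p) (A *v q) a b" by simp
  from axis_unique(3,4)[OF assms(1) this] show "\<exists>s>0. A *v p = s *\<^sub>R p" "\<exists>t>0. A *v q = t *\<^sub>R q" .
qed

lemma hyperbolic_mpow: assumes "hyperbolic B p q a b" "n > 0" shows "hyperbolic (mpow B n) p q (a ^ n) (b ^ n)"
  using assms mpow_G[of B n] by (auto simp: hyperbolic_def mpow_eigen power_strict_mono)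

text \<open>An element fixing the end \<open>q\<close> of the axis of \<open>B\<close> moves the points \<open>mpow B n *v (p + q)\<close> by a
  bounded amount, so by discreteness its conjugates by the powers of \<open>B\<close> repeat.\<close>

lemma fix_end_commutes: assumes h: "hyperbolic B p q a b" and A: "A \<in> G" and Aq: "A *v q = k *\<^sub>R q" "k > 0"
  shows "\<exists>n>0. A ** mpow B n = mpow B n ** A"
proof -
  let ?x = "\<lambda>n. mpow B n *v (p + q)"
  have B: "B \<in> G" and ab: "0 < a" "a < b" and pq: "p + q \<in> C" and K: "p \<in> K" "q \<in> K"
    using h by (auto simp: hyperbolic_def)
  have bound: "\<exists>R\<ge>0. \<forall>n. A *v ?x n \<sqsubseteq> R *\<^sub>R ?x n" if A: "A \<in> G" "A *v q = k *\<^sub>R q" "k > 0" for A k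
  proof -
    obtain R where R: "R \<ge> 1" "comparable R (A *v (p + q)) (p + q)"
      using ex_comparable map_C[OF A(1) pq] pq by blast
    have "A *v p \<sqsubseteq> A *v (p + q)" using map_K[OF A(1) K(2)] by (simp add: le_def matrix_vector_right_distrib)
    also have "\<dots> \<sqsubseteq> R *\<^sub>R (p + q)" using R by (simp add: comparable_def)
    finally have Ap: "A *v p \<sqsubseteq> R *\<^sub>R (p + q)" .
    have "A *v ?x n \<sqsubseteq> (R + k) *\<^sub>R ?x n" for n
    proof -
      have "A *v ?x n = a ^ n *\<^sub>R (A *v p) + (k * b ^ n) *\<^sub>R q"
        unfolding mpow_hyperbolic[OF h] by (simp add: A matrix_vector_right_distrib matrix_vector_mult_scaleR mult.commute)
      also have "\<dots> \<sqsubseteq> a ^ n *\<^sub>R (R *\<^sub>R (p + q)) + (k * b ^ n) *\<^sub>R q"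
        using ab A by (intro le_add le_scale Ap) auto
      also have "\<dots> = (R * a ^ n) *\<^sub>R p + (R * a ^ n + k * b ^ n) *\<^sub>R q"
        by (simp add: algebra_simps)
      also have "\<dots> \<sqsubseteq> ((R + k) * a ^ n) *\<^sub>R p + ((R + k) * b ^ n) *\<^sub>R q"
      proof (intro le_add le_scalar K)
        have "a ^ n \<le> b ^ n" using ab by (intro power_mono) auto
        then have "R * a ^ n \<le> R * b ^ n" using R by (intro mult_left_mono) auto
        then show "R * a ^ n + k * b ^ n \<le> (R + k) * b ^ n" by (simp add: algebra_simps)
        show "R * a ^ n \<le> (R + k) * a ^ n" using ab A by (intro mult_right_mono) auto
      qed
      also have "\<dots> = (R + k) *\<^sub>R ?x n" unfolding mpow_hyperbolic[OF h] by (simp add: algebra_simps)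
      finally show ?thesis .
    qed
    then show ?thesis using R A by (intro exI[of _ "R + k"]) auto
  qed
  obtain R where R: "R \<ge> 0" "\<And>n. A *v ?x n \<sqsubseteq> R *\<^sub>R ?x n" using bound[OF A Aq] by blast
  obtain S where S: "S \<ge> 0" "\<And>n. minv A *v ?x n \<sqsubseteq> S *\<^sub>R ?x n"
    using bound[OF minv(1)[OF A] minv_eigen[OF A Aq(1)]] Aq by auto
  have xK: "?x n \<in> K" "A *v ?x n \<in> K" for n
    using map_C[OF mpow_G[OF B]] pq C_K map_K[OF A] by blast+
  let ?R = "max R S"
  have comparable: "comparable ?R (?x n) (A *v ?x n)" for n
  proof -
    have "?x n \<sqsubseteq> S *\<^sub>R (A *v ?x n)"
      using map_le[OF A S(2)[of n]] by (simp add: minv_vec[OF A] matrix_vector_mult_scaleR)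
    also have "\<dots> \<sqsubseteq> ?R *\<^sub>R (A *v ?x n)" by (intro le_scalar xK) simp
    finally have "?x n \<sqsubseteq> ?R *\<^sub>R (A *v ?x n)" .
    moreover have "R *\<^sub>R ?x n \<sqsubseteq> ?R *\<^sub>R ?x n" by (intro le_scalar xK) simp
    with R(2)[of n] have "A *v ?x n \<sqsubseteq> ?R *\<^sub>R ?x n" by (rule le_trans)
    ultimately show ?thesis by (simp add: comparable_def)
  qed
  \<comment> \<open>Conjugating back transports the estimate from \<open>?x n\<close> to the single
    point \<open>p + q\<close>, where \<open>proper\<close> allows only finitely many
    values.\<close>
  define f where "f n = minv (mpow B n) ** A ** mpow B n" for n
  have "f n \<in> {A\<in>G. comparable ?R (p + q) (A *v (p + q))}" for n
  proof -
    have m: "mpow B n \<in> G" using mpow_G B by blast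
    have "comparable ?R (minv (mpow B n) *v ?x n) (minv (mpow B n) *v (A *v ?x n))"
      by (rule map_comparable[OF minv(1)[OF m] comparable])
    then show ?thesis using minv_vec[OF m] minv[OF m] m A mult_G
      by (simp add: f_def matrix_vector_mul_assoc[symmetric])
  qed
  then have "range f \<subseteq> {A\<in>G. comparable ?R (p + q) (A *v (p + q))}" by (rule image_subsetI)
  then have "finite (range f)" by (rule finite_subset) (rule proper[OF pq])
  then have "\<not> inj f" using finite_imageD infinite_UNIV_nat by blast
  then obtain i j where ij: "i < j" "f i = f j" unfolding inj_def by (metis linorder_neqE_nat)
  define n where "n = j - i"
  have n: "n > 0" "mpow B j = mpow B n ** mpow B i" using ij mpow_add[of B n i] by (auto simp: n_def)
  have m: "mpow B i \<in> G" "mpow B j \<in> G" "mpow B n \<in> G" using mpow_G B by blast+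
  have fA: "mpow B k ** f k = A ** mpow B k" if "mpow B k \<in> G" for k
    using minv(2)[OF that] by (simp add: f_def matrix_mul_assoc)
  have "mpow B n ** (A ** mpow B i) = mpow B n ** (mpow B i ** f i)" by (simp add: fA[OF m(1)])
  also have "\<dots> = mpow B j ** f j" by (simp add: n(2) ij(2) matrix_mul_assoc)
  also have "\<dots> = A ** mpow B n ** mpow B i" unfolding fA[OF m(2)] by (simp add: n(2) matrix_mul_assoc)
  finally have "mpow B n ** A ** mpow B i ** minv (mpow B i) = A ** mpow B n ** mpow B i ** minv (mpow B i)"
    by (simp add: matrix_mul_assoc)
  then have "mpow B n ** A = A ** mpow B n"
    using minv(2)[OF m(1)] by (simp add: matrix_mul_assoc[symmetric])
  with n(1) show ?thesis by metis
qed

text \<open>An element fixing one end commutes with a positive power of \<open>B\<close>, and that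
  power has the same two ends. The end \<open>p\<close> is treated as the attracting end of
  \<open>minv B\<close>.\<close>

lemma fix_end_axis: assumes "hyperbolic B p q a b" "A \<in> G" "(\<exists>s>0. A *v p = s *\<^sub>R p) \<or> (\<exists>s>0. A *v q = s *\<^sub>R q)"
  shows "\<exists>s>0. A *v p = s *\<^sub>R p" "\<exists>t>0. A *v q = t *\<^sub>R q"
proof -
  have *: "(\<exists>s>0. A *v p = s *\<^sub>R p) \<and> (\<exists>t>0. A *v q = t *\<^sub>R q)"
    if h: "hyperbolic B p q a b" and q: "\<exists>s>0. A *v q = s *\<^sub>R q" for B p q a b
  proof -
    obtain n where "n > 0" "A ** mpow B n = mpow B n ** A"
      using fix_end_commutes[OF h assms(2)] q by blast
    with comm_axis[OF hyperbolic_mpow[OF h] assms(2)] show ?thesis by blast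
  qed
  show "\<exists>s>0. A *v p = s *\<^sub>R p" "\<exists>t>0. A *v q = t *\<^sub>R q"
    using assms(3) *[OF assms(1)] *[OF hyperbolic_minv[OF assms(1)]] by blast+
qed

text \<open>The vectors \<open>p + v n\<close> stay comparable to the point \<open>p + q\<close> of the axis; applying \<open>B\<close>, the
  rescaled images stay in an order interval and every limit is comparable to the extreme ray \<open>q\<close>.\<close>

lemma attract: assumes h: "hyperbolic B p q a b" and v: "\<And>n. v n \<in> K" "v \<longlonglongrightarrow> v0" "v0 \<noteq> 0" "\<And>s. v0 \<noteq> s *\<^sub>R p"
    and e: "strict_mono e"
  shows "\<exists>r t. strict_mono r \<and> t > 0 \<and>
    (\<lambda>n. (1 / b ^ e (r n)) *\<^sub>R (mpow B (e (r n)) *v v (r n))) \<longlonglongrightarrow> t *\<^sub>R q"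
proof -
  define z where "z n = (1 / b ^ e n) *\<^sub>R (mpow B (e n) *v v n)" for n
  define eps where "eps n = (a / b) ^ e n" for n
  have B: "B \<in> G" and ab: "0 < a" "a < b" and pq: "p + q \<in> C" and K: "p \<in> K" "q \<in> K" and n0: "p \<noteq> 0" "q \<noteq> 0"
    using h by (auto simp: hyperbolic_def)
  have v0: "v0 \<in> K" using lim_K v by blast
  \<comment> \<open>The only use of \<open>v0\<close> not being a multiple of \<open>p\<close>:
    strictness then moves \<open>p + v0\<close> into the interior.\<close>
  have y: "p + v0 \<in> C" using strict[of p v0] v0 v K n0 by blast
  obtain R where R: "R \<ge> 1" "comparable R (p + q) (p + v0)" using ex_comparable pq y by blast
  obtain d where d: "d > 0" "\<And>w l. norm w \<le> d * l \<Longrightarrow> order_ball (p + v0) l w" using ex_order_ball[OF y] by blast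
  obtain N where N: "\<And>n. n \<ge> N \<Longrightarrow> norm (v n - v0) < d * (1/2)"
    using LIMSEQ_D[OF v(2), of "d * (1/2)"] d by auto
  have c: "comparable (R * 2) (eps n *\<^sub>R p + q) (eps n *\<^sub>R p + z n)" if "n \<ge> N" for n
  proof -
    have "order_ball (p + v0) (1/2) (v n - v0)" using N[OF that] d(2) by (simp add: less_imp_le)
    then have 1: "(1/2) *\<^sub>R (p + v0) - (v n - v0) \<in> K" and 2: "(1/2) *\<^sub>R (p + v0) + (v n - v0) \<in> K"
      by (auto simp: order_ball_def)
    have "(1/2) *\<^sub>R (p + v0) \<in> K" using y C_K scale_K by simp
    from add_K[OF this 1] have "p + v n \<sqsubseteq> 2 *\<^sub>R (p + v0)"
      unfolding le_def by (rule back_subst[of "\<lambda>x. x \<in> K"]) (simp add: vec_eq_iff field_simps)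
    moreover have "p + v0 \<sqsubseteq> 2 *\<^sub>R (p + v n)"
      using scale_K[OF 2, of 2] unfolding le_def by (rule back_subst[of "\<lambda>x. x \<in> K"]) (simp_all add: vec_eq_iff field_simps)
    ultimately have "comparable 2 (p + v0) (p + v n)" by (simp add: comparable_def)
    from comparable_trans[OF R(2) this] R have "comparable (R * 2) (p + q) (p + v n)" by simp
    from comparable_scale[OF map_comparable[OF mpow_G[OF B, of "e n"] this], of "1 / b ^ e n"] ab
    have "comparable (R * 2) ((a / b) ^ e n *\<^sub>R p + q) ((1 / b ^ e n) *\<^sub>R (mpow B (e n) *v (p + v n)))"
      by (simp add: mpow_hyperbolic_norm[OF h])
    moreover have "(1 / b ^ e n) *\<^sub>R (mpow B (e n) *v (p + v n)) = eps n *\<^sub>R p + z n"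
      using h by (simp add: matrix_vector_right_distrib z_def eps_def mpow_eigen hyperbolic_def scaleR_add_right power_divide)
    ultimately show ?thesis by (simp add: eps_def)
  qed
  have zK: "z n \<in> K" for n
    unfolding z_def using map_K[OF mpow_G[OF B] v(1)] ab by (intro scale_K) auto
  have eps: "0 \<le> eps n" "eps n \<le> 1" for n using ab by (auto simp: eps_def power_le_one)
  have "order_ball (p + q) (R * 2) (z n)" if "n \<ge> N" for n
  proof -
    have "z n \<sqsubseteq> eps n *\<^sub>R p + z n" using scale_K[OF K(1) eps(1)] by (simp add: le_def)
    also have "\<dots> \<sqsubseteq> (R * 2) *\<^sub>R (eps n *\<^sub>R p + q)" using c[OF that] by (simp add: comparable_def)
    also have "\<dots> \<sqsubseteq> (R * 2) *\<^sub>R (1 *\<^sub>R p + q)" using R eps K by (intro le_scale le_add le_scalar) auto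
    finally have "(R * 2) *\<^sub>R (p + q) - z n \<in> K" by (simp add: le_def)
    moreover have "(R * 2) *\<^sub>R (p + q) + z n \<in> K" using R K zK by (intro add_K scale_K) auto
    ultimately show ?thesis by (simp add: order_ball_def)
  qed
  then have "\<forall>n. z (n + N) \<in> {w. order_ball (p + q) (R * 2) w}" by simp
  then obtain l r0 where l: "strict_mono r0" "((\<lambda>n. z (n + N)) \<circ> r0) \<longlonglongrightarrow> l"
    using compact_order_ball[of "p + q" "R * 2"] unfolding compact_def by metis
  define r where "r n = r0 n + N" for n
  have r: "strict_mono r" using l(1) by (simp add: r_def strict_mono_def)
  have zl: "(\<lambda>n. z (r n)) \<longlonglongrightarrow> l" using l(2) by (simp add: r_def o_def)
  have er: "(\<lambda>n. eps (r n)) \<longlonglongrightarrow> 0"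
    using LIMSEQ_subseq_LIMSEQ[OF ratio_tendsto[OF h] strict_mono_o[OF e r]] by (simp add: eps_def o_def)
  have cr: "comparable (R * 2) (eps (r n) *\<^sub>R p + q) (eps (r n) *\<^sub>R p + z (r n))" for n
    by (rule c) (simp add: r_def)
  have "(\<lambda>n. (R * 2) *\<^sub>R (eps (r n) *\<^sub>R p + z (r n)) - (eps (r n) *\<^sub>R p + q)) \<longlonglongrightarrow>
      (R * 2) *\<^sub>R (0 *\<^sub>R p + l) - (0 *\<^sub>R p + q)"
    "(\<lambda>n. (R * 2) *\<^sub>R (eps (r n) *\<^sub>R p + q) - (eps (r n) *\<^sub>R p + z (r n))) \<longlonglongrightarrow>
      (R * 2) *\<^sub>R (0 *\<^sub>R p + q) - (0 *\<^sub>R p + l)"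
    by (intro tendsto_intros er zl)+
  then have "(R * 2) *\<^sub>R (0 *\<^sub>R p + l) - (0 *\<^sub>R p + q) \<in> K" "(R * 2) *\<^sub>R (0 *\<^sub>R p + q) - (0 *\<^sub>R p + l) \<in> K"
    using cr unfolding comparable_def le_def by (auto elim!: lim_K)
  then have 1: "(R * 2) *\<^sub>R l - q \<in> K" and 2: "l \<sqsubseteq> (R * 2) *\<^sub>R q" by (simp_all add: le_def)
  have "l \<noteq> 0" using 1 pointed[of q] K n0 by auto
  moreover have "l \<in> K" using lim_K[OF zl] zK by blast
  ultimately obtain t where "t > 0" "l = t *\<^sub>R q"
    using extreme_ray[OF K(2) hyperbolic_ends(2)[OF h] _ _ 2] R n0 by auto
  with r zl show ?thesis unfolding z_def by blast
qed

text \<open>Brouwer's theorem for the projectivised map on the compact convex section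
  \<open>f \<bullet> v = 1\<close> of \<open>K\<close>, as in the theorem of Perron and
  Frobenius.\<close>

lemma eigenvector_exists: assumes "A \<in> G" shows "\<exists>w k. w \<in> K \<and> w \<noteq> 0 \<and> k > 0 \<and> A *v w = k *\<^sub>R w"
proof -
  obtain f e where f: "e > 0" "\<And>v. v \<in> K \<Longrightarrow> f \<bullet> v \<ge> e * norm v" using positive_functional by blast
  have pos: "f \<bullet> v > 0" if "v \<in> K" "v \<noteq> 0" for v
    using f(2)[OF that(1)] f(1) that(2) by (meson less_le_trans mult_pos_pos zero_less_norm_iff)
  let ?S = "K \<inter> {v. f \<bullet> v = 1}"
  let ?h = "\<lambda>v. (1 / (f \<bullet> (A *v v))) *\<^sub>R (A *v v)"
  have nz: "v \<noteq> 0" if "v \<in> ?S" for v using that by auto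
  have Apos: "f \<bullet> (A *v v) > 0" if "v \<in> ?S" for v
    using that nz[OF that] by (intro pos map_K assms) (auto simp: inj_G[OF assms])
  obtain x where "x \<in> ?S" "?h x = x"
  proof (rule brouwer[of ?S ?h])
    have "norm v \<le> 1 / e" if "v \<in> ?S" for v
      using f(2)[of v] f(1) that by (simp add: field_simps)
    then have "bounded ?S" unfolding bounded_iff by blast
    moreover have "closed ?S" by (intro closed_Int closed_hyperplane) simp
    ultimately show "compact ?S" by (simp add: compact_eq_bounded_closed)
    show "convex ?S" by (intro convex_Int convex_K convex_hyperplane)
    obtain c where c: "c \<in> C" using ne_C by blast
    then have "c \<noteq> 0" using zero_notin by auto
    with c have "f \<bullet> c > 0" by (intro pos C_K)
    then have "(1 / (f \<bullet> c)) *\<^sub>R c \<in> ?S" using c C_K scale_K by simp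
    then show "?S \<noteq> {}" by blast
    show "continuous_on ?S ?h"
      using Apos by (intro continuous_intros) (metis less_irrefl)
    show "?h \<in> ?S \<rightarrow> ?S"
    proof
      fix v assume v: "v \<in> ?S"
      then show "?h v \<in> ?S" using Apos[OF v] map_K[OF assms, of v] scale_K by auto
    qed
  qed auto
  then have "A *v x = (f \<bullet> (A *v x)) *\<^sub>R x" using Apos[of x]
    by (metis (no_types, lifting) divide_inverse_commute less_irrefl mult.right_neutral right_inverse scaleR_one scaleR_scaleR)
  with \<open>x \<in> ?S\<close> Apos nz show ?thesis by blast
qed

text \<open>Let \<open>w\<close> be an eigenvector of \<open>A\<close> in \<open>K\<close> with
  eigenvalue \<open>k\<close>. By commutation each \<open>u n\<close> in the proof is an eigenvector
  for the same \<open>k\<close>. Unless \<open>p\<close> is one too, neither \<open>w\<close> nor a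
  limit direction of the \<open>u n\<close> is a multiple of \<open>p\<close>, so
  \<open>attract\<close> drives both \<open>mpow B n *v w\<close> and \<open>mpow B n *v u n\<close>
  to the ray of \<open>q\<close> along a subsequence. Since \<open>A\<close> maps the former vector
  to the latter, it fixes this ray.\<close>

lemma conj_commutes_fix_end:
  assumes h: "hyperbolic B p q a b" and A: "A \<in> G"
    and com: "\<And>n. A ** (mpow B n ** A ** minv (mpow B n)) = (mpow B n ** A ** minv (mpow B n)) ** A"
  shows "(\<exists>s>0. A *v p = s *\<^sub>R p) \<or> (\<exists>s>0. A *v q = s *\<^sub>R q)"
proof -
  have B: "B \<in> G" and ab: "0 < a" "a < b" and pq: "p + q \<in> C" and K: "p \<in> K" "q \<in> K" and n0: "p \<noteq> 0" "q \<noteq> 0"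
    using h by (auto simp: hyperbolic_def)
  have M: "mpow B n \<in> G" for n using mpow_G B by blast
  obtain w k where w: "w \<in> K" "w \<noteq> 0" "k > 0" "A *v w = k *\<^sub>R w" using eigenvector_exists[OF A] by blast
  show ?thesis
  proof (cases "A *v p = k *\<^sub>R p")
    case np: False
    have notp: "u \<noteq> s *\<^sub>R p" if "A *v u = k *\<^sub>R u" "u \<noteq> 0" for u s
    proof
      assume u: "u = s *\<^sub>R p"
      then have "s \<noteq> 0" using that by auto
      have "s *\<^sub>R (A *v p) = s *\<^sub>R (k *\<^sub>R p)" using that u by (simp add: matrix_vector_mult_scaleR mult.commute)
      from scaleR_left_imp_eq[OF \<open>s \<noteq> 0\<close> this] np show False by contradiction
    qed
    define u where "u n = minv (mpow B n) *v (A *v (mpow B n *v w))" for n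
    have uK: "u n \<in> K" for n unfolding u_def using w M minv(1) A by (intro map_K) auto
    have u0: "u n \<noteq> 0" for n unfolding u_def using w M minv(1) A by (simp add: inj_G)
    have Au: "A *v u n = k *\<^sub>R u n" for n
    proof -
      let ?P = "mpow B n" and ?Q = "minv (mpow B n)"
      have comv: "(?P ** A ** ?Q) *v (A *v x) = A *v ((?P ** A ** ?Q) *v x)" for x
        by (simp only: matrix_vector_mul_assoc com[of n])
      have "?P *v (A *v u n) = (?P ** A ** ?Q) *v (A *v (?P *v w))"
        by (simp add: u_def matrix_vector_mul_assoc matrix_mul_assoc)
      also have "\<dots> = A *v ((?P ** A ** ?Q) *v (?P *v w))"
        by (rule comv)
      also have "(?P ** A ** ?Q) *v (?P *v w) = k *\<^sub>R (?P *v w)"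
        using minv_vec[OF M, of n w] w by (simp add: matrix_vector_mul_assoc[symmetric] matrix_vector_mult_scaleR)
      finally have "?Q *v (?P *v (A *v u n)) = k *\<^sub>R u n" by (simp add: u_def matrix_vector_mult_scaleR)
      then show ?thesis by (simp add: minv_vec[OF M])
    qed
    define v where "v n = (1 / norm (u n)) *\<^sub>R u n" for n
    have vK: "v n \<in> K" for n unfolding v_def by (intro scale_K uK) simp
    have Av: "A *v v n = k *\<^sub>R v n" for n by (simp add: v_def Au matrix_vector_mult_scaleR)
    have "\<forall>n. v n \<in> sphere 0 1" using u0 by (simp add: v_def)
    then obtain v0 s where v0: "v0 \<in> sphere 0 1" "strict_mono s" "(v \<circ> s) \<longlonglongrightarrow> v0"
      using compact_sphere[of "0::real^3" 1] unfolding compact_def by metis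
    have Av0: "A *v v0 = k *\<^sub>R v0"
    proof (rule LIMSEQ_unique)
      show "(\<lambda>n. A *v (v \<circ> s) n) \<longlonglongrightarrow> A *v v0"
        by (intro bounded_linear.tendsto[OF matrix_vector_mul_bounded_linear] v0)
      show "(\<lambda>n. A *v (v \<circ> s) n) \<longlonglongrightarrow> k *\<^sub>R v0"
        unfolding o_def Av using v0(3) by (intro tendsto_intros) (simp add: o_def)
    qed
    have v00: "v0 \<noteq> 0" using v0(1) by auto
    obtain r t where r: "strict_mono r" "t > 0"
      "(\<lambda>n. (1 / b ^ s (r n)) *\<^sub>R (mpow B (s (r n)) *v (v \<circ> s) (r n))) \<longlonglongrightarrow> t *\<^sub>R q"
      using attract[OF h _ v0(3) v00 notp[OF Av0 v00] v0(2)] vK by auto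
    have sr: "strict_mono (s \<circ> r)" using r(1) v0(2) by (simp add: strict_mono_o)
    obtain r' t' where r': "strict_mono r'" "t' > 0"
      "(\<lambda>n. (1 / b ^ (s \<circ> r) (r' n)) *\<^sub>R (mpow B ((s \<circ> r) (r' n)) *v w)) \<longlonglongrightarrow> t' *\<^sub>R q"
      using attract[OF h w(1) tendsto_const w(2) notp[OF w(4) w(2)] sr] by auto
    \<comment> \<open>One subsequence that serves both limits.\<close>
    define e where "e n = s (r (r' n))" for n
    define z where "z n = (1 / b ^ e n) *\<^sub>R (mpow B (e n) *v v (e n))" for n
    define w' where "w' n = (1 / b ^ e n) *\<^sub>R (mpow B (e n) *v w)" for n
    have z: "z \<longlonglongrightarrow> t *\<^sub>R q" using LIMSEQ_subseq_LIMSEQ[OF r(3) r'(1)] by (simp add: z_def[abs_def] e_def o_def)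
    have w': "w' \<longlonglongrightarrow> t' *\<^sub>R q" using r'(3) by (simp add: w'_def[abs_def] e_def o_def)
    have "A *v w' n = norm (u (e n)) *\<^sub>R z n" for n
    proof -
      have "norm (u (e n)) *\<^sub>R z n = (1 / b ^ e n) *\<^sub>R (mpow B (e n) *v (norm (u (e n)) *\<^sub>R v (e n)))"
        by (simp add: z_def matrix_vector_mult_scaleR)
      also have "norm (u (e n)) *\<^sub>R v (e n) = u (e n)" using u0 by (simp add: v_def)
      also have "mpow B (e n) *v u (e n) = A *v (mpow B (e n) *v w)"
        by (simp add: u_def minv_vec[OF M])
      finally show ?thesis by (simp add: w'_def matrix_vector_mult_scaleR)
    qed note eq = this
    have Aw': "(\<lambda>n. A *v w' n) \<longlonglongrightarrow> A *v (t' *\<^sub>R q)"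
      by (intro bounded_linear.tendsto[OF matrix_vector_mul_bounded_linear] w')
    have tq: "norm (t *\<^sub>R q) > 0" using r(2) n0 by simp
    let ?rho = "norm (A *v (t' *\<^sub>R q)) / norm (t *\<^sub>R q)"
    \<comment> \<open>The scale factors \<open>norm (u (e n))\<close> are quotients of two
      convergent norms with nonzero denominator in the limit; hence they converge
      themselves.\<close>
    have "(\<lambda>n. norm (A *v w' n) / norm (z n)) \<longlonglongrightarrow> ?rho"
      using tq by (intro tendsto_intros Aw' z) auto
    moreover have "norm (A *v w' n) / norm (z n) = norm (u (e n))" for n
    proof -
      have "z n \<noteq> 0" using u0 ab by (simp add: z_def v_def inj_G[OF M])
      then show ?thesis by (simp add: eq)
    qed
    ultimately have "(\<lambda>n. norm (u (e n)) *\<^sub>R z n) \<longlonglongrightarrow> ?rho *\<^sub>R (t *\<^sub>R q)"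
      by (intro tendsto_scaleR z) simp
    then have "A *v (t' *\<^sub>R q) = ?rho *\<^sub>R (t *\<^sub>R q)"
      using Aw' unfolding eq by (rule LIMSEQ_unique[rotated])
    then have "t' *\<^sub>R (A *v q) = (?rho * t) *\<^sub>R q" by (simp only: matrix_vector_mult_scaleR scaleR_scaleR)
    then have "(1/t') *\<^sub>R (t' *\<^sub>R (A *v q)) = (1/t') *\<^sub>R ((?rho * t) *\<^sub>R q)" by (rule arg_cong)
    then have "A *v q = (?rho * t / t') *\<^sub>R q" using r'(2) by simp
    moreover have "norm (A *v (t' *\<^sub>R q)) > 0" using r'(2) n0 by (simp add: inj_G[OF A])
    then have "?rho * t / t' > 0" using tq r(2) r'(2) by (intro divide_pos_pos mult_pos_pos)
    ultimately show ?thesis by blast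
  qed (use w in blast)
qed

section \<open>Core elements on an axis\<close>

lemma minv_unique: "A \<in> G \<Longrightarrow> A ** X = mat 1 \<Longrightarrow> X = minv A"
  by (metis matrix_mul_assoc matrix_mul_lid matrix_mul_rid minv(3))

lemma minv_mult: assumes "A \<in> G" "B \<in> G" shows "minv (A ** B) = minv B ** minv A"
proof (rule minv_unique[symmetric, OF mult_G[OF assms]])
  have "A ** B ** (minv B ** minv A) = A ** (B ** minv B) ** minv A" by (simp only: matrix_mul_assoc)
  then show "A ** B ** (minv B ** minv A) = mat 1" using assms by (simp add: minv)
qed

text \<open>The span of the conjugates of \<open>A\<close> by \<open>mpow B n\<close> with \<open>n\<close> below some \<open>k \<le> 9 = dim\<close> is
  invariant under conjugation by \<open>B\<close>, so commuting with finitely many conjugates suffices.\<close>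

lemma commutes_with_all_conj:
  assumes A: "A \<in> G" and B: "B \<in> G"
    and com: "\<And>n. n \<le> 9 \<Longrightarrow> A ** (mpow B n ** A ** minv (mpow B n)) = (mpow B n ** A ** minv (mpow B n)) ** A"
  shows "A ** (mpow B n ** A ** minv (mpow B n)) = (mpow B n ** A ** minv (mpow B n)) ** A"
proof -
  define X where "X n = mpow B n ** A ** minv (mpow B n)" for n
  have XSuc: "X (Suc n) = B ** X n ** minv B" for n
    by (simp add: X_def mpow_Suc minv_mult[OF B mpow_G[OF B]] matrix_mul_assoc)
  obtain k where k: "k \<le> 9" "X k \<in> span (X ` {..<k})" using prefix_span[of X] by auto
  let ?V = "span (X ` {..<k})"
  have V: "subspace ?V" by (rule subspace_span)
  have "subspace {M. B ** M ** minv B \<in> ?V}"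
    using subspace_add[OF V] subspace_scale[OF V] subspace_0[OF V]
    by (intro subspaceI) (auto simp: matrix_mult_scaleR matrix_mult_add_right matrix_add_ldistrib)
  moreover have "X ` {..<k} \<subseteq> {M. B ** M ** minv B \<in> ?V}"
  proof (safe, simp only: XSuc[symmetric])
    fix i assume i: "i < k"
    show "X (Suc i) \<in> ?V"
    proof (cases "Suc i = k")
      case False
      then show ?thesis using i by (intro span_base) auto
    qed (use k in auto)
  qed
  ultimately have inv: "?V \<subseteq> {M. B ** M ** minv B \<in> ?V}" by (rule span_minimal[rotated])
  have X0: "X 0 = A" using minv(2)[OF one_G] by (simp add: X_def)
  have "k \<noteq> 0"
  proof
    assume "k = 0"
    then have "A = 0" using k X0 by simp
    then show False using map_C[OF A] ne_C zero_notin by auto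
  qed
  then have "X 0 \<in> ?V" by (intro span_base) auto
  then have XV: "X n \<in> ?V" for n using inv by (induction n) (auto simp: XSuc)
  have "subspace {M. A ** M = M ** A}"
    by (intro subspaceI) (auto simp: matrix_mult_scaleR matrix_mult_add_right matrix_add_ldistrib)
  moreover have "X ` {..<k} \<subseteq> {M. A ** M = M ** A}" using com k(1) by (auto simp: X_def)
  ultimately have "?V \<subseteq> {M. A ** M = M ** A}" by (rule span_minimal[rotated])
  with XV[of n] show ?thesis by (auto simp: X_def)
qed

lemma op_bound_conj: assumes "M \<in> G" "op_bound y k (displ A)" shows "op_bound (M *v y) k (displ (M ** A ** minv M))"
  unfolding op_bound_def
proof (intro allI impI)
  fix l v assume "order_ball (M *v y) l v"
  then have "order_ball y l (minv M *v v)" using map_order_ball[OF minv(1)[OF assms(1)], of "M *v y" l v] minv_vec[OF assms(1)] by simp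
  then have "order_ball y (k * l) (displ A (minv M *v v))" using assms unfolding op_bound_def by blast
  from map_order_ball[OF assms(1) this] show "order_ball (M *v y) (k * l) (displ (M ** A ** minv M) v)"
    by (simp add: matrix_vector_mult_diff_distrib minv_vec[OF assms(1)] matrix_vector_mul_assoc[symmetric])
qed

text \<open>The volume bounds give \<open>a \<le> 1\<close> and \<open>1 \<le> b\<close>, so that
  \<open>b\<close> and \<open>1 / a\<close> are both at most \<open>b / a\<close>.\<close>

lemma hyperbolic_comparable: assumes "hyperbolic B p q a b" shows "comparable (b / a) (p + q) (B *v (p + q))"
proof -
  have B: "B \<in> G" and ab: "0 < a" "a < b" and pq: "p + q \<in> C" and K: "p \<in> K" "q \<in> K"
    and e: "B *v p = a *\<^sub>R p" "B *v q = b *\<^sub>R q"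
    using assms by (auto simp: hyperbolic_def)
  have Bx: "B *v (p + q) = a *\<^sub>R p + b *\<^sub>R q" by (simp add: matrix_vector_right_distrib e)
  have up: "B *v (p + q) \<sqsubseteq> b *\<^sub>R (p + q)" unfolding Bx scaleR_add_right using ab K
    by (intro le_add le_scalar) auto
  have lo: "a *\<^sub>R (p + q) \<sqsubseteq> B *v (p + q)" unfolding Bx scaleR_add_right using ab K
    by (intro le_add le_scalar) auto
  have 1: "b \<ge> 1" "a \<le> 1" using upper_ge_1[OF B pq up] lower_le_1[OF B pq lo] by auto
  have "b *\<^sub>R (p + q) \<sqsubseteq> (b / a) *\<^sub>R (p + q)" using 1 ab pq C_K by (intro le_scalar) (auto simp: field_simps)
  with up have U: "B *v (p + q) \<sqsubseteq> (b / a) *\<^sub>R (p + q)" by (rule le_trans)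
  have "p + q \<sqsubseteq> (1 / a) *\<^sub>R (B *v (p + q))" using le_scale[OF lo, of "1 / a"] ab by simp
  also have "\<dots> \<sqsubseteq> (b / a) *\<^sub>R (B *v (p + q))" using 1 ab map_C[OF B pq] C_K by (intro le_scalar) (auto simp: field_simps)
  finally show ?thesis using U by (simp add: comparable_def)
qed

definition fixes_ends :: "real^3^3 \<Rightarrow> real^3 \<Rightarrow> real^3 \<Rightarrow> bool" where
  "fixes_ends A p q \<longleftrightarrow> (\<exists>s>0. A *v p = s *\<^sub>R p) \<and> (\<exists>t>0. A *v q = t *\<^sub>R q)"

text \<open>Moving the base point from \<open>mpow B n *v (p + q)\<close> back to
  \<open>p + q\<close> costs the square of \<open>(b / a) ^ n\<close>. For \<open>n \<le> 9\<close>
  the conjugates of \<open>A\<close> therefore stay below \<open>1/16\<close>, and a core element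
  commutes with them.\<close>

lemma core_fixes_ends:
  assumes h: "hyperbolic B p q a b" and A: "core (p + q) k A" and k: "k * (b / a) ^ 18 \<le> 1/16" "k \<ge> 0"
  shows "fixes_ends A p q"
proof -
  have B: "B \<in> G" and ab: "0 < a" "a < b" and pq: "p + q \<in> C" using h by (auto simp: hyperbolic_def)
  have A': "A \<in> G" "op_bound (p + q) k (displ A)" and com: "\<And>X. X \<in> G \<Longrightarrow> op_bound (p + q) (1/16) (displ X) \<Longrightarrow> A ** X = X ** A"
    using A by (auto simp: core_def small_def)
  have com9: "A ** (mpow B n ** A ** minv (mpow B n)) = (mpow B n ** A ** minv (mpow B n)) ** A" if "n \<le> 9" for n
  proof (rule com)
    have M: "mpow B n \<in> G" using mpow_G B by blast
    show "mpow B n ** A ** minv (mpow B n) \<in> G" using M minv(1) A' mult_G by simp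
    have "comparable ((b / a) ^ n) (p + q) (mpow B n *v (p + q))"
      using hyperbolic_comparable[OF hyperbolic_mpow[OF h, of n]] by (cases "n = 0") (auto simp: comparable_def power_divide)
    then have "comparable ((b / a) ^ n) (mpow B n *v (p + q)) (p + q)" using comparable_sym by blast
    from op_bound_comparable[OF op_bound_conj[OF M A'(2)] this map_C[OF M pq] pq k(2)] ab
    have "op_bound (p + q) (((b / a) ^ n)\<^sup>2 * k) (displ (mpow B n ** A ** minv (mpow B n)))" by simp
    moreover have "((b / a) ^ n)\<^sup>2 * k \<le> 1/16"
    proof -
      have "((b / a) ^ n)\<^sup>2 = (b / a) ^ (n * 2)" by (simp add: power_mult)
      also have "\<dots> \<le> (b / a) ^ 18" using that ab by (intro power_increasing) auto
      finally have "((b / a) ^ n)\<^sup>2 * k \<le> (b / a) ^ 18 * k" using k by (intro mult_right_mono)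
      with k show ?thesis by (simp add: mult.commute)
    qed
    ultimately show "op_bound (p + q) (1/16) (displ (mpow B n ** A ** minv (mpow B n)))"
      by (rule op_bound_mono[OF _ _ pq])
  qed
  have "(\<exists>s>0. A *v p = s *\<^sub>R p) \<or> (\<exists>s>0. A *v q = s *\<^sub>R q)"
    by (rule conj_commutes_fix_end[OF h A'(1) commutes_with_all_conj[OF A'(1) B com9]])
  from fix_end_axis[OF h A'(1) this] show ?thesis by (simp add: fixes_ends_def)
qed

text \<open>The hypothesis says that \<open>A\<close> reverses \<open>w\<close>. Since
  \<open>w\<close> is minus half its displacement, a bound \<open>l\<close> for its order-unit norm
  improves to \<open>l / 4\<close>; a factor 2 per step is enough to force
  \<open>w = 0\<close>.\<close>

lemma no_double_displ: assumes "y \<in> C" "op_bound y k (displ A)" "k \<le> 1/2" "displ A w = -2 *\<^sub>R w" shows "w = 0"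
proof -
  obtain e where e: "e > 0" "\<And>v l. norm v \<le> e * l \<Longrightarrow> order_ball y l v" using ex_order_ball[OF assms(1)] by blast
  have B: "op_bound y (1/2) (displ A)" by (rule op_bound_mono[OF assms(2,3,1)])
  have "order_ball y ((norm w / e) / 2 ^ n) w" for n
  proof (induction n)
    case 0
    show ?case using e by (intro e(2)) simp
  next
    case (Suc n)
    let ?l = "(norm w / e) / 2 ^ n"
    have "order_ball y (1/2 * ?l) (displ A w)" using B Suc unfolding op_bound_def by blast
    from order_ball_scale[OF this, of "-1/2"] have "order_ball y (1/4 * ?l) w" by (simp add: assms(4))
    then show ?case
      by (rule order_ball_mono[OF C_K[OF assms(1)]]) (use e in \<open>simp add: field_simps\<close>)
  qed
  then show ?thesis by (rule order_ball_zero)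
qed

text \<open>If \<open>A\<close> fixes the plane spanned by \<open>p\<close> and \<open>q\<close> pointwise, then \<open>N = A - 1\<close> has rank at most
  one, so \<open>N\<^sup>2 = nu N\<close>. By discreteness \<open>A\<close> has finite order, which forces \<open>nu = -2\<close> unless
  \<open>N = 0\<close>.\<close>

lemma no_pointwise_axis:
  assumes "small y k A" "y \<in> C" "k \<le> 1/2" and pq: "p \<in> K" "q \<in> K" "p \<noteq> 0" "q \<noteq> 0" "p + q \<in> C" "p \<notin> C"
    and e: "A *v p = s *\<^sub>R p" "A *v q = s *\<^sub>R q"
  shows False
proof -
  have A: "A \<in> G" "A \<noteq> mat 1" "op_bound y k (displ A)" using assms(1) by (auto simp: small_def)
  have Ax: "A *v (p + q) = s *\<^sub>R (p + q)" by (simp add: e matrix_vector_right_distrib scaleR_add_right)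
  have s: "s = 1" using upper_ge_1[OF A(1) pq(5), of s] lower_le_1[OF A(1) pq(5), of s] by (simp add: Ax)
  have "range (mpow A) \<subseteq> {M\<in>G. comparable 1 (p + q) (M *v (p + q))}"
    using mpow_G[OF A(1)] mpow_eigen[OF Ax] s by (auto simp: comparable_def)
  then have "finite (range (mpow A))" by (rule finite_subset) (rule proper[OF pq(5)])
  then have "\<not> inj (mpow A)" using finite_imageD infinite_UNIV_nat by blast
  then obtain i j where ij: "i < j" "mpow A i = mpow A j" unfolding inj_def by (metis linorder_neqE_nat)
  define n where "n = j - i"
  have n: "n > 0" "mpow A j = mpow A n ** mpow A i" using ij mpow_add[of A n i] by (auto simp: n_def)
  have "mpow A n ** (mpow A i ** minv (mpow A i)) = mpow A i ** minv (mpow A i)"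
    using ij n by (simp add: matrix_mul_assoc)
  then have An: "mpow A n = mat 1" using minv(2)[OF mpow_G[OF A(1)], of i] by simp
  \<comment> \<open>If \<open>q\<close> were a multiple of \<open>p\<close>, then
    \<open>p + q\<close> would be a positive multiple of \<open>p\<close>, which is not in
    \<open>C\<close>, or lie in \<open>- K\<close>.\<close>
  have ind: "independent {p, q}" "p \<noteq> q"
  proof -
    have *: "q \<noteq> c *\<^sub>R p" for c
    proof
      assume q: "q = c *\<^sub>R p"
      show False
      proof (cases "1 + c > 0")
        case True
        have "(1 / (1 + c)) *\<^sub>R (p + q) \<in> C" using pq True by (intro scale_C) auto
        also have "p + q = (1 + c) *\<^sub>R p" by (simp add: q algebra_simps)
        finally show False using True pq by simp
      next
        case False
        have "p + q = - ((- (1 + c)) *\<^sub>R p)" by (simp add: q algebra_simps)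
        moreover have "(- (1 + c)) *\<^sub>R p \<in> K" using False pq by (intro scale_K) auto
        ultimately show False using neg_C[OF pq(5)] by simp
      qed
    qed
    from *[of 1] show "p \<noteq> q" by auto
    have "q \<notin> span {p}" using * by (auto simp: span_singleton)
    then have "independent (insert q {p})" using pq by (simp add: independent_insert)
    then show "independent {p, q}" by (simp add: insert_commute)
  qed
  have "span {p, q} \<noteq> UNIV"
  proof
    assume "span {p, q} = UNIV"
    then have "dim {p, q} = DIM(real^3)" using dim_span[of "{p, q}"] by simp
    then show False using dim_le_card'[of "{p, q}"] ind by simp
  qed
  then obtain v where v: "v \<notin> span {p, q}" by blast
  have "independent (insert v {p, q})" using v ind by (simp add: independent_insert)
  moreover have "card (insert v {p, q}) = 3"
  proof -
    have "v \<notin> {p, q}" using v span_base[of v "{p, q}"] by auto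
    then show ?thesis using ind(2) by simp
  qed
  ultimately have "span (insert v {p, q}) = UNIV"
    using card_ge_dim_independent[of "insert v {p, q}" UNIV] by auto
  then have dec: "\<exists>c. u - c *\<^sub>R v \<in> span {p, q}" for u using span_breakdown_eq[of u v "{p, q}"] by blast
  have fixU: "A *v u = u" if "u \<in> span {p, q}" for u
  proof -
    have "subspace {u. A *v u = u}"
      by (intro subspaceI) (auto simp: matrix_vector_right_distrib matrix_vector_mult_scaleR)
    moreover have "{p, q} \<subseteq> {u. A *v u = u}" using e s by auto
    ultimately show ?thesis using span_minimal that by blast
  qed
  obtain m where m: "A *v v - m *\<^sub>R v \<in> span {p, q}" using dec by blast
  define nu where "nu = m - 1"
  have "displ A (displ A u) = nu *\<^sub>R displ A u" for u
  proof -
    obtain c where c: "u - c *\<^sub>R v \<in> span {p, q}" using dec by blast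
    have 1: "displ A u = c *\<^sub>R displ A v"
      using fixU[OF c] by (simp add: matrix_vector_mult_diff_distrib matrix_vector_mult_scaleR algebra_simps)
    have 2: "displ A (displ A v) = nu *\<^sub>R displ A v"
      using fixU[OF m] by (simp add: nu_def matrix_vector_mult_diff_distrib matrix_vector_mult_scaleR algebra_simps)
    have "displ A (displ A u) = c *\<^sub>R displ A (displ A v)"
      unfolding 1 by (simp add: algebra_simps)
    also have "\<dots> = nu *\<^sub>R displ A u" by (simp only: 1 2 scaleR_left_commute)
    finally show ?thesis .
  qed note N2 = this
  have Anw: "A *v w = (1 + nu) *\<^sub>R w" if "w = displ A u" for u w
    using N2[of u] unfolding that[symmetric] by (simp add: scaleR_add_left diff_eq_eq add.commute)
  \<comment> \<open>Geometric series for the powers of \<open>1 + N\<close>, based on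
    \<open>N2\<close>.\<close>
  have powers: "mpow A i *v u = u + (\<Sum>j<i. (1 + nu) ^ j) *\<^sub>R displ A u" for i u
  proof (induction i)
    case (Suc i)
    define d c where "d = displ A u" and "c = (\<Sum>j<i. (1 + nu) ^ j)"
    have d: "A *v d = (1 + nu) *\<^sub>R d" "A *v u = u + d" using Anw[of d u] by (simp_all add: d_def)
    have "mpow A (Suc i) *v u = A *v (u + c *\<^sub>R d)"
      using Suc by (simp add: mpow_Suc matrix_vector_mul_assoc[symmetric] d_def c_def)
    also have "\<dots> = u + (1 + c * (1 + nu)) *\<^sub>R d"
      by (simp add: matrix_vector_right_distrib matrix_vector_mult_scaleR d algebra_simps)
    finally have "mpow A (Suc i) *v u = u + (1 + (\<Sum>j<i. (1 + nu) ^ j) * (1 + nu)) *\<^sub>R displ A u"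
      by (simp only: d_def c_def)
    also have "1 + (\<Sum>j<i. (1 + nu) ^ j) * (1 + nu) = (\<Sum>j<Suc i. (1 + nu) ^ j)"
      by (simp add: sum.lessThan_Suc_shift sum_distrib_left mult.commute[of _ "1 + nu"] del: sum.lessThan_Suc)
    finally show ?case .
  qed simp
  obtain u where u: "displ A u \<noteq> 0" using A(2) by (metis eq_iff_diff_eq_0 matrix_eq matrix_vector_mul_lid)
  have "(\<Sum>j<n. (1 + nu) ^ j) *\<^sub>R displ A u = 0" using powers[of n u] An by simp
  then have sum0: "(\<Sum>j<n. (1 + nu) ^ j) = 0" using u scaleR_eq_0_iff by blast
  \<comment> \<open>Finite order makes \<open>1 + nu\<close> a real root of unity, and the vanishing
    sum excludes 1. What remains is -1, a reflection, whose displacement is too large.\<close>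
  have "(1 + nu) ^ n = 1" using power_diff_1_eq[of "1 + nu" n] sum0 by simp
  then have "\<bar>1 + nu\<bar> ^ n = 1 ^ n" by (simp add: power_abs[symmetric])
  then have "\<bar>1 + nu\<bar> = 1" using power_eq_iff_eq_base[OF n(1), of "\<bar>1 + nu\<bar>" 1] by simp
  moreover have "nu \<noteq> 0"
  proof
    assume "nu = 0"
    then show False using sum0 n(1) by simp
  qed
  ultimately have "nu = -2" by auto
  with N2[of u] have "displ A (displ A u) = -2 *\<^sub>R displ A u" by simp
  from no_double_displ[OF assms(2) A(3) assms(3) this] u show False by simp
qed

text \<open>By \<open>no_pointwise_axis\<close> the eigenvalues of \<open>A\<close> at
  \<open>p\<close> and \<open>q\<close> differ, so \<open>A\<close> is hyperbolic in one of the two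
  directions. Its size at \<open>y'\<close> is at most \<open>4 * k\<close>, hence at most
  \<open>1/16\<close>; so the core element \<open>A'\<close> commutes with \<open>A\<close> and
  preserves its axis.\<close>

lemma core_step:
  assumes pq: "p \<in> K" "q \<in> K" "p \<noteq> 0" "q \<noteq> 0" "p + q \<in> C" "p \<notin> C"
    and A: "small y k A" "fixes_ends A p q" and A': "core y' k A'"
    and y: "y \<in> C" "y' \<in> C" "comparable 2 y y'" and k: "0 \<le> k" "k \<le> 1/64"
  shows "(\<exists>a b. hyperbolic A p q a b \<or> hyperbolic A q p a b) \<and> fixes_ends A' p q"
proof -
  have G: "A \<in> G" "A' \<in> G" using A A' by (auto simp: small_def core_def)
  obtain s t where st: "s > 0" "t > 0" "A *v p = s *\<^sub>R p" "A *v q = t *\<^sub>R q" using A(2) by (auto simp: fixes_ends_def)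
  have "s \<noteq> t" using no_pointwise_axis[OF A(1) y(1) _ pq, of s] st k by auto
  then have h: "hyperbolic A p q s t \<or> hyperbolic A q p t s" using pq G st by (auto simp: hyperbolic_def add.commute)
  have "op_bound y' (2\<^sup>2 * k) (displ A)" using A(1) k y by (intro op_bound_comparable) (auto simp: small_def)
  then have "op_bound y' (1/16) (displ A)" by (rule op_bound_mono) (use k y in auto)
  then have "A' ** A = A ** A'" using A' G by (auto simp: core_def)
  then have "fixes_ends A' p q" using h comm_axis[of A] G(2) unfolding fixes_ends_def by blast
  with h show ?thesis by blast
qed

section \<open>From the axis to the thick part\<close>

definition thick :: "real \<Rightarrow> real^3 \<Rightarrow> bool" where
  "thick k y \<longleftrightarrow> y \<in> C \<and> (\<nexists>A. small y k A)"

text \<open>Core elements at consecutive points of the segment from the axis to \<open>z\<close> commute, so all of them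
  fix the ends \<open>p\<close> and \<open>q\<close>.\<close>

lemma walk_to_thick:
  assumes h: "hyperbolic B p q a b" and k: "0 < k" "k \<le> 1/64" "k * (b / a) ^ 18 \<le> 1/16"
    and z: "thick k z" and x: "\<not> thick k (p + q)"
  shows "\<exists>A y a' b'. A \<in> G \<and> thick k y \<and> comparable 8 y (A *v y) \<and> (hyperbolic A p q a' b' \<or> hyperbolic A q p a' b')"
proof -
  have pq: "p \<in> K" "q \<in> K" "p \<noteq> 0" "q \<noteq> 0" "p + q \<in> C" "p \<notin> C"
    using h hyperbolic_ends[OF h] by (auto simp: hyperbolic_def)
  have zC: "z \<in> C" using z by (simp add: thick_def)
  obtain n y where y: "y 0 = p + q" "y n = z" "\<And>i. i \<le> n \<Longrightarrow> y i \<in> C" "\<And>i. i < n \<Longrightarrow> comparable 2 (y i) (y (Suc i))"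
    using segment_chain[OF pq(5) zC] by blast
  let ?goal = "\<exists>A y a' b'. A \<in> G \<and> thick k y \<and> comparable 8 y (A *v y) \<and> (hyperbolic A p q a' b' \<or> hyperbolic A q p a' b')"
  have core: "\<exists>A. core (y i) k A" if "i \<le> n" "\<not> thick k (y i)" for i
    using core_exists[of "y i" k] that y(3)[of i] k by (auto simp: thick_def)
  have "?goal \<or> (\<exists>A. core (y i) k A \<and> fixes_ends A p q)" if "i \<le> n" for i
    using that
  proof (induction i)
    case 0
    obtain A where "core (y 0) k A" using core[of 0] x y(1) by auto
    then show ?case using core_fixes_ends[OF h _ k(3)] k y(1) by auto
  next
    case (Suc i)
    then consider ?goal | A where "core (y i) k A" "fixes_ends A p q" by auto
    then show ?case
    proof cases
      case 2
      have A: "small (y i) k A" "A \<in> G" using 2 by (auto simp: core_def small_def)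
      have yi: "y i \<in> C" "y (Suc i) \<in> C" "comparable 2 (y i) (y (Suc i))" using y Suc by auto
      show ?thesis
      proof (cases "thick k (y (Suc i))")
        case True
        have "core (y i) k A" by (rule 2)
        \<comment> \<open>\<open>core_step\<close> is applied with both points equal to
          \<open>y i\<close>; only the hyperbolicity of \<open>A\<close> is wanted here.\<close>
        have "comparable 1 (y i) (y i)" by (simp add: comparable_def)
        then have "comparable 2 (y i) (y i)" by (rule comparable_mono) (use yi C_K in auto)
        from core_step[OF pq A(1) 2(2) 2(1) yi(1) yi(1) this] k
        obtain a' b' where "hyperbolic A p q a' b' \<or> hyperbolic A q p a' b'" by auto
        \<comment> \<open>Three factors 2: from \<open>y (Suc i)\<close> back to \<open>y i\<close>,
          on to its image under \<open>A\<close>, and forward to the image of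
          \<open>y (Suc i)\<close>.\<close>
        moreover have "comparable 8 (y (Suc i)) (A *v y (Suc i))"
        proof -
          have "comparable 2 (y i) (A *v y i)" using A k yi by (intro displ_comparable) (auto simp: small_def)
          moreover have "comparable 2 (A *v y i) (A *v y (Suc i))" by (rule map_comparable[OF A(2) yi(3)])
          moreover have "comparable 2 (y (Suc i)) (y i)" using yi(3) comparable_sym by blast
          ultimately show ?thesis using comparable_trans[of 2 "y (Suc i)" "y i" 2 "A *v y i"]
              comparable_trans[of 4 "y (Suc i)" "A *v y i" 2 "A *v y (Suc i)"] by simp
        qed
        ultimately show ?thesis using A(2) True by blast
      next
        case False
        then obtain A' where A': "core (y (Suc i)) k A'" using core Suc by blast
        from core_step[OF pq A(1) 2(2) A' yi] k have "fixes_ends A' p q" by simp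
        with A' show ?thesis by blast
      qed
    qed blast
  qed
  \<comment> \<open>The last point \<open>z\<close> is thick and has no core element, so the goal
    must have been reached on the way.\<close>
  from this[of n] y(2) z show ?thesis by (auto simp: thick_def core_def)
qed

lemma hyperbolic_scale: "hyperbolic B p q a b \<Longrightarrow> s > 0 \<Longrightarrow> t > 0 \<Longrightarrow> hyperbolic B (s *\<^sub>R p) (t *\<^sub>R q) a b"
proof -
  assume h: "hyperbolic B p q a b" and s: "s > 0" and t: "t > 0"
  have K: "p \<in> K" "q \<in> K" "p + q \<in> C" using h by (auto simp: hyperbolic_def)
  have "min s t *\<^sub>R (p + q) \<in> C" using K s t by (intro scale_C) auto
  moreover have "min s t *\<^sub>R (p + q) \<sqsubseteq> s *\<^sub>R p + t *\<^sub>R q"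
    unfolding scaleR_add_right using K by (intro le_add le_scalar) auto
  ultimately have "s *\<^sub>R p + t *\<^sub>R q \<in> C" by (rule le_C)
  then show ?thesis using h s t scale_K by (auto simp: hyperbolic_def matrix_vector_mult_scaleR)
qed

text \<open>The premise \<open>cover\<close> is the cocompactness of the thick part;
  \<open>thick_cover\<close> derives it from finite area. \<open>F1\<close> receives the elements
  whose axis point \<open>p + q\<close> is thick. In the other case \<open>walk_to_thick\<close>
  gives an \<open>A\<close> with the same axis that displaces a thick point boundedly; up to
  conjugation it lies in \<open>F2\<close>, and \<open>F3\<close> collects the elements that move a
  chosen axis point of such an \<open>A\<close> by a factor at most \<open>L\<close>.\<close>

lemma finite_conjugacy:
  assumes cover: "\<And>k. 0 < k \<Longrightarrow> k \<le> 1/64 \<Longrightarrow> \<exists>Y R. finite Y \<and> Y \<subseteq> C \<and> R \<ge> 1 \<and>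
      (\<forall>y. thick k y \<longrightarrow> (\<exists>g\<in>G. \<exists>s>0. \<exists>z\<in>Y. comparable R (s *\<^sub>R (g *v y)) z))"
    and L: "L \<ge> 1"
  shows "\<exists>F. finite F \<and> F \<subseteq> G \<and> (\<forall>B p q a b. hyperbolic B p q a b \<and> b / a \<le> L \<longrightarrow> (\<exists>g\<in>G. g ** B ** minv g \<in> F))"
proof -
  obtain z0 where z0: "z0 \<in> C" using ne_C by blast
  \<comment> \<open>Makes \<open>k * (b / a) ^ 18\<close> small enough for every \<open>B\<close>
    with \<open>b / a \<le> L\<close>.\<close>
  define k0 where "k0 = 1 / (64 * L ^ 18)"
  have L18: "L ^ 18 \<ge> 1" using L by simp
  then have k0: "k0 > 0" "k0 \<le> 1/64" "k0 * L ^ 18 = 1/64" using L by (simp_all add: k0_def divide_le_eq_1)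
  \<comment> \<open>Further halving makes the arbitrary point \<open>z0\<close> thick, so that the
    walk has a target.\<close>
  obtain n where n: "\<nexists>A. small z0 (k0 / 2 ^ n) A" using not_small[OF z0, of k0] k0 by auto
  define k where "k = k0 / 2 ^ n"
  have kk0: "k \<le> k0" using k0 by (simp add: k_def field_simps)
  have k: "k > 0" "k \<le> 1/64" using k0(1) order_trans[OF kk0 k0(2)] by (simp_all add: k_def)
  have "k * L ^ 18 \<le> k0 * L ^ 18" using kk0 L18 by (intro mult_right_mono) auto
  then have kL: "k * L ^ 18 \<le> 1/64" using k0 by simp
  have tz: "thick k z0" using n z0 by (simp add: thick_def k_def)
  obtain Y R where Y: "finite Y" "Y \<subseteq> C" "R \<ge> 1"
    "\<And>y. thick k y \<Longrightarrow> \<exists>g\<in>G. \<exists>s>0. \<exists>z\<in>Y. comparable R (s *\<^sub>R (g *v y)) z" using cover[OF k] by blast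
  define F1 where "F1 = (\<Union>z\<in>Y. {A\<in>G. comparable (R * L * R) z (A *v z)})"
  define F2 where "F2 = (\<Union>z\<in>Y. {A\<in>G. comparable (R * 8 * R) z (A *v z)})"
  \<comment> \<open>Any point of the axis will do: by \<open>axis_unique\<close> the choices differ
    in the scaling of the ends, and \<open>cL\<close> below holds for every scaling.\<close>
  define ax where "ax A = (SOME x. \<exists>p q a b. hyperbolic A p q a b \<and> x = p + q)" for A
  define F2' where "F2' = {A\<in>F2. \<exists>p q a b. hyperbolic A p q a b}"
  define F3 where "F3 = (\<Union>A\<in>F2'. {B\<in>G. comparable L (ax A) (B *v ax A)})"
  have ax: "\<exists>p q a b. hyperbolic A p q a b \<and> ax A = p + q" if "hyperbolic A p q a b" for A p q a b
    unfolding ax_def by (rule someI_ex) (use that in blast)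
  have "finite F1" "finite F2" unfolding F1_def F2_def using Y(1,2) proper by auto
  moreover have "finite F3" unfolding F3_def
  proof (rule finite_UN_I)
    show "finite F2'" using \<open>finite F2\<close> by (simp add: F2'_def)
    fix A assume "A \<in> F2'"
    then have "ax A \<in> C" using ax unfolding F2'_def hyperbolic_def by force
    then show "finite {B\<in>G. comparable L (ax A) (B *v ax A)}" by (rule proper)
  qed
  ultimately have fin: "finite (F1 \<union> F3)" by simp
  have move: "\<exists>g\<in>G. \<exists>z\<in>Y. comparable (R * S * R) z ((g ** A ** minv g) *v z)"
    if t: "thick k y" and A: "A \<in> G" and c: "comparable S y (A *v y)" and S: "S \<ge> 0" for y A S
  proof -
    obtain g s z where g: "g \<in> G" "s > 0" "z \<in> Y" "comparable R (s *\<^sub>R (g *v y)) z" using Y(4)[OF t] by blast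
    let ?A = "g ** A ** minv g" and ?w = "s *\<^sub>R (g *v y)"
    have A': "?A \<in> G" using g A minv(1) mult_G by simp
    have "comparable S ?w (s *\<^sub>R (g *v (A *v y)))" by (intro comparable_scale map_comparable g c)
    also have "s *\<^sub>R (g *v (A *v y)) = ?A *v ?w"
      by (simp add: matrix_vector_mult_scaleR matrix_vector_mul_assoc[symmetric] minv_vec[OF g(1)])
    finally have "comparable S ?w (?A *v ?w)" .
    moreover have "comparable R z ?w" using g(4) comparable_sym by blast
    moreover have "comparable R (?A *v ?w) (?A *v z)" by (rule map_comparable[OF A' g(4)])
    ultimately have "comparable (R * S * R) z (?A *v z)"
      using comparable_trans[of R z ?w S "?A *v ?w"] comparable_trans[of "R * S" z "?A *v ?w" R "?A *v z"] Y(3) S by simp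
    with g show ?thesis by blast
  qed
  have "\<exists>g\<in>G. g ** B ** minv g \<in> F1 \<union> F3" if h: "hyperbolic B p q a b" and bL: "b / a \<le> L" for B p q a b
  proof -
    have B: "B \<in> G" and ab: "0 < a" "a < b" and pq: "p + q \<in> C" using h by (auto simp: hyperbolic_def)
    have cL: "comparable L x (B' *v x)" if "hyperbolic B' p' q' a b" "x = p' + q'" for B' p' q' x
    proof -
      have "x \<in> C" "B' *v x \<in> C" using that map_C by (auto simp: hyperbolic_def)
      then show ?thesis using comparable_mono[OF hyperbolic_comparable[OF that(1)] bL] C_K that(2) by simp
    qed
    show ?thesis
    proof (cases "thick k (p + q)")
      case True
      from move[OF True B cL[OF h refl]] L obtain g z where g: "g \<in> G" "z \<in> Y" "comparable (R * L * R) z ((g ** B ** minv g) *v z)"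
        by auto
      moreover have "g ** B ** minv g \<in> G" using g B minv(1) mult_G by simp
      ultimately have "g ** B ** minv g \<in> F1" unfolding F1_def by blast
      with g(1) show ?thesis by blast
    next
      case False
      have "(b / a) ^ 18 \<le> L ^ 18" using bL ab by (intro power_mono) auto
      then have "k * (b / a) ^ 18 \<le> k * L ^ 18" using k by (intro mult_left_mono) auto
      then have "k * (b / a) ^ 18 \<le> 1/16" using kL by linarith
      from walk_to_thick[OF h k this tz False] obtain A y a' b' where
        A: "A \<in> G" "thick k y" "comparable 8 y (A *v y)" "hyperbolic A p q a' b' \<or> hyperbolic A q p a' b'" by blast
      obtain g z where g: "g \<in> G" "z \<in> Y" "comparable (R * 8 * R) z ((g ** A ** minv g) *v z)"
        using move[OF A(2,1,3)] by auto
      let ?A = "g ** A ** minv g" and ?B = "g ** B ** minv g"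
      have gA: "?A \<in> G" "?B \<in> G" using g A(1) B minv(1) mult_G by auto
      have hB: "hyperbolic ?B (g *v p) (g *v q) a b" by (rule hyperbolic_conj[OF h g(1)])
      have hA: "hyperbolic ?A (g *v p) (g *v q) a' b' \<or> hyperbolic ?A (g *v q) (g *v p) a' b'"
        using A(4) hyperbolic_conj[OF _ g(1)] by blast
      then have "\<exists>p q a b. hyperbolic ?A p q a b" by blast
      with gA g have F: "?A \<in> F2'" unfolding F2'_def F2_def by blast
      obtain p' q' c d where x: "hyperbolic ?A p' q' c d" "ax ?A = p' + q'" using hA ax by blast
      have "comparable L (ax ?A) (?B *v ax ?A)" using hA
      proof
        assume "hyperbolic ?A (g *v p) (g *v q) a' b'"
        from axis_unique(3,4)[OF this x(1)] obtain s t where "s > 0" "t > 0" "p' = s *\<^sub>R (g *v p)" "q' = t *\<^sub>R (g *v q)" by blast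
        with hyperbolic_scale[OF hB, of s t] x(2) show ?thesis by (intro cL) auto
      next
        assume "hyperbolic ?A (g *v q) (g *v p) a' b'"
        from axis_unique(3,4)[OF this x(1)] obtain s t where "s > 0" "t > 0" "p' = s *\<^sub>R (g *v q)" "q' = t *\<^sub>R (g *v p)" by blast
        with hyperbolic_scale[OF hB, of t s] x(2) show ?thesis
          by (intro cL[of _ "t *\<^sub>R (g *v p)" "s *\<^sub>R (g *v q)"]) (auto simp: add.commute)
      qed
      then have "?B \<in> F3" using F gA unfolding F3_def by blast
      with g(1) show ?thesis by blast
    qed
  qed
  note conj = this
  have sub: "F1 \<union> F3 \<subseteq> G" by (auto simp: F1_def F3_def)
  show ?thesis
    by (rule exI[of _ "F1 \<union> F3"], intro conjI fin sub allI impI; elim exE conjE; rule conj)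
qed

section \<open>Packing in the nine-dimensional space of matrices\<close>

lemma op_bound_ball_bounded: assumes y: "y \<in> C" shows "bounded {M. op_bound y t (\<lambda>v. M *v v)}"
proof -
  obtain e where e: "e > 0" "\<And>v l. norm v \<le> e * l \<Longrightarrow> order_ball y l v" using ex_order_ball[OF y] by blast
  have "order_ball y (1 / e) (axis j 1)" for j :: 3 using e by (intro e(2)) (simp add: norm_axis_1)
  obtain B where B: "\<And>v. order_ball y (t * (1 / e)) v \<Longrightarrow> norm v \<le> B" using bounded_order_ball unfolding bounded_iff by blast
  have b: "\<bar>M $ i $ j\<bar> \<le> B" if M: "op_bound y t (\<lambda>v. M *v v)" for M :: "real^3^3" and i j
  proof -
    have "order_ball y (t * (1 / e)) (M *v axis j 1)" using M \<open>order_ball y (1 / e) (axis j 1)\<close> unfolding op_bound_def by blast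
    then have "norm (column j M) \<le> B" using B by (simp add: matrix_vector_mul_component matrix_vector_mult_basis)
    moreover have "\<bar>M $ i $ j\<bar> \<le> norm (column j M)" using component_le_norm_cart[of "column j M" i] by (simp add: column_def)
    ultimately show ?thesis by simp
  qed
  have "norm M \<le> 9 * B" if M: "op_bound y t (\<lambda>v. M *v v)" for M :: "real^3^3"
  proof -
    have "norm (M $ i) \<le> 3 * B" for i
    proof -
      have "(\<Sum>j\<in>UNIV. \<bar>M $ i $ j\<bar>) \<le> (\<Sum>j\<in>(UNIV::3 set). B)" by (intro sum_mono b M)
      then show ?thesis using norm_le_l1_cart[of "M $ i"] by simp
    qed
    then have "(\<Sum>i\<in>UNIV. norm (M $ i)) \<le> (\<Sum>i\<in>(UNIV::3 set). 3 * B)" by (intro sum_mono)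
    moreover have "norm M \<le> (\<Sum>i\<in>UNIV. norm (M $ i))" unfolding norm_vec_def by (rule L2_set_le_sum) simp
    ultimately show ?thesis by simp
  qed
  then show ?thesis unfolding bounded_iff by blast
qed

lemma op_bound_ball_closed: "closed {M. op_bound y t (\<lambda>v. M *v v)}"
proof -
  have eq: "{M. op_bound y t (\<lambda>v. M *v v)} = (\<Inter>l. \<Inter>v\<in>{v. order_ball y l v}. (\<lambda>M. M *v v) -` {w. order_ball y (t * l) w})"
    by (auto simp: op_bound_def)
  have "continuous_on UNIV (\<lambda>M::real^3^3. M *v v)" for v :: "real^3"
    unfolding matrix_vector_mult_def by (intro continuous_intros)
  then have "closed ((\<lambda>M::real^3^3. M *v v) -` {w. order_ball y (t * l) w})" for l v
    by (intro closed_vimage closed_order_ball)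
  then show ?thesis unfolding eq by (intro closed_INT ballI)
qed

lemma op_bound_ball_measure: assumes y: "y \<in> C"
  shows "{M. op_bound y t (\<lambda>v. M *v v)} \<in> lmeasurable" "measure lebesgue {M. op_bound y 1 (\<lambda>v. M *v v)} > 0"
proof -
  show m: "{M. op_bound y t (\<lambda>v. M *v v)} \<in> lmeasurable" for t
    using op_bound_ball_bounded[OF y] op_bound_ball_closed by (intro lmeasurable_compact) (simp add: compact_eq_bounded_closed)
  obtain e where e: "e > 0" "\<And>v l. norm v \<le> e * l \<Longrightarrow> order_ball y l v" using ex_order_ball[OF y] by blast
  obtain b where b: "b > 0" "\<And>v. order_ball y 1 v \<Longrightarrow> norm v \<le> b" using bounded_order_ball[of y 1] unfolding bounded_pos by blast
  have nrm: "norm v \<le> b * l" if "order_ball y l v" for l v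
  proof (cases "l = 0")
    case True
    then have "v = 0" using pointed[of v] that by (simp add: order_ball_def)
    then show ?thesis using True by simp
  next
    case False
    then have l: "l > 0" using order_ball_nonneg[OF y that] by simp
    then have "order_ball y 1 ((1/l) *\<^sub>R v)" using order_ball_scale[OF that, of "1/l"] by simp
    from b(2)[OF this] l show ?thesis by (simp add: field_simps)
  qed
  have "ball 0 (e / (3 * b)) \<subseteq> {M. op_bound y 1 (\<lambda>v. M *v v)}"
  proof
    fix M :: "real^3^3" assume "M \<in> ball 0 (e / (3 * b))"
    then have M: "norm M \<le> e / (3 * b)" by simp
    have "order_ball y (1 * l) (M *v v)" if v: "order_ball y l v" for l v
    proof (rule e(2))
      have "norm (M *v v) \<le> 3 * norm M * norm v" by (rule norm_matrix_vector_le)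
      also have "\<dots> \<le> 3 * (e / (3 * b)) * (b * l)" using M nrm[OF v] e b by (intro mult_mono) auto
      also have "\<dots> = e * (1 * l)" using b by simp
      finally show "norm (M *v v) \<le> e * (1 * l)" .
    qed
    then show "M \<in> {M. op_bound y 1 (\<lambda>v. M *v v)}" by (simp add: op_bound_def)
  qed
  then have "measure lebesgue (ball (0::real^3^3) (e / (3 * b))) \<le> measure lebesgue {M. op_bound y 1 (\<lambda>v. M *v v)}"
    by (intro measure_mono_fmeasurable m) auto
  moreover have "measure lebesgue (ball (0::real^3^3) (e / (3 * b))) > 0"
    using content_ball_pos[of "e / (3 * b)"] e b by simp
  ultimately show "measure lebesgue {M. op_bound y 1 (\<lambda>v. M *v v)} > 0" by linarith
qed

lemma op_bound_ball_affine_measure: assumes y: "y \<in> C" and t: "t > 0"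
  shows "measure lebesgue {M. op_bound y t (\<lambda>v. (M - A) *v v)} = t ^ 9 * measure lebesgue {M. op_bound y 1 (\<lambda>v. M *v v)}"
    and "{M. op_bound y t (\<lambda>v. (M - A) *v v)} \<in> lmeasurable"
proof -
  have eq: "{M. op_bound y t (\<lambda>v. (M - A) *v v)} = (\<lambda>M. t *\<^sub>R M + A) ` {M. op_bound y 1 (\<lambda>v. M *v v)}"
  proof -
    have 1: "op_bound y t (\<lambda>v. (t *\<^sub>R M) *v v)" if "op_bound y 1 (\<lambda>v. M *v v)" for M :: "real^3^3"
      using that order_ball_scale[of y _ _ t] t by (auto simp: op_bound_def scaleR_matrix_vector_assoc[symmetric])
    have 2: "op_bound y 1 (\<lambda>v. ((1/t) *\<^sub>R M) *v v)" if "op_bound y t (\<lambda>v. M *v v)" for M :: "real^3^3"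
      unfolding op_bound_def
    proof (intro allI impI)
      fix l v assume "order_ball y l v"
      then have "order_ball y (t * l) (M *v v)" using that by (simp add: op_bound_def)
      from order_ball_scale[OF this, of "1/t"] t show "order_ball y (1 * l) (((1/t) *\<^sub>R M) *v v)"
        by (simp add: scaleR_matrix_vector_assoc[symmetric])
    qed
    show ?thesis
    proof (safe, goal_cases)
      case (1 M)
      from 2[OF this] t show ?case by (intro image_eqI[of _ _ "(1/t) *\<^sub>R (M - A)"]) auto
    next
      case (2 _ M)
      from 1[OF this] show ?case by simp
    qed
  qed
  show "measure lebesgue {M. op_bound y t (\<lambda>v. (M - A) *v v)} = t ^ 9 * measure lebesgue {M. op_bound y 1 (\<lambda>v. M *v v)}"
    unfolding eq using measure_lebesgue_affine[of t A "{M. op_bound y 1 (\<lambda>v. M *v v)}"] t by simp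
  have "{M. op_bound y t (\<lambda>v. (M - A) *v v)} = (\<lambda>M. A + M) ` {M. op_bound y t (\<lambda>v. M *v v)}"
    by (auto intro!: image_eqI[of _ _ "_ - A"])
  then show "{M. op_bound y t (\<lambda>v. (M - A) *v v)} \<in> lmeasurable"
    using measurable_translation[OF op_bound_ball_measure(1)[OF y]] by simp
qed

lemma op_bound_add: "op_bound y a f \<Longrightarrow> op_bound y b g \<Longrightarrow> op_bound y (a + b) (\<lambda>v. f v + g v)"
  unfolding op_bound_def using order_ball_add by (auto simp: distrib_right)

lemma op_bound_diff: "op_bound y a f \<Longrightarrow> op_bound y b g \<Longrightarrow> op_bound y (a + b) (\<lambda>v. f v - g v)"
  unfolding op_bound_def using order_ball_diff by (auto simp: distrib_right)

text \<open>Operator-norm balls of radius \<open>e = k / R / 2\<close> about these elements are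
  disjoint: if those about \<open>A\<close> and \<open>B\<close> met, \<open>A - B\<close> would
  have norm at most \<open>k / R\<close>, and since \<open>minv B\<close> has norm at most
  \<open>R\<close>, the nontrivial element \<open>minv B ** A\<close> would have displacement at
  most \<open>k\<close>. All balls lie in the one of radius \<open>R + e\<close> about 0; the
  exponent 9 is the dimension.\<close>

lemma packing: assumes y: "thick k y" and k: "k > 0" and R: "R \<ge> 1"
  shows "real (card {A\<in>G. comparable R y (A *v y)}) \<le> (1 + 2 * R\<^sup>2 / k) ^ 9"
proof -
  have yC: "y \<in> C" using y by (simp add: thick_def)
  let ?S = "{A\<in>G. comparable R y (A *v y)}"
  define e where "e = k / R / 2"
  have e: "e > 0" using k R by (simp add: e_def)
  have fin: "finite ?S" by (rule proper[OF yC])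
  define m where "m = measure lebesgue {M. op_bound y 1 (\<lambda>v. M *v v)}"
  have m: "m > 0" using op_bound_ball_measure[OF yC] by (simp add: m_def)
  define Q where "Q A = {M. op_bound y e (\<lambda>v. (M - A) *v v)}" for A
  have op_bound: "op_bound y R (\<lambda>v. A *v v)" if "A \<in> ?S" for A
    unfolding op_bound_def
  proof (intro allI impI)
    fix l v assume v: "order_ball y l v"
    show "order_ball y (R * l) (A *v v)"
      using order_ball_le[OF _ map_order_ball[OF _ v] order_ball_nonneg[OF yC v], of A R y] that by (auto simp: comparable_def)
  qed
  have disj: "A = B" if A: "A \<in> ?S" and B: "B \<in> ?S" and M: "M \<in> Q A" "M \<in> Q B" for A B M
  proof (rule ccontr)
    assume ne: "A \<noteq> B"
    have G: "A \<in> G" "B \<in> G" using A B by auto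
    have "op_bound y (e + e) (\<lambda>v. (M - B) *v v - (M - A) *v v)" using M by (intro op_bound_diff) (simp_all add: Q_def)
    then have d: "op_bound y (k / R) (\<lambda>v. A *v v - B *v v)" by (simp add: e_def matrix_vector_mult_diff_rdistrib)
    have "y \<sqsubseteq> R *\<^sub>R (B *v y)" using B by (simp add: comparable_def)
    from map_le[OF minv(1)[OF G(2)] this] have le: "minv B *v y \<sqsubseteq> R *\<^sub>R y"
      by (simp add: matrix_vector_mult_scaleR minv_vec[OF G(2)])
    have "op_bound y k (displ (minv B ** A))" unfolding op_bound_def
    proof (intro allI impI)
      fix l v assume v: "order_ball y l v"
      have l: "l \<ge> 0" using order_ball_nonneg[OF yC v] .
      have "order_ball y (k / R * l) (A *v v - B *v v)" using d v by (simp add: op_bound_def)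
      from order_ball_le[OF le map_order_ball[OF minv(1)[OF G(2)] this]] k R l
      have "order_ball y (k * l) (minv B *v (A *v v - B *v v))" by simp
      then show "order_ball y (k * l) (displ (minv B ** A) v)"
        by (simp add: matrix_vector_mult_diff_distrib minv_vec[OF G(2)] matrix_vector_mul_assoc[symmetric])
    qed
    moreover have "minv B ** A \<noteq> mat 1"
    proof
      assume "minv B ** A = mat 1"
      then have "B ** (minv B ** A) = B" by simp
      then show False using ne minv(2)[OF G(2)] by (simp add: matrix_mul_assoc)
    qed
    ultimately have "small y k (minv B ** A)" using G minv(1) mult_G by (simp add: small_def)
    then show False using y by (auto simp: thick_def)
  qed
  have meas: "Q A \<in> lmeasurable" "measure lebesgue (Q A) = e ^ 9 * m" for A
    using op_bound_ball_affine_measure[OF yC e, of A] by (auto simp: Q_def m_def)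
  have "real (card ?S) * (e ^ 9 * m) = (\<Sum>A\<in>?S. measure lebesgue (Q A))" by (simp add: meas)
  also have "\<dots> = measure lebesgue (\<Union>A\<in>?S. Q A)"
  proof (rule measure_finite_Union[symmetric, OF fin])
    show "Q ` ?S \<subseteq> sets lebesgue" using meas(1) by (auto dest: fmeasurableD)
    show "disjoint_family_on Q ?S" unfolding disjoint_family_on_def using disj by blast
    show "emeasure lebesgue (Q A) \<noteq> \<infinity>" for A using fmeasurableD2[OF meas(1)] by simp
  qed
  also have "\<dots> \<le> measure lebesgue {M. op_bound y (R + e) (\<lambda>v. M *v v)}"
  proof (rule measure_mono_fmeasurable)
    show "(\<Union>A\<in>?S. Q A) \<subseteq> {M. op_bound y (R + e) (\<lambda>v. M *v v)}"
    proof safe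
      fix A M assume A: "A \<in> G" "comparable R y (A *v y)" and M: "M \<in> Q A"
      have "op_bound y (R + e) (\<lambda>v. A *v v + (M - A) *v v)" using op_bound[of A] A M by (intro op_bound_add) (auto simp: Q_def)
      then show "op_bound y (R + e) (\<lambda>v. M *v v)" by (simp add: matrix_vector_mult_diff_rdistrib)
    qed
    show "(\<Union>A\<in>?S. Q A) \<in> sets lebesgue" using meas(1) fin by (intro sets.finite_UN) (auto dest: fmeasurableD)
  qed (rule op_bound_ball_measure(1)[OF yC])
  also have "\<dots> = (R + e) ^ 9 * m"
    using op_bound_ball_affine_measure(1)[OF yC, of "R + e" 0] R e by (simp add: m_def)
  finally have "real (card ?S) * e ^ 9 \<le> (R + e) ^ 9" using m by simp
  then have "real (card ?S) \<le> ((R + e) / e) ^ 9" using e by (simp add: power_divide field_simps)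
  also have "(R + e) / e = 1 + 2 * R\<^sup>2 / k" using k R by (simp add: e_def field_simps power2_eq_square)
  finally show ?thesis .
qed

end

section \<open>Hilbert geometry and geodesics\<close>

text \<open>Homogeneous coordinates: \<open>hat\<close> puts the chart at height 1,
  \<open>hat_dir\<close> is the linear part of \<open>hat\<close>, and \<open>unhat\<close> is the
  central projection back to the chart.\<close>

definition hat :: "real^2 \<Rightarrow> real^3" where "hat x = vector [x $ 1, x $ 2, 1]"
definition hat_dir :: "real^2 \<Rightarrow> real^3" where "hat_dir x = vector [x $ 1, x $ 2, 0]"
definition first_two :: "real^3 \<Rightarrow> real^2" where "first_two w = vector [w $ 1, w $ 2]"
definition unhat :: "real^3 \<Rightarrow> real^2" where "unhat w = (1 / w $ 3) *\<^sub>R first_two w"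

lemma hat_nth [simp]: "hat x $ 1 = x $ 1" "hat x $ 2 = x $ 2" "hat x $ 3 = 1"
  and hat_dir_nth [simp]: "hat_dir x $ 1 = x $ 1" "hat_dir x $ 2 = x $ 2" "hat_dir x $ 3 = 0"
  and first_two_nth [simp]: "first_two w $ 1 = w $ 1" "first_two w $ 2 = w $ 2"
  by (simp_all add: hat_def hat_dir_def first_two_def vector_3 vector_2)

lemma linear_hat_dir: "linear hat_dir" and linear_first_two: "linear first_two"
  by (auto intro!: linearI simp: vec_eq_iff forall_3 forall_2)

lemma hat_add: "hat (x + v) = hat x + hat_dir v"
  by (simp add: vec_eq_iff forall_3)

lemma first_two_hat [simp]: "first_two (hat x) = x" and first_two_hat_dir [simp]: "first_two (hat_dir x) = x" and unhat_hat [simp]: "unhat (hat x) = x"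
  by (simp_all add: vec_eq_iff forall_2 unhat_def)

lemma hat_unhat: "w $ 3 \<noteq> 0 \<Longrightarrow> w $ 3 *\<^sub>R hat (unhat w) = w"
  by (simp add: vec_eq_iff forall_3 unhat_def)

lemma unhat_scale: "t \<noteq> 0 \<Longrightarrow> unhat (t *\<^sub>R w) = unhat w"
  by (simp add: vec_eq_iff forall_2 unhat_def)

lemma hat_comb: "s + t \<noteq> 0 \<Longrightarrow> s *\<^sub>R hat u + t *\<^sub>R hat v = (s + t) *\<^sub>R hat ((s / (s + t)) *\<^sub>R u + (t / (s + t)) *\<^sub>R v)"
  by (simp add: vec_eq_iff forall_3 field_simps add_divide_distrib[symmetric])

lemma continuous_unhat: "continuous_on {w. w $ 3 \<noteq> 0} unhat"
  unfolding unhat_def using linear_continuous_on[OF linear_linear[THEN iffD2, OF linear_first_two]]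
  by (intro continuous_intros) auto

lemma bounded_linear_hat_dir: "bounded_linear hat_dir" and bounded_linear_first_two: "bounded_linear first_two"
  using linear_hat_dir linear_first_two linear_conv_bounded_linear by blast+

lemma hat_eq: "hat x = hat_dir x + axis 3 1"
  by (simp add: vec_eq_iff forall_3 axis_def)

lemma continuous_on_hat [continuous_intros]: "continuous_on S f \<Longrightarrow> continuous_on S (\<lambda>x. hat (f x))"
  unfolding hat_eq by (intro continuous_intros bounded_linear.continuous_on[OF bounded_linear_hat_dir])

definition cone_over :: "(real^2) set \<Rightarrow> (real^3) set" where
  "cone_over U = {w. w $ 3 > 0 \<and> unhat w \<in> U}"

lemma cone_over_iff: "w \<in> cone_over U \<longleftrightarrow> (\<exists>t>0. \<exists>u\<in>U. w = t *\<^sub>R hat u)"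
  by (auto simp: cone_over_def unhat_scale intro!: exI[of _ "w $ 3"] bexI[of _ "unhat w"] simp: hat_unhat)

lemma hat_cone_over [simp]: "hat u \<in> cone_over U \<longleftrightarrow> u \<in> U"
  by (simp add: cone_over_def)

text \<open>The line from \<open>p\<close> to \<open>q\<close> in its unit-speed Hilbert
  parametrisation, kept as an unnormalised vector so that a translation along it becomes diagonal in
  \<open>hat p\<close> and \<open>hat q\<close>.\<close>

definition chord :: "real^2 \<Rightarrow> real^2 \<Rightarrow> real \<Rightarrow> real^3" where
  "chord p q t = exp (- t) *\<^sub>R hat p + exp t *\<^sub>R hat q"

lemma chord_swap: "chord p q t = chord q p (- t)"
  by (simp add: chord_def add.commute)

lemma chord_3 [simp]: "chord p q t $ 3 = exp (- t) + exp t"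
  by (simp add: chord_def)

lemma unhat_chord: "unhat (chord p q t) = (exp (- t) / (exp (- t) + exp t)) *\<^sub>R p + (exp t / (exp (- t) + exp t)) *\<^sub>R q"
  by (simp add: vec_eq_iff forall_2 unhat_def chord_def add_divide_distrib)

lemma exp_sum_pos: "exp (- t) + exp (t::real) > 0" by (simp add: add_pos_pos)

section \<open>Strictly convex plane domains and the cones over them\<close>

locale convex_domain =
  fixes U :: "(real^2) set"
  assumes open_U: "open U" and convex_U: "convex U" and bounded_U: "bounded U" and ne_U: "U \<noteq> {}"
    and strict_U: "x \<noteq> y \<Longrightarrow> \<not> closed_segment x y \<subseteq> frontier U"
begin

text \<open>Boundedness of \<open>U\<close> excludes nonzero limits at height 0.\<close>

lemma closure_cone_over: "closure (cone_over U) = {w. w = 0 \<or> w $ 3 > 0 \<and> unhat w \<in> closure U}"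
proof (intro equalityI subsetI)
  fix w assume "w \<in> closure (cone_over U)"
  then obtain f where f: "\<And>n. f n \<in> cone_over U" "f \<longlonglongrightarrow> w" unfolding closure_sequential by blast
  have f3: "(\<lambda>n. f n $ 3) \<longlonglongrightarrow> w $ 3" by (intro tendsto_intros f)
  have w3: "w $ 3 \<ge> 0" using f(1) by (intro LIMSEQ_le_const[OF f3]) (auto simp: cone_over_def less_imp_le)
  show "w \<in> {w. w = 0 \<or> w $ 3 > 0 \<and> unhat w \<in> closure U}"
  proof (cases "w $ 3 = 0")
    case True
    obtain B where B: "\<And>u. u \<in> U \<Longrightarrow> norm u \<le> B" using bounded_U unfolding bounded_iff by blast
    have trf: "(\<lambda>n. first_two (f n)) \<longlonglongrightarrow> first_two w" by (intro bounded_linear.tendsto[OF bounded_linear_first_two] f)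
    have "norm (first_two (f n)) \<le> f n $ 3 * B" for n
    proof -
      have "f n $ 3 > 0" "norm (unhat (f n)) \<le> B" using f(1)[of n] B by (auto simp: cone_over_def)
      then show ?thesis by (simp add: unhat_def field_simps)
    qed
    then have "norm (first_two w) \<le> w $ 3 * B"
      by (intro LIMSEQ_le[OF tendsto_norm[OF trf] tendsto_mult[OF f3 tendsto_const]]) auto
    then have "first_two w = 0" using True by simp
    then have "w $ 1 = 0" "w $ 2 = 0" using first_two_nth[of w] by simp_all
    with True have "w = 0" by (simp add: vec_eq_iff forall_3)
    then show ?thesis by simp
  next
    case False
    then have pos: "w $ 3 > 0" using w3 by simp
    have "(\<lambda>n. unhat (f n)) \<longlonglongrightarrow> unhat w"
      unfolding unhat_def using False by (intro tendsto_intros f3 bounded_linear.tendsto[OF bounded_linear_first_two] f)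
    moreover have "unhat (f n) \<in> U" for n using f(1)[of n] by (simp add: cone_over_def)
    ultimately have "unhat w \<in> closure U" unfolding closure_sequential by (intro exI[of _ "\<lambda>n. unhat (f n)"]) simp
    with pos show ?thesis by simp
  qed
next
  fix w assume w: "w \<in> {w. w = 0 \<or> w $ 3 > 0 \<and> unhat w \<in> closure U}"
  show "w \<in> closure (cone_over U)"
  proof (cases "w = 0")
    case True
    obtain u where u: "u \<in> U" using ne_U by blast
    have "(\<lambda>n. inverse (real (Suc n)) *\<^sub>R hat u) \<longlonglongrightarrow> 0 *\<^sub>R hat u"
      by (intro tendsto_intros LIMSEQ_inverse_real_of_nat)
    moreover have "inverse (real (Suc n)) *\<^sub>R hat u \<in> cone_over U" for n
      using u by (simp add: cone_over_def unhat_scale)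
    ultimately show ?thesis unfolding closure_sequential True
      by (intro exI[of _ "\<lambda>n. inverse (real (Suc n)) *\<^sub>R hat u"]) simp
  next
    case False
    then have w': "w $ 3 > 0" "unhat w \<in> closure U" using w by auto
    then obtain u where u: "\<And>n. u n \<in> U" "u \<longlonglongrightarrow> unhat w" unfolding closure_sequential by blast
    have "(\<lambda>n. w $ 3 *\<^sub>R hat (u n)) \<longlonglongrightarrow> w $ 3 *\<^sub>R hat (unhat w)"
      unfolding hat_eq by (intro tendsto_intros bounded_linear.tendsto[OF bounded_linear_hat_dir] u)
    moreover have "w $ 3 *\<^sub>R hat (u n) \<in> cone_over U" for n
      using u(1)[of n] w' by (simp add: cone_over_def unhat_scale)
    ultimately show ?thesis unfolding closure_sequential using w' hat_unhat[of w]
      by (intro exI[of _ "\<lambda>n. w $ 3 *\<^sub>R hat (u n)"]) simp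
  qed
qed

text \<open>A point \<open>c\<close> of the segment in \<open>U\<close> would put \<open>?m\<close>
  into \<open>U\<close>, because \<open>?m\<close> is \<open>c\<close> itself or lies strictly
  between \<open>c\<close> and an endpoint. So if \<open>?m\<close> is missing, the whole segment
  lies in the frontier.\<close>

lemma segment_meets_U: assumes "u \<in> closure U" "v \<in> closure U" "u \<noteq> v" "0 < t" "t < 1"
  shows "(1 - t) *\<^sub>R u + t *\<^sub>R v \<in> U"
proof (rule ccontr)
  let ?m = "(1 - t) *\<^sub>R u + t *\<^sub>R v"
  assume m: "?m \<notin> U"
  have "closed_segment u v \<subseteq> frontier U"
  proof
    fix c assume c: "c \<in> closed_segment u v"
    then have "c \<in> closure U" using closed_segment_subset[OF assms(1,2)] convex_U by auto
    moreover have "c \<notin> U"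
    proof
      assume cU: "c \<in> U"
      obtain s where s: "c = (1 - s) *\<^sub>R u + s *\<^sub>R v" "0 \<le> s" "s \<le> 1" using c by (auto simp: in_segment)
      have int: "open_segment c w \<subseteq> U" if "w \<in> closure U" for w
        using in_interior_closure_convex_segment[OF convex_U, of c w] that cU open_U by (simp add: interior_open)
      consider "s = t" | "s < t" | "t < s" by linarith
      then show False
      proof cases
        case 1
        then show False using cU m s by simp
      next
        case 2
        \<comment> \<open>The position of \<open>?m\<close> on the segment from \<open>c\<close> to
          \<open>v\<close>.\<close>
        define r where "r = (t - s) / (1 - s)"
        have r: "0 < r" "r < 1" using 2 assms s by (auto simp: r_def field_simps)
        have "r * (1 - s) = t - s" using 2 assms by (simp add: r_def)
        then have "(1 - r) * (1 - s) = 1 - t" "(1 - r) * s + r = t" by (simp_all add: algebra_simps)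
        then have eq: "?m = (1 - r) *\<^sub>R c + r *\<^sub>R v"
          by (simp add: s scaleR_add_right add.assoc scaleR_add_left[symmetric])
        have "c \<noteq> v"
        proof
          assume "c = v"
          with eq have "?m = v" by (simp add: algebra_simps)
          then have "(1 - t) *\<^sub>R u = (1 - t) *\<^sub>R v" by (simp add: algebra_simps)
          then show False using assms by simp
        qed
        then have "?m \<in> open_segment c v" using r eq by (auto simp: in_segment)
        then show False using int assms m by blast
      next
        case 3
        define r where "r = (s - t) / s"
        have s0: "s > 0" using 3 assms by simp
        have r: "0 < r" "r < 1" using 3 assms s0 by (auto simp: r_def field_simps)
        have "r * s = s - t" using s0 by (simp add: r_def)
        then have "(1 - r) * (1 - s) + r = 1 - t" "(1 - r) * s = t" by (simp_all add: algebra_simps)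
        then have eq: "?m = (1 - r) *\<^sub>R c + r *\<^sub>R u"
          by (simp add: s scaleR_add_right algebra_simps) (simp add: scaleR_add_left[symmetric] algebra_simps)
        have "c \<noteq> u"
        proof
          assume "c = u"
          with eq have "?m = u" by (simp add: algebra_simps)
          then have "t *\<^sub>R u = t *\<^sub>R v" by (auto simp: algebra_simps)
          then show False using assms by simp
        qed
        then have "?m \<in> open_segment c u" using r eq by (auto simp: in_segment)
        then show False using int assms m by blast
      qed
    qed
    ultimately show "c \<in> frontier U" by (simp add: frontier_def interior_open[OF open_U])
  qed
  with strict_U assms(3) show False by blast
qed

sublocale strict_cone "cone_over U"
proof
  have "open {w::real^3. w $ 3 > 0}" by (intro open_Collect_less continuous_intros)
  then have "open ({w. w $ 3 > 0} \<inter> unhat -` U)"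
    by (intro continuous_open_preimage open_U continuous_on_subset[OF continuous_unhat]) auto
  moreover have "cone_over U = {w. w $ 3 > 0} \<inter> unhat -` U" by (auto simp: cone_over_def)
  ultimately show "open (cone_over U)" by simp
  show "cone_over U \<noteq> {}" using ne_U hat_cone_over by blast
  show sc: "t *\<^sub>R x \<in> cone_over U" if "x \<in> cone_over U" "t > 0" for x t
    using that by (simp add: cone_over_def unhat_scale)
  show "convex (cone_over U)"
  proof (rule convexI)
    fix x y and a b :: real assume h: "x \<in> cone_over U" "y \<in> cone_over U" "0 \<le> a" "0 \<le> b" "a + b = 1"
    obtain s u t v where st: "s > 0" "u \<in> U" "x = s *\<^sub>R hat u" "t > 0" "v \<in> U" "y = t *\<^sub>R hat v"
      using h by (auto simp: cone_over_iff)
    have p: "a * s + b * t > 0"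
    proof (cases "a = 0")
      case False
      then show ?thesis using h st by (intro add_pos_nonneg) auto
    qed (use h st in auto)
    have "a *\<^sub>R x + b *\<^sub>R y = (a * s + b * t) *\<^sub>R hat ((a * s / (a * s + b * t)) *\<^sub>R u + (b * t / (a * s + b * t)) *\<^sub>R v)"
      using hat_comb[of "a * s" "b * t" u v] p st by simp
    moreover have "(a * s / (a * s + b * t)) *\<^sub>R u + (b * t / (a * s + b * t)) *\<^sub>R v \<in> U"
      using p st h by (intro convexD[OF convex_U]) (auto simp: add_divide_distrib[symmetric])
    ultimately show "a *\<^sub>R x + b *\<^sub>R y \<in> cone_over U" using p by (auto simp: cone_over_iff)
  qed
  show "x = 0" if "x \<in> closure (cone_over U)" "- x \<in> closure (cone_over U)" for x
    using that by (auto simp: closure_cone_over)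
  show "\<exists>k>0. y = k *\<^sub>R x"
    if h: "x \<in> closure (cone_over U)" "y \<in> closure (cone_over U)" "x \<noteq> 0" "y \<noteq> 0" "x + y \<notin> cone_over U" for x y
  proof -
    have p: "x $ 3 > 0" "unhat x \<in> closure U" "y $ 3 > 0" "unhat y \<in> closure U" using h by (auto simp: closure_cone_over)
    have xy: "x = x $ 3 *\<^sub>R hat (unhat x)" "y = y $ 3 *\<^sub>R hat (unhat y)" using p by (simp_all add: hat_unhat)
    show ?thesis
    proof (cases "unhat x = unhat y")
      case True
      then have "(y $ 3 / x $ 3) *\<^sub>R x = (y $ 3 / x $ 3) *\<^sub>R (x $ 3 *\<^sub>R hat (unhat y))" using xy by metis
      then have "y = (y $ 3 / x $ 3) *\<^sub>R x" using p xy(2) by simp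
      with p show ?thesis by (intro exI[of _ "y $ 3 / x $ 3"]) simp
    next
      case False
      let ?s = "x $ 3" and ?t = "y $ 3"
      have "1 - ?t / (?s + ?t) = ?s / (?s + ?t)" using p by (simp add: field_simps)
      then have "(?s / (?s + ?t)) *\<^sub>R unhat x + (?t / (?s + ?t)) *\<^sub>R unhat y \<in> U"
        using segment_meets_U[OF p(2,4) False, of "?t / (?s + ?t)"] p by simp
      moreover have "x + y = (?s + ?t) *\<^sub>R hat ((?s / (?s + ?t)) *\<^sub>R unhat x + (?t / (?s + ?t)) *\<^sub>R unhat y)"
        using hat_comb[of ?s ?t "unhat x" "unhat y"] p xy by simp
      ultimately have "x + y \<in> cone_over U" using p by (auto simp: cone_over_iff intro!: exI[of _ "?s + ?t"])
      with h show ?thesis by blast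
    qed
  qed
qed

section \<open>Exit points, the Finsler norm and the Hilbert metric\<close>

notation le (infix "\<sqsubseteq>" 50)

text \<open>Convexity excludes a second frontier point on the ray; this validates the definite
  description in \<open>exit_point\<close> and gives its parameter.\<close>

lemma exit_param: assumes "x \<in> U" "v \<noteq> 0"
  shows "\<exists>a>0. exit_point U x (x + v) = x + a *\<^sub>R v \<and> x + a *\<^sub>R v \<in> frontier U \<and> (\<forall>s\<ge>0. x + s *\<^sub>R v \<in> U \<longleftrightarrow> s < a)"
proof -
  have int: "interior U = U" by (rule interior_open[OF open_U])
  obtain a where a: "a > 0" "x + a *\<^sub>R v \<in> frontier U" "\<And>e. 0 \<le> e \<Longrightarrow> e < a \<Longrightarrow> x + e *\<^sub>R v \<in> interior U"
    using ray_to_frontier[OF bounded_U, of x v] assms int by blast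
  have out: "x + s *\<^sub>R v \<notin> closure U" if "s > a" for s
  proof
    assume c: "x + s *\<^sub>R v \<in> closure U"
    have "x \<noteq> x + s *\<^sub>R v" using that a assms by simp
    moreover have "x + a *\<^sub>R v = (1 - a / s) *\<^sub>R x + (a / s) *\<^sub>R (x + s *\<^sub>R v)"
      using that a by (simp add: algebra_simps)
    ultimately have "x + a *\<^sub>R v \<in> open_segment x (x + s *\<^sub>R v)"
      unfolding in_segment using that a by (intro conjI exI[of _ "a / s"]) auto
    then have "x + a *\<^sub>R v \<in> U" using in_interior_closure_convex_segment[OF convex_U _ c, of x] assms int by auto
    then show False using a(2) by (simp add: frontier_def int)
  qed
  have iff: "x + s *\<^sub>R v \<in> U \<longleftrightarrow> s < a" if "s \<ge> 0" for s
  proof (cases "s = a")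
    case True
    then show ?thesis using a(2) by (simp add: frontier_def int)
  next
    case False
    then show ?thesis using a(3)[of s] out[of s] that int closure_subset[of U] by force
  qed
  have uniq: "s = a" if "s > 0" "x + s *\<^sub>R v \<in> frontier U" for s
  proof -
    have "x + s *\<^sub>R v \<notin> U" "x + s *\<^sub>R v \<in> closure U" using that by (auto simp: frontier_def int)
    moreover from this have "\<not> a < s" using out[of s] by blast
    ultimately show ?thesis using iff[of s] that by auto
  qed
  have "exit_point U x (x + v) = x + a *\<^sub>R v" unfolding exit_point_def
  proof (rule the_equality)
    show "x + a *\<^sub>R v \<in> frontier U \<and> (\<exists>t>0. x + a *\<^sub>R v = x + t *\<^sub>R (x + v - x))" using a by auto
    show "p = x + a *\<^sub>R v" if "p \<in> frontier U \<and> (\<exists>t>0. p = x + t *\<^sub>R (x + v - x))" for p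
      using that uniq by auto
  qed
  with a iff show ?thesis by blast
qed

text \<open>The unit ball of the Finsler norm at \<open>x\<close>, described without reference to exit points.\<close>

definition finsler_ball :: "real^2 \<Rightarrow> (real^2) set" where
  "finsler_ball x = {v. \<exists>s>0. \<exists>t>0. x + s *\<^sub>R v \<in> U \<and> x - t *\<^sub>R v \<in> U \<and> 1 / s + 1 / t < 2}"

lemma hilbert_norm_ball: assumes x: "x \<in> U" shows "{v. hilbert_norm U x v < 1} = finsler_ball x"
proof -
  have "v \<in> {v. hilbert_norm U x v < 1} \<longleftrightarrow> v \<in> finsler_ball x" for v
  proof -
  obtain a b where ab: "v \<noteq> 0 \<Longrightarrow> a > 0" "v \<noteq> 0 \<Longrightarrow> b > 0"
    "v \<noteq> 0 \<Longrightarrow> exit_point U x (x + v) = x + a *\<^sub>R v" "v \<noteq> 0 \<Longrightarrow> exit_point U x (x - v) = x - b *\<^sub>R v"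
    "\<And>s. v \<noteq> 0 \<Longrightarrow> s \<ge> 0 \<Longrightarrow> x + s *\<^sub>R v \<in> U \<longleftrightarrow> s < a" "\<And>s. v \<noteq> 0 \<Longrightarrow> s \<ge> 0 \<Longrightarrow> x - s *\<^sub>R v \<in> U \<longleftrightarrow> s < b"
  proof (cases "v = 0")
    case False
    obtain a where "a > 0" "exit_point U x (x + v) = x + a *\<^sub>R v" "\<And>s. s \<ge> 0 \<Longrightarrow> x + s *\<^sub>R v \<in> U \<longleftrightarrow> s < a"
      using exit_param[OF x False] by blast
    moreover obtain b where "b > 0" "exit_point U x (x + - v) = x + b *\<^sub>R (- v)" "\<And>s. s \<ge> 0 \<Longrightarrow> x + s *\<^sub>R (- v) \<in> U \<longleftrightarrow> s < b"
      using exit_param[OF x, of "- v"] False by auto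
    ultimately show ?thesis using that[of a b] by simp
  qed (use that in auto)
  have nrm: "hilbert_norm U x v = (1 / a + 1 / b) / 2" if v: "v \<noteq> 0"
    unfolding hilbert_norm_def ab(3)[OF v] ab(4)[OF v] using v ab(1)[OF v] ab(2)[OF v]
    by (simp add: dist_norm) (simp add: field_simps)
  show ?thesis
  proof
    assume h: "v \<in> {v. hilbert_norm U x v < 1}"
    show "v \<in> finsler_ball x"
    proof (cases "v = 0")
      case True
      then show ?thesis using x by (auto simp: finsler_ball_def intro!: exI[of _ 2])
    next
      case v: False
      then have lt: "1 / a + 1 / b < 2" using h nrm by simp
      \<comment> \<open>The exit points themselves are not in \<open>U\<close>. Both parameters are
        shrunk by a factor \<open>e\<close> below 1, and the strict inequality survives for
        \<open>e\<close> near 1.\<close>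
      have "((\<lambda>e. 1 / (a * e) + 1 / (b * e)) \<longlongrightarrow> 1 / (a * 1) + 1 / (b * 1)) (at_left 1)"
        using ab(1,2)[OF v] by (intro tendsto_intros) auto
      then have "eventually (\<lambda>e. 1 / (a * e) + 1 / (b * e) < 2) (at_left 1)"
        using lt by (intro order_tendstoD(2)) auto
      moreover have "eventually (\<lambda>e. e \<in> {0<..<1::real}) (at_left 1)"
        by (rule eventually_at_left_real) simp
      ultimately have "eventually (\<lambda>e. 1 / (a * e) + 1 / (b * e) < 2 \<and> e \<in> {0<..<1::real}) (at_left 1)"
        by (rule eventually_conj)
      then obtain e where e: "1 / (a * e) + 1 / (b * e) < 2" "0 < e" "e < 1"
        using eventually_happens by force
      then show ?thesis unfolding finsler_ball_def using ab(1,2,5,6)[OF v]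
        by (intro CollectI exI[of _ "a * e"] exI[of _ "b * e"] conjI) auto
    qed
  next
    assume h: "v \<in> finsler_ball x"
    show "v \<in> {v. hilbert_norm U x v < 1}"
    proof (cases "v = 0")
      case v: False
      obtain s t where st: "s > 0" "t > 0" "x + s *\<^sub>R v \<in> U" "x - t *\<^sub>R v \<in> U" "1 / s + 1 / t < 2"
        using h by (auto simp: finsler_ball_def)
      then have "s < a" "t < b" using ab(5,6)[OF v] by auto
      then have "1 / a < 1 / s" "1 / b < 1 / t" using st by (auto intro!: divide_strict_left_mono)
      then show ?thesis using st nrm[OF v] by simp
    qed (simp add: hilbert_norm_def)
  qed
  qed
  then show ?thesis by blast
qed

text \<open>Birkhoff's description of the Hilbert metric by the order. For the exit point
  \<open>?p\<close> one has \<open>k *\<^sub>R hat y - hat x = (k - 1) *\<^sub>R hat ?p\<close>, a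
  boundary vector of the cone, so no factor below \<open>k\<close> will do.\<close>

lemma hilbert_ratio: assumes x: "x \<in> U" and y: "y \<in> U" and ne: "x \<noteq> y"
  shows "\<exists>k>1. dist x (exit_point U x y) / dist y (exit_point U x y) = k \<and>
    (\<forall>l. hat x \<sqsubseteq> l *\<^sub>R hat y \<longleftrightarrow> k \<le> l)"
proof -
  have v: "y - x \<noteq> 0" using ne by simp
  obtain a where a: "a > 0" "exit_point U x y = x + a *\<^sub>R (y - x)" "x + a *\<^sub>R (y - x) \<in> frontier U"
    "\<And>s. s \<ge> 0 \<Longrightarrow> x + s *\<^sub>R (y - x) \<in> U \<longleftrightarrow> s < a" using exit_param[OF x v] by auto
  have a1: "a > 1" using a(4)[of 1] y by simp
  define k where "k = a / (a - 1)"
  have k: "k > 1" "k - 1 = 1 / (a - 1)" using a1 by (auto simp: k_def field_simps)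
  let ?p = "x + a *\<^sub>R (y - x)"
  have "dist x ?p = a * norm (y - x)" using a by (simp add: dist_norm)
  moreover have "y - ?p = (1 - a) *\<^sub>R (y - x)" by (simp add: algebra_simps)
  then have "dist y ?p = (a - 1) * norm (y - x)" using a1 by (simp add: dist_norm)
  ultimately have r: "dist x ?p / dist y ?p = k" using v by (simp add: k_def)
  have pK: "hat ?p \<in> K" using a(3) by (auto simp: closure_cone_over frontier_def)
  have pC: "?p \<notin> U" using a(3) by (simp add: frontier_def interior_open[OF open_U])
  have eq: "k *\<^sub>R hat y - hat x = (k - 1) *\<^sub>R hat ?p"
    using a1 unfolding k(2) by (simp add: vec_eq_iff forall_3 k_def field_simps)
  have "hat x \<sqsubseteq> l *\<^sub>R hat y \<longleftrightarrow> k \<le> l" for l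
  proof
    assume l: "hat x \<sqsubseteq> l *\<^sub>R hat y"
    show "k \<le> l"
    proof (rule ccontr)
      assume "\<not> k \<le> l"
      then have "(k - l) *\<^sub>R hat y \<in> cone_over U" using y by (intro scale_C) auto
      from add_CK[OF this l[unfolded le_def]]
      have "(k - l) *\<^sub>R hat y + (l *\<^sub>R hat y - hat x) \<in> cone_over U" .
      also have "(k - l) *\<^sub>R hat y + (l *\<^sub>R hat y - hat x) = k *\<^sub>R hat y - hat x" by (simp add: algebra_simps)
      finally have "(k - 1) *\<^sub>R hat ?p \<in> cone_over U" by (simp only: eq)
      from scale_C[OF this, of "1 / (k - 1)"] k(1) have "hat ?p \<in> cone_over U" by simp
      with pC show False by simp
    qed
  next
    assume l: "k \<le> l"
    have "hat x \<sqsubseteq> k *\<^sub>R hat y" using scale_K[OF pK, of "k - 1"] k(1) unfolding le_def eq by simp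
    also have "\<dots> \<sqsubseteq> l *\<^sub>R hat y" using y l C_K by (intro le_scalar) auto
    finally show "hat x \<sqsubseteq> l *\<^sub>R hat y" .
  qed
  with k r a(2) show ?thesis by auto
qed

definition max_ratio :: "real^2 \<Rightarrow> real^2 \<Rightarrow> real" where "max_ratio x y = Inf {l. hat x \<sqsubseteq> l *\<^sub>R hat y}"

lemma max_ratio_eqI: "(\<And>l. hat x \<sqsubseteq> l *\<^sub>R hat y \<longleftrightarrow> k \<le> l) \<Longrightarrow> max_ratio x y = k"
proof -
  assume "\<And>l. hat x \<sqsubseteq> l *\<^sub>R hat y \<longleftrightarrow> k \<le> l"
  then have "{l. hat x \<sqsubseteq> l *\<^sub>R hat y} = {k..}" by auto
  then show ?thesis by (simp add: max_ratio_def)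
qed

lemma max_ratio: assumes "x \<in> U" "y \<in> U"
  shows "hat x \<sqsubseteq> l *\<^sub>R hat y \<longleftrightarrow> max_ratio x y \<le> l" "x \<noteq> y \<Longrightarrow> max_ratio x y > 1" "max_ratio x x = 1"
    "x \<noteq> y \<Longrightarrow> max_ratio x y = dist x (exit_point U x y) / dist y (exit_point U x y)"
proof -
  have xx: "hat x \<sqsubseteq> l *\<^sub>R hat x \<longleftrightarrow> 1 \<le> l" for l
    using le_scalar_iff[of "hat x" 1 l] assms by simp
  then show xx': "max_ratio x x = 1" by (rule max_ratio_eqI)
  have ne: "(hat x \<sqsubseteq> l *\<^sub>R hat y \<longleftrightarrow> max_ratio x y \<le> l) \<and> max_ratio x y > 1 \<and>
      max_ratio x y = dist x (exit_point U x y) / dist y (exit_point U x y)" if "x \<noteq> y" for l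
  proof -
    obtain k where k: "k > 1" "dist x (exit_point U x y) / dist y (exit_point U x y) = k"
      "\<And>l. hat x \<sqsubseteq> l *\<^sub>R hat y \<longleftrightarrow> k \<le> l" using hilbert_ratio[OF assms \<open>x \<noteq> y\<close>] by blast
    have "max_ratio x y = k" by (rule max_ratio_eqI[OF k(3)])
    with k show ?thesis by simp
  qed
  show "hat x \<sqsubseteq> l *\<^sub>R hat y \<longleftrightarrow> max_ratio x y \<le> l" using ne xx xx' by (cases "x = y") auto
  show "x \<noteq> y \<Longrightarrow> max_ratio x y > 1" "x \<noteq> y \<Longrightarrow> max_ratio x y = dist x (exit_point U x y) / dist y (exit_point U x y)"
    using ne by blast+
qed

lemma max_ratio_ge_1: "x \<in> U \<Longrightarrow> y \<in> U \<Longrightarrow> max_ratio x y \<ge> 1"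
  using max_ratio(2,3)[of x y] by (cases "x = y") auto

lemma hilbert_dist_max_ratio: assumes "x \<in> U" "y \<in> U" shows "hilbert_dist U x y = ln (max_ratio x y * max_ratio y x) / 2"
proof (cases "x = y")
  case True
  then show ?thesis using max_ratio(3)[OF assms] by (simp add: hilbert_dist_def)
next
  case False
  then show ?thesis using max_ratio(4)[OF assms False] max_ratio(4)[OF assms(2,1)]
    by (simp add: hilbert_dist_def Let_def)
qed

lemma max_ratio_attained: "x \<in> U \<Longrightarrow> y \<in> U \<Longrightarrow> max_ratio x y *\<^sub>R hat y - hat x \<in> K"
  using max_ratio(1)[of x y "max_ratio x y"] by (simp add: le_def)

lemma max_ratio_submult: assumes "x \<in> U" "y \<in> U" "z \<in> U" shows "max_ratio x z \<le> max_ratio x y * max_ratio y z"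
proof -
  have "hat x \<sqsubseteq> max_ratio x y *\<^sub>R hat y" using max_ratio_attained assms by (simp add: le_def)
  also have "\<dots> \<sqsubseteq> max_ratio x y *\<^sub>R (max_ratio y z *\<^sub>R hat z)"
    using max_ratio_attained[of y z] max_ratio_ge_1[of x y] assms by (intro le_scale) (auto simp: le_def)
  finally show ?thesis using max_ratio(1)[OF assms(1,3)] by simp
qed

text \<open>Equality in the triangle inequality makes the sum of two boundary vectors a boundary vector, so
  strict convexity makes them parallel.\<close>

lemma hilbert_collinear:
  assumes U: "x \<in> U" "y \<in> U" "z \<in> U" and ne: "x \<noteq> y" "y \<noteq> z"
    and eq: "hilbert_dist U x z = hilbert_dist U x y + hilbert_dist U y z"
  shows "\<exists>t. 0 < t \<and> t < 1 \<and> y = (1 - t) *\<^sub>R x + t *\<^sub>R z"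
proof -
  define a b where "a = max_ratio x y" and "b = max_ratio y z"
  have ab: "a > 1" "b > 1" using max_ratio(2) U ne by (auto simp: a_def b_def)
  have pos: "max_ratio u v \<ge> 1" if "u \<in> U" "v \<in> U" for u v using max_ratio_ge_1 that by blast
  have p: "max_ratio x y \<ge> 1" "max_ratio y x \<ge> 1" "max_ratio y z \<ge> 1" "max_ratio z y \<ge> 1" "max_ratio x z \<ge> 1" "max_ratio z x \<ge> 1" using pos U by auto
  have "ln (max_ratio x z * max_ratio z x) = ln (max_ratio x y * max_ratio y x) + ln (max_ratio y z * max_ratio z y)"
    using eq U by (simp add: hilbert_dist_max_ratio)
  also have "\<dots> = ln ((max_ratio x y * max_ratio y x) * (max_ratio y z * max_ratio z y))"
    using p by (intro ln_mult_pos[symmetric] mult_pos_pos) auto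
  finally have prod: "max_ratio x z * max_ratio z x = (a * b) * (max_ratio z y * max_ratio y x)"
    using p by (subst (asm) ln_inj_iff) (auto intro!: mult_pos_pos simp: a_def b_def)
  have le: "max_ratio x z \<le> a * b" "max_ratio z x \<le> max_ratio z y * max_ratio y x" using max_ratio_submult U by (auto simp: a_def b_def)
  \<comment> \<open>Two inequalities between positive factors whose products agree must be
    equalities.\<close>
  have ab_eq: "max_ratio x z = a * b"
  proof (rule ccontr)
    assume "max_ratio x z \<noteq> a * b"
    then have "max_ratio x z < a * b" using le by simp
    then have "max_ratio x z * max_ratio z x < (a * b) * max_ratio z x" using p by (intro mult_strict_right_mono) auto
    also have "\<dots> \<le> (a * b) * (max_ratio z y * max_ratio y x)" using le ab by (intro mult_left_mono) auto
    finally show False using prod by simp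
  qed
  define e1 e2 where "e1 = a *\<^sub>R hat y - hat x" and "e2 = b *\<^sub>R hat z - hat y"
  have eK: "e1 \<in> K" "e2 \<in> K" using max_ratio_attained U by (auto simp: e1_def e2_def a_def b_def)
  have e3: "e1 $ 3 = a - 1" "e2 $ 3 = b - 1" by (auto simp: e1_def e2_def)
  have nz: "e1 \<noteq> 0" "e2 \<noteq> 0" using e3 ab by auto
  have sum: "e1 + a *\<^sub>R e2 = (a * b) *\<^sub>R hat z - hat x" by (simp add: e1_def e2_def algebra_simps)
  \<comment> \<open>If the sum were interior, some positive multiple of \<open>hat z\<close> could
    be subtracted from it, which would lower \<open>max_ratio x z\<close>.\<close>
  have "e1 + a *\<^sub>R e2 \<notin> cone_over U"
  proof
    assume w: "e1 + a *\<^sub>R e2 \<in> cone_over U"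
    obtain R where R: "R \<ge> 1" "comparable R (hat z) (e1 + a *\<^sub>R e2)" using ex_comparable[OF _ w, of "hat z"] U by auto
    then have "hat z \<sqsubseteq> R *\<^sub>R (e1 + a *\<^sub>R e2)" by (simp add: comparable_def)
    from le_scale[OF this, of "1/R"] R have "(1/R) *\<^sub>R hat z \<sqsubseteq> (a * b) *\<^sub>R hat z - hat x" by (simp add: sum)
    then have "hat x \<sqsubseteq> (a * b - 1/R) *\<^sub>R hat z" by (simp add: le_def algebra_simps)
    then have "max_ratio x z \<le> a * b - 1/R" using max_ratio(1)[OF U(1,3)] by simp
    then show False using ab_eq R by simp
  qed
  then obtain k where k: "k > 0" "a *\<^sub>R e2 = k *\<^sub>R e1"
    using strict[of e1 "a *\<^sub>R e2"] eK scale_K[of e2 a] nz ab by auto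
  have k3: "a * (b - 1) = k * (a - 1)" using arg_cong[OF k(2), of "\<lambda>w. w $ 3"] e3 by simp
  define c where "c = a + k * a"
  have c: "c > 0" "c = a * b + k" using ab k k3 by (auto simp: c_def algebra_simps add_pos_pos)
  have "a *\<^sub>R first_two e2 = k *\<^sub>R first_two e1" using k(2) by (simp add: vec_eq_iff forall_2 forall_3)
  moreover have "first_two e1 = a *\<^sub>R y - x" "first_two e2 = b *\<^sub>R z - y"
    by (simp_all add: e1_def e2_def vec_eq_iff forall_2)
  ultimately have "c *\<^sub>R y = k *\<^sub>R x + (a * b) *\<^sub>R z" by (simp add: c_def algebra_simps)
  then have "(1 / c) *\<^sub>R (c *\<^sub>R y) = (1 / c) *\<^sub>R (k *\<^sub>R x + (a * b) *\<^sub>R z)" by simp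
  then have "y = (k / c) *\<^sub>R x + (a * b / c) *\<^sub>R z" using c(1) by (simp add: scaleR_add_right)
  moreover have "k / c = 1 - a * b / c" using c by (simp add: field_simps)
  moreover have "0 < a * b / c" "a * b / c < 1" using c ab k by (simp_all add: field_simps)
  ultimately show ?thesis by metis
qed

section \<open>Chords and geodesics\<close>

lemma frontier_U: "p \<in> frontier U \<longleftrightarrow> p \<in> closure U \<and> p \<notin> U"
  by (simp add: frontier_def interior_open[OF open_U])

lemma hat_frontier: "p \<in> frontier U \<Longrightarrow> hat p \<in> K" "p \<in> frontier U \<Longrightarrow> hat p \<notin> cone_over U" "hat p \<noteq> 0"
  by (auto simp: closure_cone_over frontier_U) (metis hat_nth(3) zero_index zero_neq_one)

lemma chord_cone: assumes "p \<in> frontier U" "q \<in> frontier U" "p \<noteq> q" shows "chord p q t \<in> cone_over U"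
proof -
  let ?c = "exp (- t) + exp t"
  have "1 - exp t / ?c = exp (- t) / ?c" using exp_sum_pos[of t] by (simp add: field_simps)
  moreover have "0 < exp t / ?c" "exp t / ?c < 1" using exp_sum_pos[of t] by (simp_all add: field_simps)
  ultimately have "unhat (chord p q t) \<in> U"
    using segment_meets_U[of p q "exp t / ?c"] assms by (simp add: unhat_chord frontier_U)
  then show ?thesis using exp_sum_pos[of t] by (simp add: cone_over_def)
qed

lemma comb_in_K: assumes "p \<in> frontier U" "q \<in> frontier U" "p \<noteq> q" "\<alpha> *\<^sub>R hat p + \<beta> *\<^sub>R hat q \<in> K" shows "\<alpha> \<ge> 0"
proof (rule ccontr)
  assume a: "\<not> \<alpha> \<ge> 0"
  then have le: "(- \<alpha>) *\<^sub>R hat p \<sqsubseteq> \<beta> *\<^sub>R hat q" using assms by (simp add: le_def add.commute)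
  have pK: "(- \<alpha>) *\<^sub>R hat p \<in> K" using a hat_frontier(1)[OF assms(1)] by (intro scale_K) auto
  have b: "\<beta> > 0"
  proof (rule ccontr)
    assume "\<not> \<beta> > 0"
    then have "(- \<beta>) *\<^sub>R hat q \<in> K" using hat_frontier(1)[OF assms(2)] by (intro scale_K) auto
    from add_K[OF this le[unfolded le_def]] have "- ((- \<alpha>) *\<^sub>R hat p) \<in> K" by simp
    from pointed[OF pK this] a show False using hat_frontier(3)[of p] by simp
  qed
  obtain t where "t > 0" "(- \<alpha>) *\<^sub>R hat p = t *\<^sub>R hat q"
    using extreme_ray[of "hat q", OF _ _ pK _ le b] hat_frontier assms a by auto
  then have "(- \<alpha>) *\<^sub>R hat p = t *\<^sub>R hat q" by simp
  then have "unhat ((- \<alpha>) *\<^sub>R hat p) = unhat (t *\<^sub>R hat q)" by (rule arg_cong)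
  then show False using a \<open>t > 0\<close> assms(3) by (simp add: unhat_scale del: scaleR_minus_left)
qed

lemma chord_le: assumes "p \<in> frontier U" "q \<in> frontier U" "p \<noteq> q"
  shows "chord p q s \<sqsubseteq> l *\<^sub>R chord p q t \<longleftrightarrow> exp \<bar>s - t\<bar> \<le> l"
proof -
  have d: "l *\<^sub>R chord p q t - chord p q s = (l * exp (- t) - exp (- s)) *\<^sub>R hat p + (l * exp t - exp s) *\<^sub>R hat q"
    by (simp add: chord_def algebra_simps)
  have eq: "0 \<le> l * exp (- t) - exp (- s) \<longleftrightarrow> exp (t - s) \<le> l" "0 \<le> l * exp t - exp s \<longleftrightarrow> exp (s - t) \<le> l"
    by (simp_all add: exp_diff exp_minus field_simps)
  have "l *\<^sub>R chord p q t - chord p q s \<in> K \<longleftrightarrow> 0 \<le> l * exp (- t) - exp (- s) \<and> 0 \<le> l * exp t - exp s"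
  proof
    assume a: "l *\<^sub>R chord p q t - chord p q s \<in> K"
    then have b: "(l * exp t - exp s) *\<^sub>R hat q + (l * exp (- t) - exp (- s)) *\<^sub>R hat p \<in> K" by (simp add: d add.commute)
    show "0 \<le> l * exp (- t) - exp (- s) \<and> 0 \<le> l * exp t - exp s"
      using comb_in_K[OF assms a[unfolded d]] comb_in_K[OF assms(2,1) assms(3)[symmetric] b] by blast
  next
    assume "0 \<le> l * exp (- t) - exp (- s) \<and> 0 \<le> l * exp t - exp s"
    then show "l *\<^sub>R chord p q t - chord p q s \<in> K"
      unfolding d using hat_frontier(1) assms by (intro add_K scale_K) auto
  qed
  also have "\<dots> \<longleftrightarrow> exp \<bar>s - t\<bar> \<le> l" unfolding eq by (cases "s \<le> t") (auto intro: order_trans[rotated])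
  finally show ?thesis by (simp add: le_def)
qed

lemma hat_unhat_chord: "chord p q t = (exp (- t) + exp t) *\<^sub>R hat (unhat (chord p q t))"
  using hat_unhat[of "chord p q t"] exp_sum_pos[of t] by simp

lemma chord_dist: assumes "p \<in> frontier U" "q \<in> frontier U" "p \<noteq> q"
  shows "hilbert_dist U (unhat (chord p q s)) (unhat (chord p q t)) = \<bar>s - t\<bar>"
proof -
  define c where "c t = exp (- t) + exp t" for t :: real
  define x where "x t = unhat (chord p q t)" for t
  have c: "c t > 0" for t using exp_sum_pos by (simp add: c_def)
  have X: "chord p q t = c t *\<^sub>R hat (x t)" for t using hat_unhat_chord by (simp add: c_def x_def)
  have U: "x t \<in> U" for t using chord_cone[OF assms, of t] by (simp add: cone_over_def x_def)
  \<comment> \<open>The quotients of heights come from normalising to height 1; they cancel in the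
    product of the two ratios.\<close>
  have m: "max_ratio (x s) (x t) = exp \<bar>s - t\<bar> * c t / c s" for s t
  proof (rule max_ratio_eqI)
    fix l
    have "hat (x s) \<sqsubseteq> l *\<^sub>R hat (x t) \<longleftrightarrow> chord p q s \<sqsubseteq> (l * c s / c t) *\<^sub>R chord p q t"
    proof
      assume "hat (x s) \<sqsubseteq> l *\<^sub>R hat (x t)"
      from le_scale[OF this, of "c s"] c[of s] c[of t] show "chord p q s \<sqsubseteq> (l * c s / c t) *\<^sub>R chord p q t"
        by (simp add: X mult.commute)
    next
      assume "chord p q s \<sqsubseteq> (l * c s / c t) *\<^sub>R chord p q t"
      from le_scale[OF this, of "1 / c s"] c[of s] c[of t] show "hat (x s) \<sqsubseteq> l *\<^sub>R hat (x t)"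
        by (simp add: X)
    qed
    also have "\<dots> \<longleftrightarrow> exp \<bar>s - t\<bar> * c t / c s \<le> l" using chord_le[OF assms] c[of s] c[of t] by (simp add: field_simps)
    finally show "hat (x s) \<sqsubseteq> l *\<^sub>R hat (x t) \<longleftrightarrow> exp \<bar>s - t\<bar> * c t / c s \<le> l" .
  qed
  have "max_ratio (x s) (x t) * max_ratio (x t) (x s) = exp \<bar>s - t\<bar> * exp \<bar>s - t\<bar>"
    unfolding m using c[of s] c[of t] by (simp add: abs_minus_commute)
  also have "\<dots> = exp (2 * \<bar>s - t\<bar>)" by (simp add: exp_add[symmetric])
  finally show ?thesis using hilbert_dist_max_ratio[OF U U, of s t] by (simp add: x_def)
qed

lemma on_chord: assumes "0 < \<theta>" "\<theta> < 1" shows "\<exists>t. (1 - \<theta>) *\<^sub>R p + \<theta> *\<^sub>R q = unhat (chord p q t)"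
proof -
  \<comment> \<open>Solves \<open>exp (2 * t) = \<theta> / (1 - \<theta>)\<close>, the ratio of the
    barycentric weights.\<close>
  define t where "t = ln (\<theta> / (1 - \<theta>)) / 2"
  have e: "exp t * exp t = \<theta> / (1 - \<theta>)" using assms by (simp add: t_def exp_add[symmetric])
  have "exp t / (exp (- t) + exp t) = (exp t * exp t) / (1 + exp t * exp t)"
    using exp_gt_zero[of t] by (simp add: exp_minus divide_simps)
  also have "\<dots> = \<theta>" unfolding e using assms by (simp add: field_simps)
  finally have 1: "exp t / (exp (- t) + exp t) = \<theta>" .
  moreover have "exp (- t) / (exp (- t) + exp t) = 1 - exp t / (exp (- t) + exp t)"
    using exp_sum_pos[of t] by (simp add: field_simps)
  ultimately show ?thesis by (intro exI[of _ t]) (simp add: unhat_chord)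
qed

lemma chord_through: assumes "x \<in> U" "y \<in> U" "x \<noteq> y"
  shows "\<exists>p q s t. p \<in> frontier U \<and> q \<in> frontier U \<and> p \<noteq> q \<and> s < t \<and> x = unhat (chord p q s) \<and> y = unhat (chord p q t)"
proof -
  have v: "y - x \<noteq> 0" "x - y \<noteq> 0" using assms by auto
  obtain a where a: "x + a *\<^sub>R (y - x) \<in> frontier U" "\<And>s. s \<ge> 0 \<Longrightarrow> x + s *\<^sub>R (y - x) \<in> U \<longleftrightarrow> s < a"
    using exit_param[OF assms(1) v(1)] by blast
  obtain b where b: "b > 0" "x + b *\<^sub>R (x - y) \<in> frontier U" using exit_param[OF assms(1) v(2)] by blast
  have a1: "a > 1" using a(2)[of 1] assms by simp
  define p q where "p = x + b *\<^sub>R (x - y)" and "q = x + a *\<^sub>R (y - x)"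
  have qp: "q = p + (a + b) *\<^sub>R (y - x)" by (simp add: p_def q_def algebra_simps)
  have pq: "p \<noteq> q" using qp v a1 b by simp
  have line: "x + s *\<^sub>R (y - x) = (1 - (b + s) / (a + b)) *\<^sub>R p + ((b + s) / (a + b)) *\<^sub>R q" for s
  proof -
    have "(1 - (b + s) / (a + b)) *\<^sub>R p + ((b + s) / (a + b)) *\<^sub>R q = p + (b + s) *\<^sub>R (y - x)"
    proof -
      have g: "(1 - r) *\<^sub>R p + r *\<^sub>R (p + d *\<^sub>R w) = p + (r * d) *\<^sub>R w" for r d and w :: "real^2"
        by (simp add: algebra_simps)
      show ?thesis unfolding qp g using a1 b by simp
    qed
    then show ?thesis by (simp add: p_def algebra_simps)
  qed
  have "\<exists>s. x + 0 *\<^sub>R (y - x) = unhat (chord p q s)" "\<exists>t. x + 1 *\<^sub>R (y - x) = unhat (chord p q t)"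
    unfolding line by (rule on_chord; use a1 b in \<open>simp add: field_simps\<close>)+
  then obtain s t where st: "x = unhat (chord p q s)" "y = unhat (chord p q t)" by auto
  have F: "p \<in> frontier U" "q \<in> frontier U" using a b by (auto simp: p_def q_def)
  have "s \<noteq> t" using st assms by auto
  then consider "s < t" | "- s < - t" by linarith
  then show ?thesis
  proof cases
    case 2
    then show ?thesis using F pq st chord_swap[of p q] by metis
  qed (use F pq st in blast)
qed

definition on_line :: "real^2 \<Rightarrow> real^2 \<Rightarrow> real^2 \<Rightarrow> bool" where
  "on_line p q x \<longleftrightarrow> (\<exists>\<theta>. x = (1 - \<theta>) *\<^sub>R p + \<theta> *\<^sub>R q)"

lemma on_line_comb: "on_line p q x \<Longrightarrow> on_line p q y \<Longrightarrow> on_line p q ((1 - t) *\<^sub>R x + t *\<^sub>R y)"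
proof -
  assume "on_line p q x" "on_line p q y"
  then obtain a b where ab: "x = (1 - a) *\<^sub>R p + a *\<^sub>R q" "y = (1 - b) *\<^sub>R p + b *\<^sub>R q" by (auto simp: on_line_def)
  show ?thesis unfolding on_line_def ab by (intro exI[of _ "(1 - t) * a + t * b"]) (simp add: algebra_simps)
qed

lemma on_line_left: assumes "on_line p q y" "on_line p q z" "y = (1 - t) *\<^sub>R x + t *\<^sub>R z" "t < 1" shows "on_line p q x"
proof -
  have "x = (1 - (- t / (1 - t))) *\<^sub>R y + (- t / (1 - t)) *\<^sub>R z"
  proof -
    have "1 - (- t / (1 - t)) = 1 / (1 - t)" using assms by (simp add: field_simps)
    moreover have "(1 / (1 - t)) *\<^sub>R y = x + (t / (1 - t)) *\<^sub>R z" using assms by (simp add: scaleR_add_right)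
    ultimately show ?thesis by simp
  qed
  with on_line_comb[OF assms(1,2), of "- t / (1 - t)"] show ?thesis by simp
qed

lemma on_line_right: assumes "on_line p q x" "on_line p q y" "y = (1 - t) *\<^sub>R x + t *\<^sub>R z" "0 < t" shows "on_line p q z"
  using on_line_left[of p q y x "1 - t" z] assms by (simp add: add.commute)

lemma on_line_chord: assumes "p \<in> frontier U" "q \<in> frontier U" "p \<noteq> q" "on_line p q x" "x \<in> U"
  shows "\<exists>t. x = unhat (chord p q t)"
proof -
  obtain \<theta> where x: "x = (1 - \<theta>) *\<^sub>R p + \<theta> *\<^sub>R q" using assms by (auto simp: on_line_def)
  have lt: "\<theta> < 1" if F: "p \<in> frontier U" "q \<in> frontier U" "x = (1 - \<theta>) *\<^sub>R p + \<theta> *\<^sub>R q" for p q \<theta>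
  proof (rule ccontr)
    assume "\<not> \<theta> < 1"
    then have t: "\<theta> \<ge> 1" by simp
    show False
    proof (cases "\<theta> = 1 \<or> p = q")
      case True
      then show False using F assms(5) by (auto simp: frontier_U algebra_simps)
    next
      case False
      then have t: "\<theta> > 1" using t by simp
      have "q = (1 - 1 / \<theta>) *\<^sub>R p + (1 / \<theta>) *\<^sub>R x"
        unfolding F(3) using t by (simp add: vec_eq_iff forall_2 field_simps)
      moreover have "p \<in> closure U" "x \<in> closure U" "p \<noteq> x" using F assms(5) closure_subset by (auto simp: frontier_U)
      ultimately have "q \<in> U" using segment_meets_U[of p x "1 / \<theta>"] t by simp
      then show False using F by (simp add: frontier_U)
    qed
  qed
  have "\<theta> < 1" using lt[OF assms(1,2) x] .
  moreover have "1 - \<theta> < 1" by (rule lt[OF assms(2,1)]) (simp add: x add.commute)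
  ultimately show ?thesis using on_chord[of \<theta> p q] x by simp
qed

text \<open>Equality in the triangle inequality puts \<open>\<sigma> s\<close> on the line through
  the two known points, and its distances to both of them determine its parameter.\<close>

lemma geodesic_extends:
  assumes F: "p \<in> frontier U" "q \<in> frontier U" "p \<noteq> q" and U: "\<And>t. \<sigma> t \<in> U"
    and iso: "\<And>s s'. s \<in> ball t e \<Longrightarrow> s' \<in> ball t e \<Longrightarrow> hilbert_dist U (\<sigma> s) (\<sigma> s') = \<bar>s - s'\<bar>"
    and s12: "s1 \<in> ball t e" "s2 \<in> ball t e" "s1 < s2"
    and eq: "\<sigma> s1 = unhat (chord p q (s1 + c))" "\<sigma> s2 = unhat (chord p q (s2 + c))"
    and s: "s \<in> ball t e"
  shows "\<sigma> s = unhat (chord p q (s + c))"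
proof -
  have ne: "\<sigma> u \<noteq> \<sigma> v" if "u \<in> ball t e" "v \<in> ball t e" "u \<noteq> v" for u v
    using iso[OF that(1,2)] that(3) by (auto simp: hilbert_dist_def)
  have col: "\<exists>r. 0 < r \<and> r < 1 \<and> \<sigma> v = (1 - r) *\<^sub>R \<sigma> u + r *\<^sub>R \<sigma> w"
    if "u \<in> ball t e" "v \<in> ball t e" "w \<in> ball t e" "u < v" "v < w" for u v w
    using that by (intro hilbert_collinear U ne) (auto simp: iso)
  have L: "on_line p q (unhat (chord p q u))" for u
  proof -
    have "exp (- u) / (exp (- u) + exp u) = 1 - exp u / (exp (- u) + exp u)"
      using exp_sum_pos[of u] by (simp add: field_simps)
    then show ?thesis unfolding on_line_def unhat_chord by metis
  qed
  then have L12: "on_line p q (\<sigma> s1)" "on_line p q (\<sigma> s2)" using eq by auto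
  show ?thesis
  proof (cases "s = s1 \<or> s = s2")
    case False
    then consider "s < s1" | "s1 < s" "s < s2" | "s2 < s" by linarith
    then have "on_line p q (\<sigma> s)"
    proof cases
      case 1
      from col[OF s s12(1,2) 1 s12(3)] L12 show ?thesis using on_line_left by blast
    next
      case 2
      from col[OF s12(1) s s12(2) 2] L12 show ?thesis using on_line_comb by metis
    next
      case 3
      from col[OF s12(1,2) s s12(3) 3] L12 show ?thesis using on_line_right by blast
    qed
    then obtain u where u: "\<sigma> s = unhat (chord p q u)" using on_line_chord[OF F _ U] by blast
    have "\<bar>u - (s1 + c)\<bar> = \<bar>s - s1\<bar>" "\<bar>u - (s2 + c)\<bar> = \<bar>s - s2\<bar>"
      using iso[OF s s12(1)] iso[OF s s12(2)] by (simp_all add: u eq chord_dist[OF F])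
    then have "u = s + c" using s12(3) by (auto simp: abs_if split: if_splits)
    with u show ?thesis by simp
  qed (use eq in auto)
qed

text \<open>Connectedness of the time axis: the set \<open>T\<close> of times near which
  \<open>\<sigma>\<close> follows the initial chord is nonempty, open and closed.\<close>

lemma geodesic_is_chord:
  assumes U: "\<And>t. \<sigma> t \<in> U"
    and loc: "\<And>t. \<exists>e>0. \<forall>s\<in>ball t e. \<forall>s'\<in>ball t e. hilbert_dist U (\<sigma> s) (\<sigma> s') = \<bar>s - s'\<bar>"
  shows "\<exists>p q c. p \<in> frontier U \<and> q \<in> frontier U \<and> p \<noteq> q \<and> (\<forall>t. \<sigma> t = unhat (chord p q (t + c)))"
proof -
  obtain e where e: "e > 0" "\<And>s s'. s \<in> ball 0 e \<Longrightarrow> s' \<in> ball 0 e \<Longrightarrow> hilbert_dist U (\<sigma> s) (\<sigma> s') = \<bar>s - s'\<bar>"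
    using loc[of 0] by blast
  have d: "hilbert_dist U (\<sigma> 0) (\<sigma> (e/2)) = e/2" using e(2)[of 0 "e/2"] e(1) by simp
  then have "\<sigma> 0 \<noteq> \<sigma> (e/2)" using e(1) by (auto simp: hilbert_dist_def)
  from chord_through[OF U U this] obtain p q c t where F: "p \<in> frontier U" "q \<in> frontier U" "p \<noteq> q"
    and ct: "c < t" "\<sigma> 0 = unhat (chord p q c)" "\<sigma> (e/2) = unhat (chord p q t)" by blast
  have "t = e/2 + c" using d ct by (simp add: chord_dist[OF F])
  with ct have eq: "\<sigma> 0 = unhat (chord p q (0 + c))" "\<sigma> (e/2) = unhat (chord p q (e/2 + c))" by auto
  define T where "T = {t. \<exists>e>0. \<forall>s\<in>ball t e. \<sigma> s = unhat (chord p q (s + c))}"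
  have "\<forall>s\<in>ball 0 e. \<sigma> s = unhat (chord p q (s + c))"
  proof
    fix s :: real assume s: "s \<in> ball 0 e"
    have b: "0 \<in> ball 0 e" "e/2 \<in> ball 0 e" "0 < e/2" using e(1) by auto
    show "\<sigma> s = unhat (chord p q (s + c))" by (rule geodesic_extends[OF F U e(2) b eq s])
  qed
  then have "0 \<in> T" using e(1) by (auto simp: T_def)
  have "open T" unfolding open_contains_ball
  proof
    fix t assume "t \<in> T"
    then obtain e where e: "e > 0" "\<And>s. s \<in> ball t e \<Longrightarrow> \<sigma> s = unhat (chord p q (s + c))" by (auto simp: T_def)
    have "ball t (e/2) \<subseteq> T"
    proof
      fix u assume u: "u \<in> ball t (e/2)"
      have "ball u (e/2) \<subseteq> ball t e"
      proof
        fix x assume "x \<in> ball u (e/2)"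
        with u show "x \<in> ball t e" unfolding mem_ball dist_real_def by linarith
      qed
      then show "u \<in> T" using e unfolding T_def by (intro CollectI exI[of _ "e/2"]) auto
    qed
    then show "\<exists>e>0. ball t e \<subseteq> T" using e(1) by (intro exI[of _ "e/2"]) simp
  qed
  moreover have "open (- T)" unfolding open_contains_ball
  proof
    fix t assume t: "t \<in> - T"
    obtain e where e: "e > 0" "\<And>s s'. s \<in> ball t e \<Longrightarrow> s' \<in> ball t e \<Longrightarrow> hilbert_dist U (\<sigma> s) (\<sigma> s') = \<bar>s - s'\<bar>"
      using loc[of t] by blast
    have "ball t e \<subseteq> - T"
    proof (rule ccontr)
      assume "\<not> ball t e \<subseteq> - T"
      then obtain u where u: "u \<in> ball t e" "u \<in> T" by blast
      then obtain d where d: "d > 0" "\<And>s. s \<in> ball u d \<Longrightarrow> \<sigma> s = unhat (chord p q (s + c))" by (auto simp: T_def)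
      obtain d' where d': "d' > 0" "ball u d' \<subseteq> ball t e" using u(1) open_ball open_contains_ball by blast
      define v where "v = u + min d d' / 2"
      have v: "v \<in> ball u d" "v \<in> ball u d'" "u < v" using d(1) d'(1) by (auto simp: v_def dist_real_def)
      have "v \<in> ball t e" using v d' by blast
      have "\<sigma> s = unhat (chord p q (s + c))" if "s \<in> ball t e" for s
        using geodesic_extends[OF F U e(2) u(1) \<open>v \<in> ball t e\<close> v(3) d(2) d(2)[OF v(1)] that] d(1) by simp
      then have "t \<in> T" using e(1) by (auto simp: T_def)
      with t show False by blast
    qed
    then show "\<exists>e>0. ball t e \<subseteq> - T" using e(1) by blast
  qed
  ultimately have "T = UNIV" using \<open>0 \<in> T\<close> clopen[of T] by (auto simp: closed_def)
  then have "t \<in> T" for t by simp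
  then have "\<sigma> t = unhat (chord p q (t + c))" for t unfolding T_def using centre_in_ball by blast
  with F show ?thesis by blast
qed

end

section \<open>Area\<close>

text \<open>A bridge between Lebesgue integrability, the setting of the change of variables, and the
  nonnegative integral that defines the area.\<close>

lemma absolutely_integrable_nn_integral:
  fixes f :: "'a::euclidean_space \<Rightarrow> real"
  assumes S: "S \<in> sets borel" and f: "f \<in> borel_measurable borel" and nn: "\<And>x. f x \<ge> 0"
  shows "f absolutely_integrable_on S \<longleftrightarrow> (\<integral>\<^sup>+x. ennreal (f x) * indicator S x \<partial>lborel) < \<infinity>"
    and "f absolutely_integrable_on S \<Longrightarrow> (\<integral>\<^sup>+x. ennreal (f x) * indicator S x \<partial>lborel) = ennreal (integral S f)"
proof -
  have meas: "(\<lambda>x. indicator S x *\<^sub>R f x) \<in> borel_measurable lborel" using S f by measurable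
  have eq: "(\<integral>\<^sup>+x. ennreal (norm (indicator S x *\<^sub>R f x)) \<partial>lborel) = (\<integral>\<^sup>+x. ennreal (f x) * indicator S x \<partial>lborel)"
    using nn by (intro nn_integral_cong) (auto simp: indicator_def)
  have "f absolutely_integrable_on S \<longleftrightarrow> integrable lborel (\<lambda>x. indicator S x *\<^sub>R f x)"
    unfolding set_integrable_def using meas by (intro integrable_completion) simp
  also have "\<dots> \<longleftrightarrow> (\<integral>\<^sup>+x. ennreal (f x) * indicator S x \<partial>lborel) < \<infinity>"
    unfolding integrable_iff_bounded eq using meas by simp
  finally show *: "f absolutely_integrable_on S \<longleftrightarrow> (\<integral>\<^sup>+x. ennreal (f x) * indicator S x \<partial>lborel) < \<infinity>" .
  assume "f absolutely_integrable_on S"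
  then have fin: "(\<integral>\<^sup>+x\<in>S. f x \<partial>lborel) < \<infinity>" using * by simp
  have "(\<integral>\<^sup>+x\<in>S. f x \<partial>lborel) = integral S f"
    by (rule set_nn_integral_lborel_eq_integral[OF _ _ fin]) (use nn f S in \<open>auto simp: set_borel_measurable_def\<close>)
  then show "(\<integral>\<^sup>+x. ennreal (f x) * indicator S x \<partial>lborel) = ennreal (integral S f)" by simp
qed

text \<open>The premise \<open>inv\<close> makes \<open>h\<close> an invariant density. The detour
  through \<open>real^1\<close> fits the vector-valued change of variables, and its equivalence of
  integrability also covers infinite integrals.\<close>

lemma nn_integral_change_of_variables:
  fixes h :: "real^2 \<Rightarrow> real" and g :: "real^2 \<Rightarrow> real^2"
  assumes S: "S \<in> sets borel" and gS: "g ` S \<in> sets borel"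
    and der: "\<And>x. x \<in> S \<Longrightarrow> (g has_derivative g' x) (at x within S)" and inj: "inj_on g S"
    and h: "h \<in> borel_measurable borel" "\<And>x. h x \<ge> 0"
    and inv: "\<And>x. x \<in> S \<Longrightarrow> \<bar>det (matrix (g' x))\<bar> * h (g x) = h x"
  shows "(\<integral>\<^sup>+x. ennreal (h x) * indicator (g ` S) x \<partial>lborel) = (\<integral>\<^sup>+x. ennreal (h x) * indicator S x \<partial>lborel)"
proof -
  let ?f = "\<lambda>x. (\<chi> i. h x) :: real^1"
  have L: "S \<in> sets lebesgue" using S by simp
  have cv: "(\<lambda>x. \<bar>det (matrix (g' x))\<bar> *\<^sub>R ?f (g x)) absolutely_integrable_on S \<and>
           integral S (\<lambda>x. \<bar>det (matrix (g' x))\<bar> *\<^sub>R ?f (g x)) = b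
     \<longleftrightarrow> ?f absolutely_integrable_on (g ` S) \<and> integral (g ` S) ?f = b" for b
    by (rule has_absolute_integral_change_of_variables[OF L der inj])
  have e: "\<bar>det (matrix (g' x))\<bar> *\<^sub>R ?f (g x) = ?f x" if "x \<in> S" for x
    using inv[OF that] by (simp add: vec_eq_iff)
  have 1: "(\<lambda>x. \<bar>det (matrix (g' x))\<bar> *\<^sub>R ?f (g x)) absolutely_integrable_on S \<longleftrightarrow> ?f absolutely_integrable_on S"
    by (rule set_integrable_cong) (use e in auto)
  have 2: "integral S (\<lambda>x. \<bar>det (matrix (g' x))\<bar> *\<^sub>R ?f (g x)) = integral S ?f"
    by (rule integral_cong) (use e in auto)
  have 3: "?f absolutely_integrable_on T \<longleftrightarrow> h absolutely_integrable_on T" for T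
    by (subst absolutely_integrable_on_1_iff) simp
  have 4: "integral T ?f = (\<chi> i. integral T h)" for T
    by (subst integral_on_1_eq) (simp add: vec_eq_iff)
  have cv': "h absolutely_integrable_on S \<and> integral S h = b \<longleftrightarrow> h absolutely_integrable_on (g ` S) \<and> integral (g ` S) h = b" for b
    using cv[of "\<chi> i. b"] unfolding 1 2 3 4 by (simp add: vec_eq_iff)
  show ?thesis
  proof (cases "h absolutely_integrable_on S")
    case True
    then have "h absolutely_integrable_on (g ` S)" "integral (g ` S) h = integral S h" using cv' by blast+
    then show ?thesis using True absolutely_integrable_nn_integral(2)[OF S h] absolutely_integrable_nn_integral(2)[OF gS h] by simp
  next
    case False
    then have "\<not> h absolutely_integrable_on (g ` S)" using cv' by blast
    then show ?thesis using False absolutely_integrable_nn_integral(1)[OF S h] absolutely_integrable_nn_integral(1)[OF gS h]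
      by (simp add: not_less top_unique)
  qed
qed

context convex_domain begin

text \<open>The unit balls are the sections of one open subset of the product.\<close>

lemma finsler_ball_measurable: "(\<lambda>x. measure lborel (finsler_ball x)) \<in> borel_measurable borel"
proof -
  let ?Q = "{(x, v). \<exists>s>0. \<exists>t>0. x + s *\<^sub>R v \<in> U \<and> x - t *\<^sub>R v \<in> U \<and> 1 / s + 1 / t < (2::real)}"
  have "?Q = (\<Union>(s, t)\<in>{(s, t). s > 0 \<and> t > 0 \<and> 1 / s + 1 / t < 2}.
      (\<lambda>z. fst z + s *\<^sub>R snd z) -` U \<inter> (\<lambda>z. fst z - t *\<^sub>R snd z) -` U)" by fastforce
  also have "open \<dots>"
    by (intro open_UN) (auto intro!: open_Int open_vimage open_U continuous_intros)
  finally have "?Q \<in> sets borel" by simp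
  then have Q: "?Q \<in> sets (lborel \<Otimes>\<^sub>M lborel)" by (simp add: borel_prod[symmetric] cong: sets_pair_measure_cong)
  have "(\<lambda>x. emeasure lborel (Pair x -` ?Q)) \<in> borel_measurable lborel"
    by (rule lborel.measurable_emeasure_Pair[OF Q])
  moreover have "Pair x -` ?Q = finsler_ball x" for x by (auto simp: finsler_ball_def)
  ultimately show ?thesis by (simp add: measure_def)
qed

lemma finsler_ball_open: "open (finsler_ball x)"
proof -
  have "finsler_ball x = (\<Union>(s, t)\<in>{(s, t). s > 0 \<and> t > 0 \<and> 1 / s + 1 / t < 2}.
      (\<lambda>v. x + s *\<^sub>R v) -` U \<inter> (\<lambda>v. x - t *\<^sub>R v) -` U)" by (auto simp: finsler_ball_def)
  also have "open \<dots>"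
    by (intro open_UN) (auto intro!: open_Int open_vimage open_U continuous_intros)
  finally show ?thesis .
qed

text \<open>The symmetric part of \<open>U\<close> about \<open>y\<close>, translated to the origin;
  up to constants it controls the Finsler balls near \<open>y\<close> and is easier to compare
  between points.\<close>

definition sym_part :: "real^2 \<Rightarrow> (real^2) set" where
  "sym_part y = {z. y + z \<in> U \<and> y - z \<in> U}"

lemma sym_part: assumes "y \<in> U"
  shows "sym_part y \<in> lmeasurable" "open (sym_part y)" "measure lebesgue (sym_part y) > 0"
proof -
  have "sym_part y = (\<lambda>z. y + z) -` U \<inter> (\<lambda>z. y - z) -` U" by (auto simp: sym_part_def)
  then show o: "open (sym_part y)" by (auto intro!: open_Int open_vimage open_U continuous_intros)
  obtain B where B: "\<And>u. u \<in> U \<Longrightarrow> norm u \<le> B" using bounded_U unfolding bounded_iff by blast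
  have "norm z \<le> B + norm y" if "z \<in> sym_part y" for z
    using B[of "y + z"] norm_triangle_ineq4[of "y + z" y] that by (simp add: sym_part_def)
  then have "bounded (sym_part y)" unfolding bounded_iff by blast
  then show m: "sym_part y \<in> lmeasurable" using o by (intro lmeasurable_open)
  have "0 \<in> sym_part y" using assms by (simp add: sym_part_def)
  then obtain e where e: "e > 0" "ball 0 e \<subseteq> sym_part y" using o open_contains_ball by blast
  have "measure lebesgue (ball (0::real^2) e) \<le> measure lebesgue (sym_part y)"
    using e m by (intro measure_mono_fmeasurable) auto
  moreover have "measure lebesgue (ball (0::real^2) e) > 0" using content_ball_pos[OF e(1)] by simp
  ultimately show "measure lebesgue (sym_part y) > 0" by linarith
qed

text \<open>Each of \<open>1 / s\<close> and \<open>1 / t\<close> is below 2, so \<open>x\<close>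
  plus or minus \<open>v / 2\<close> is still in \<open>U\<close> by convexity.\<close>

lemma finsler_ball_subset: assumes "x \<in> U" shows "finsler_ball x \<subseteq> (*\<^sub>R) 2 ` sym_part x"
proof
  fix v assume "v \<in> finsler_ball x"
  then obtain s t where st: "s > 0" "t > 0" "x + s *\<^sub>R v \<in> U" "x - t *\<^sub>R v \<in> U" "1 / s + 1 / t < 2" by (auto simp: finsler_ball_def)
  have "1 / s < 2" "1 / t < 2" using st zero_less_divide_1_iff[of s] zero_less_divide_1_iff[of t] by linarith+
  then have h: "1 / (2 * s) \<le> 1" "1 / (2 * t) \<le> 1" using st by (simp_all add: field_simps)
  have "(1 - 1 / (2 * s)) *\<^sub>R x + (1 / (2 * s)) *\<^sub>R (x + s *\<^sub>R v) \<in> U"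
    using convexD_alt[OF convex_U assms st(3), of "1 / (2 * s)"] st h by simp
  moreover have "(1 - 1 / (2 * t)) *\<^sub>R x + (1 / (2 * t)) *\<^sub>R (x - t *\<^sub>R v) \<in> U"
    using convexD_alt[OF convex_U assms st(4), of "1 / (2 * t)"] st h by simp
  ultimately have "x + (1/2) *\<^sub>R v \<in> U" "x - (1/2) *\<^sub>R v \<in> U" using st by (simp_all add: algebra_simps)
  then show "v \<in> (*\<^sub>R) 2 ` sym_part x" by (intro image_eqI[of _ _ "(1/2) *\<^sub>R v"]) (auto simp: sym_part_def)
qed

text \<open>A neighbourhood of \<open>y\<close> that replaces a Hilbert ball in the area estimates.\<close>

definition patch :: "real^2 \<Rightarrow> (real^2) set" where
  "patch y = (\<lambda>z. (1/4) *\<^sub>R z + y) ` sym_part y"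

lemma patch_subset: assumes "y \<in> U" shows "patch y \<subseteq> U"
proof
  fix x assume "x \<in> patch y"
  then obtain z where z: "y + z \<in> U" "x = (1/4) *\<^sub>R z + y" by (auto simp: patch_def sym_part_def)
  have "(1 - 1/4) *\<^sub>R y + (1/4) *\<^sub>R (y + z) \<in> U" using convexD_alt[OF convex_U assms z(1), of "1/4"] by simp
  also have "(1 - 1/4) *\<^sub>R y + (1/4) *\<^sub>R (y + z) = x" unfolding z(2) by (simp add: vec_eq_iff field_simps)
  finally show "x \<in> U" .
qed

lemma sym_part_patch: assumes "y \<in> U" "x \<in> patch y" shows "sym_part x \<subseteq> (*\<^sub>R) (5/4) ` sym_part y"
proof
  fix w assume w: "w \<in> sym_part x"
  obtain z where z: "y - z \<in> U" "x = (1/4) *\<^sub>R z + y" using assms by (auto simp: patch_def sym_part_def)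
  \<comment> \<open>The weight \<open>4/5\<close> is the one that cancels \<open>z\<close>, since
    \<open>x\<close> is \<open>y\<close> plus a quarter of \<open>z\<close>.\<close>
  have "(1 - 4/5) *\<^sub>R (y - z) + (4/5) *\<^sub>R (x + w) \<in> U" "(1 - 4/5) *\<^sub>R (y - z) + (4/5) *\<^sub>R (x - w) \<in> U"
    using convexD_alt[OF convex_U z(1), of _ "4/5"] w by (auto simp: sym_part_def)
  moreover have "(1 - 4/5) *\<^sub>R (y - z) + (4/5) *\<^sub>R (x + w) = y + (4/5) *\<^sub>R w"
    "(1 - 4/5) *\<^sub>R (y - z) + (4/5) *\<^sub>R (x - w) = y - (4/5) *\<^sub>R w"
    unfolding z(2) by (simp_all add: vec_eq_iff field_simps)
  ultimately show "w \<in> (*\<^sub>R) (5/4) ` sym_part y"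
    by (intro image_eqI[of _ _ "(4/5) *\<^sub>R w"]) (auto simp: sym_part_def)
qed

lemma patch_comparable: assumes "y \<in> U" "x \<in> patch y" shows "comparable (4/3) (hat y) (hat x)"
proof -
  obtain z where z: "y + z \<in> U" "y - z \<in> U" "x = (1/4) *\<^sub>R z + y" using assms by (auto simp: patch_def sym_part_def)
  have K: "hat (y + z) \<in> K" "hat (y - z) \<in> K" "hat y \<in> K" using z assms C_K by auto
  have "(1/3) *\<^sub>R hat (y + z) \<in> K" using K by (intro scale_K) auto
  moreover have "(1/3) *\<^sub>R hat (y + z) = (4/3) *\<^sub>R hat x - hat y"
    unfolding z(3) by (simp add: vec_eq_iff forall_3 field_simps)
  moreover have "(1/12) *\<^sub>R hat y + (1/4) *\<^sub>R hat (y - z) \<in> K" using K by (intro add_K scale_K) auto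
  moreover have "(1/12) *\<^sub>R hat y + (1/4) *\<^sub>R hat (y - z) = (4/3) *\<^sub>R hat y - hat x"
    unfolding z(3) by (simp add: vec_eq_iff forall_3 field_simps)
  ultimately show ?thesis by (simp add: comparable_def le_def)
qed

lemma open_patch: assumes "y \<in> U" shows "open (patch y)"
proof -
  have "patch y = (+) y ` (*\<^sub>R) (1/4) ` sym_part y" by (simp add: patch_def image_image add.commute)
  then show ?thesis using sym_part(2)[OF assms] by (simp add: open_translation open_scaling)
qed

lemma finsler_ball_measure: assumes "x \<in> U" shows "finsler_ball x \<in> lmeasurable" "measure lborel (finsler_ball x) > 0"
proof -
  have "(*\<^sub>R) 2 ` sym_part x \<in> lmeasurable" using sym_part(1)[OF assms] by (intro measurable_linear_image linear_scale_self)
  then show m: "finsler_ball x \<in> lmeasurable" using finsler_ball_subset[OF assms] finsler_ball_open[of x] by (auto intro: fmeasurableI2)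
  have "0 \<in> finsler_ball x" using assms by (auto simp: finsler_ball_def intro!: exI[of _ 2])
  then obtain e where e: "e > 0" "ball 0 e \<subseteq> finsler_ball x" using finsler_ball_open open_contains_ball by blast
  have "measure lebesgue (ball (0::real^2) e) \<le> measure lebesgue (finsler_ball x)"
    using m by (intro measure_mono_fmeasurable e) auto
  moreover have "measure lebesgue (ball (0::real^2) e) > 0" using content_ball_pos[OF e(1)] by simp
  ultimately have "0 < measure lebesgue (finsler_ball x)" by linarith
  then show "0 < measure lborel (finsler_ball x)" using finsler_ball_open[of x] by simp
qed

text \<open>Over the patch all Finsler balls lie in \<open>2 * (5/4)\<close> times
  \<open>sym_part y\<close>, so with \<open>m\<close> the measure of \<open>sym_part y\<close> the
  density is at least \<open>pi / (25/4 * m)\<close>. The patch has measure \<open>m / 16\<close>,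
  and the product no longer depends on \<open>y\<close>.\<close>

lemma patch_area: assumes y: "y \<in> U"
  shows "ennreal (pi / 100) \<le> (\<integral>\<^sup>+x. ennreal (pi / measure lborel (finsler_ball x)) * indicator (patch y) x \<partial>lborel)"
proof -
  let ?m = "measure lebesgue (sym_part y)"
  have m: "?m > 0" "sym_part y \<in> lmeasurable" using sym_part[OF y] by auto
  have scaled: "measure lebesgue ((*\<^sub>R) c ` sym_part y) = c\<^sup>2 * ?m" "(*\<^sub>R) c ` sym_part y \<in> lmeasurable" if "c > 0" for c
    using measure_lebesgue_affine[of c 0 "sym_part y"] that measurable_linear_image[OF linear_scale_self m(2)] by auto
  have pm: "measure lebesgue (patch y) = ?m / 16"
    using measure_lebesgue_affine[of "1/4" y "sym_part y"] by (simp add: patch_def power2_eq_square)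
  have le: "pi / (25/4 * ?m) \<le> pi / measure lborel (finsler_ball x)" if x: "x \<in> patch y" for x
  proof -
    have xU: "x \<in> U" using patch_subset[OF y] x by blast
    have "finsler_ball x \<subseteq> (*\<^sub>R) 2 ` (*\<^sub>R) (5/4) ` sym_part y"
      using finsler_ball_subset[OF xU] sym_part_patch[OF y x] by blast
    also have "\<dots> = (*\<^sub>R) (5/2) ` sym_part y" by (simp add: image_image)
    finally have sub: "finsler_ball x \<subseteq> (*\<^sub>R) (5/2) ` sym_part y" .
    have fm: "finsler_ball x \<in> sets lebesgue" using finsler_ball_open[of x] by simp
    have "measure lebesgue (finsler_ball x) \<le> measure lebesgue ((*\<^sub>R) (5/2) ` sym_part y)"
      by (rule measure_mono_fmeasurable[OF sub fm scaled(2)]) simp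
    also have "\<dots> = 25/4 * ?m" using scaled(1)[of "5/2"] by (simp add: power2_eq_square)
    finally have up: "measure lborel (finsler_ball x) \<le> 25/4 * ?m" using finsler_ball_open[of x] by simp
    have "0 < measure lborel (finsler_ball x)" by (rule finsler_ball_measure(2)[OF xU])
    with up m show ?thesis by (intro divide_left_mono) auto
  qed
  have bor: "patch y \<in> sets borel" using open_patch[OF y] by simp
  have "patch y \<in> lmeasurable"
  proof (rule lmeasurable_open[OF bounded_subset[OF bounded_U patch_subset[OF y]] open_patch[OF y]])
  qed
  then have em: "emeasure lborel (patch y) = ennreal (?m / 16)"
    using pm bor emeasure_eq_measure2[of "patch y" lebesgue] by simp
  have "ennreal (pi / 100) = ennreal (pi / (25/4 * ?m)) * ennreal (?m / 16)"
    using m by (subst ennreal_mult[symmetric]) auto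
  also have "\<dots> = (\<integral>\<^sup>+x. ennreal (pi / (25/4 * ?m)) * indicator (patch y) x \<partial>lborel)"
    using bor by (simp add: nn_integral_cmult_indicator em)
  also have "\<dots> \<le> (\<integral>\<^sup>+x. ennreal (pi / measure lborel (finsler_ball x)) * indicator (patch y) x \<partial>lborel)"
    using le by (intro nn_integral_mono) (auto simp: indicator_def intro!: ennreal_leI)
  finally show ?thesis .
qed

end

section \<open>Invariance of the area under projective maps\<close>

lemma derivative_projective:
  fixes A :: "real^3^3"
  assumes "(A *v hat u) $ 3 \<noteq> 0"
  shows "((\<lambda>u. unhat (A *v hat u)) has_derivative
    (\<lambda>v. (1 / (A *v hat u) $ 3) *\<^sub>R (first_two (A *v hat_dir v) - (A *v hat_dir v) $ 3 *\<^sub>R unhat (A *v hat u)))) (at u)"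
proof -
  let ?n = "\<lambda>u. (A *v hat u) $ 3"
  have bl: "bounded_linear (\<lambda>v. A *v hat_dir v)"
    by (rule bounded_linear_compose[OF matrix_vector_mul_bounded_linear bounded_linear_hat_dir])
  have w: "((\<lambda>u. A *v hat u) has_derivative (\<lambda>v. A *v hat_dir v)) (at u)"
    unfolding hat_eq matrix_vector_right_distrib
  proof -
    have "((\<lambda>u. A *v hat_dir u + A *v axis 3 1) has_derivative (\<lambda>v. A *v hat_dir v + 0)) (at u)"
      by (intro has_derivative_add bounded_linear_imp_has_derivative bl has_derivative_const)
    then show "((\<lambda>u. A *v hat_dir u + A *v axis 3 1) has_derivative (\<lambda>v. A *v hat_dir v)) (at u)" by simp
  qed
  have n: "(?n has_derivative (\<lambda>v. (A *v hat_dir v) $ 3)) (at u)"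
    by (rule bounded_linear.has_derivative[OF bounded_linear_vec_nth w])
  have t: "((\<lambda>u. first_two (A *v hat u)) has_derivative (\<lambda>v. first_two (A *v hat_dir v))) (at u)"
    by (rule bounded_linear.has_derivative[OF bounded_linear_first_two w])
  have i: "((\<lambda>u. inverse (?n u)) has_derivative (\<lambda>v. - (inverse (?n u) * (A *v hat_dir v) $ 3 * inverse (?n u)))) (at u)"
    by (rule Deriv.has_derivative_inverse[OF assms n])
  have "((\<lambda>u. inverse (?n u) *\<^sub>R first_two (A *v hat u)) has_derivative
     (\<lambda>v. inverse (?n u) *\<^sub>R first_two (A *v hat_dir v) + (- (inverse (?n u) * (A *v hat_dir v) $ 3 * inverse (?n u))) *\<^sub>R first_two (A *v hat u))) (at u)"
    by (rule has_derivative_scaleR[OF i t])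
  moreover have "(\<lambda>v. inverse (?n u) *\<^sub>R first_two (A *v hat_dir v) + (- (inverse (?n u) * (A *v hat_dir v) $ 3 * inverse (?n u))) *\<^sub>R first_two (A *v hat u)) =
     (\<lambda>v. (1 / ?n u) *\<^sub>R (first_two (A *v hat_dir v) - (A *v hat_dir v) $ 3 *\<^sub>R unhat (A *v hat u)))"
    by (simp add: fun_eq_iff unhat_def inverse_eq_divide scaleR_diff_right mult_ac)
  moreover have "(\<lambda>u. inverse (?n u) *\<^sub>R first_two (A *v hat u)) = (\<lambda>u. unhat (A *v hat u))"
    by (simp add: fun_eq_iff unhat_def inverse_eq_divide)
  ultimately show ?thesis by (simp only:)
qed

locale chart_group = convex_domain U + cone_group "cone_over U" G for U :: "(real^2) set" and G :: "(real^3^3) set" +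
  fixes D :: "(real^2) set"
  assumes D_borel: "D \<in> sets borel" and D_sub: "D \<subseteq> U"
    and D_meets: "u \<in> U \<Longrightarrow> \<exists>A\<in>G. unhat (A *v hat u) \<in> D"
    and D_area: "(\<integral>\<^sup>+x. ennreal (pi / measure lborel (finsler_ball x)) * indicator D x \<partial>lborel) < \<infinity>"
begin

definition act :: "real^3^3 \<Rightarrow> real^2 \<Rightarrow> real^2" where "act A u = unhat (A *v hat u)"

text \<open>The derivative of \<open>act A\<close> at \<open>u\<close>, written out by the quotient
  rule.\<close>

definition dact :: "real^3^3 \<Rightarrow> real^2 \<Rightarrow> real^2 \<Rightarrow> real^2" where
  "dact A u v = (1 / (A *v hat u) $ 3) *\<^sub>R (first_two (A *v hat_dir v) - (A *v hat_dir v) $ 3 *\<^sub>R act A u)"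

definition area_density :: "real^2 \<Rightarrow> real" where "area_density u = pi / measure lborel (finsler_ball u)"

lemma act_U: "A \<in> G \<Longrightarrow> u \<in> U \<Longrightarrow> act A u \<in> U" and act_3: "A \<in> G \<Longrightarrow> u \<in> U \<Longrightarrow> (A *v hat u) $ 3 > 0"
  using map_C[of A "hat u"] by (auto simp: act_def cone_over_def)

lemma act_lift: "A \<in> G \<Longrightarrow> u \<in> U \<Longrightarrow> A *v hat u = (A *v hat u) $ 3 *\<^sub>R hat (act A u)"
  using act_3[of A u] by (simp add: act_def hat_unhat)

lemma act_minv: assumes "A \<in> G" "u \<in> U" shows "act (minv A) (act A u) = u"
proof -
  let ?c = "(A *v hat u) $ 3"
  have c: "?c > 0" by (rule act_3[OF assms])
  have "minv A *v (A *v hat u) = minv A *v (?c *\<^sub>R hat (act A u))" using act_lift[OF assms] by simp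
  then have "hat u = ?c *\<^sub>R (minv A *v hat (act A u))" by (simp add: minv_vec[OF assms(1)] matrix_vector_mult_scaleR)
  then have "unhat (hat u) = unhat (?c *\<^sub>R (minv A *v hat (act A u)))" by (rule arg_cong)
  then show ?thesis using c by (simp add: act_def unhat_scale)
qed

lemma minv_minv: "A \<in> G \<Longrightarrow> minv (minv A) = A"
  using minv_unique[of "minv A" A] minv[of A] by simp

lemma act_minv': "A \<in> G \<Longrightarrow> u \<in> U \<Longrightarrow> act A (act (minv A) u) = u"
  using act_minv[of "minv A" u] minv_minv[of A] minv(1)[of A] by simp

lemma act_derivative: "A \<in> G \<Longrightarrow> u \<in> U \<Longrightarrow> (act A has_derivative dact A u) (at u)"
  using derivative_projective[of A u] act_3[of A u] by (simp add: act_def[abs_def] dact_def[abs_def])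

text \<open>Along a line a projective map is a fractional linear change of the parameter fixing 0:
  it adds the constant \<open>\<kappa>\<close> to \<open>1 / s\<close>.\<close>

lemma act_line: assumes A: "A \<in> G" and u: "u \<in> U" and v: "u + s *\<^sub>R v \<in> U"
  defines "\<kappa> \<equiv> (A *v hat_dir v) $ 3 / (A *v hat u) $ 3"
  shows "1 + s * \<kappa> > 0" "act A (u + s *\<^sub>R v) = act A u + (s / (1 + s * \<kappa>)) *\<^sub>R dact A u v"
proof -
  define w w' where "w = A *v hat u" and "w' = A *v hat_dir v"
  have w3: "w $ 3 > 0" using act_3[OF A u] by (simp add: w_def)
  have W: "A *v hat (u + s *\<^sub>R v) = w + s *\<^sub>R w'"
  proof -
    have "hat_dir (s *\<^sub>R v) = s *\<^sub>R hat_dir v" by (rule linear_scale[OF linear_hat_dir])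
    then show ?thesis by (simp add: hat_add matrix_vector_right_distrib matrix_vector_mult_scaleR w_def w'_def)
  qed
  have k: "\<kappa> = w' $ 3 / w $ 3" by (simp add: \<kappa>_def w_def w'_def)
  have W3: "(w + s *\<^sub>R w') $ 3 = w $ 3 * (1 + s * \<kappa>)" using w3 by (simp add: k field_simps)
  moreover have "(w + s *\<^sub>R w') $ 3 > 0" using act_3[OF A v] by (simp only: W)
  ultimately show p: "1 + s * \<kappa> > 0" using w3 by (simp add: zero_less_mult_iff)
  define e where "e = 1 + s * \<kappa>"
  have e: "e > 0" "w' $ 3 * s = w $ 3 * (e - 1)" using p w3 by (auto simp: e_def k)
  have "act A (u + s *\<^sub>R v) = (1 / (w $ 3 * e)) *\<^sub>R (first_two w + s *\<^sub>R first_two w')"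
    unfolding act_def W unhat_def W3 e_def[symmetric] by (simp add: linear_add[OF linear_first_two] linear_scale[OF linear_first_two])
  also have "\<dots> = (1 / w $ 3) *\<^sub>R first_two w + (s / e) *\<^sub>R ((1 / w $ 3) *\<^sub>R (first_two w' - (w' $ 3) *\<^sub>R ((1 / w $ 3) *\<^sub>R first_two w)))"
  proof -
    have "(1 / (w $ 3 * e)) * (a + s * b) = (1 / w $ 3) * a + (s / e) * ((1 / w $ 3) * (b - (w' $ 3) * ((1 / w $ 3) * a)))" for a b
    proof -
      have "(s / e) * ((1 / w $ 3) * (b - (w' $ 3) * ((1 / w $ 3) * a))) = (s * b - (w' $ 3 * s) * a / w $ 3) / (w $ 3 * e)"
        using w3 e(1) by (simp add: field_simps)
      also have "\<dots> = (s * b - (e - 1) * a) / (w $ 3 * e)" unfolding e(2) using w3 by simp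
      finally show ?thesis using w3 e(1) by (simp add: field_simps)
    qed
    then show ?thesis by (simp add: vec_eq_iff)
  qed
  finally show "act A (u + s *\<^sub>R v) = act A u + (s / (1 + s * \<kappa>)) *\<^sub>R dact A u v"
    by (simp add: dact_def act_def unhat_def w_def w'_def e_def)
qed

text \<open>The constant that \<open>act_line\<close> adds to \<open>1 / s\<close> is subtracted
  from \<open>1 / t\<close>, so the sum defining the Finsler ball is unchanged.\<close>

lemma dact_finsler_ball: assumes A: "A \<in> G" and u: "u \<in> U" and v: "v \<in> finsler_ball u" shows "dact A u v \<in> finsler_ball (act A u)"
proof -
  obtain s t where st: "s > 0" "t > 0" "u + s *\<^sub>R v \<in> U" "u - t *\<^sub>R v \<in> U" "1 / s + 1 / t < 2"
    using v by (auto simp: finsler_ball_def)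
  define k where "k = (A *v hat_dir v) $ 3 / (A *v hat u) $ 3"
  have 1: "1 + s * k > 0" "act A (u + s *\<^sub>R v) = act A u + (s / (1 + s * k)) *\<^sub>R dact A u v"
    using act_line[OF A u st(3)] by (auto simp: k_def)
  have m: "u + (- t) *\<^sub>R v \<in> U" using st by simp
  have 2: "1 - t * k > 0" "act A (u - t *\<^sub>R v) = act A u - (t / (1 - t * k)) *\<^sub>R dact A u v"
    using act_line[OF A u m] by (simp_all add: k_def)
  have "1 / (s / (1 + s * k)) + 1 / (t / (1 - t * k)) = 1 / s + 1 / t" using st 1(1) 2(1) by (simp add: field_simps)
  then show ?thesis unfolding finsler_ball_def using st 1 2 act_U[OF A st(3)] act_U[OF A st(4)]
    by (intro CollectI exI[of _ "s / (1 + s * k)"] exI[of _ "t / (1 - t * k)"] conjI) auto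
qed

lemma dact_minv: assumes A: "A \<in> G" and u: "u \<in> U" shows "dact (minv A) (act A u) (dact A u v) = v"
proof -
  have "(act (minv A) \<circ> act A has_derivative dact (minv A) (act A u) \<circ> dact A u) (at u)"
    by (intro diff_chain_at act_derivative A u minv(1) act_U)
  moreover have "(act (minv A) \<circ> act A has_derivative (\<lambda>v. v)) (at u)"
    by (rule has_derivative_transform_within_open[OF has_derivative_ident open_U u]) (simp add: act_minv[OF A])
  ultimately have "dact (minv A) (act A u) \<circ> dact A u = (\<lambda>v. v)" by (rule has_derivative_unique)
  then show ?thesis by (simp add: fun_eq_iff)
qed

lemma dact_finsler_ball_image: assumes A: "A \<in> G" and u: "u \<in> U" shows "finsler_ball (act A u) = dact A u ` finsler_ball u"
proof
  show "dact A u ` finsler_ball u \<subseteq> finsler_ball (act A u)" using dact_finsler_ball[OF A u] by blast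
  show "finsler_ball (act A u) \<subseteq> dact A u ` finsler_ball u"
  proof
    fix v assume v: "v \<in> finsler_ball (act A u)"
    have A': "minv A \<in> G" "act A u \<in> U" using minv(1) A act_U u by auto
    have "dact (minv A) (act A u) v \<in> finsler_ball u" using dact_finsler_ball[OF A' v] act_minv[OF A u] by simp
    moreover have "dact A u (dact (minv A) (act A u) v) = v"
      using dact_minv[OF A', of v] by (simp add: minv_minv[OF A] act_minv[OF A u])
    ultimately show "v \<in> dact A u ` finsler_ball u" by (metis imageI)
  qed
qed

text \<open>\<open>dact A u\<close> carries unit ball to unit ball, so their measures differ by its
  determinant.\<close>

lemma area_density_dact: assumes A: "A \<in> G" and u: "u \<in> U" shows "\<bar>det (matrix (dact A u))\<bar> * area_density (act A u) = area_density u"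
proof -
  have lin: "linear (dact A u)" using act_derivative[OF A u] by (rule has_derivative_linear)
  have "measure lebesgue (finsler_ball (act A u)) = \<bar>det (matrix (dact A u))\<bar> * measure lebesgue (finsler_ball u)"
    unfolding dact_finsler_ball_image[OF A u] by (rule measure_linear_image[OF lin finsler_ball_measure(1)[OF u]])
  then have "measure lborel (finsler_ball (act A u)) = \<bar>det (matrix (dact A u))\<bar> * measure lborel (finsler_ball u)"
    using finsler_ball_open by simp
  then show ?thesis unfolding area_density_def
    using finsler_ball_measure(2)[OF u] finsler_ball_measure(2)[OF act_U[OF A u]] by (auto simp: field_simps zero_less_mult_iff)
qed

lemma act_measurable: "act A \<in> borel_measurable borel"
proof -
  have c: "continuous_on UNIV (\<lambda>u. A *v hat u)"
    unfolding hat_eq by (intro continuous_intros bounded_linear.continuous_on[OF matrix_vector_mul_bounded_linear]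
        bounded_linear.continuous_on[OF bounded_linear_hat_dir])
  have 1: "(\<lambda>u. (A *v hat u) $ 3) \<in> borel_measurable borel"
    by (intro borel_measurable_continuous_onI continuous_intros c)
  have 2: "(\<lambda>u. first_two (A *v hat u)) \<in> borel_measurable borel"
    by (intro borel_measurable_continuous_onI bounded_linear.continuous_on[OF bounded_linear_first_two] c)
  show ?thesis unfolding act_def[abs_def] unhat_def using 1 2 by measurable
qed

lemma area_density_measurable: "area_density \<in> borel_measurable borel"
  unfolding area_density_def[abs_def] using finsler_ball_measurable by measurable

text \<open>\<open>act A\<close> maps the set on the right bijectively onto the set on the left and
  preserves the density.\<close>

lemma area_shift: assumes A: "A \<in> G" and E: "E \<in> sets borel" "E \<subseteq> U"
  shows "(\<integral>\<^sup>+u. ennreal (area_density u) * indicator {u. u \<in> E \<and> act (minv A) u \<in> D} u \<partial>lborel) =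
    (\<integral>\<^sup>+u. ennreal (area_density u) * indicator {u. u \<in> D \<and> act A u \<in> E} u \<partial>lborel)"
proof -
  let ?S = "{u. u \<in> D \<and> act A u \<in> E}"
  have im: "act A ` ?S = {u. u \<in> E \<and> act (minv A) u \<in> D}"
  proof (intro equalityI subsetI)
    fix u assume "u \<in> act A ` ?S"
    then show "u \<in> {u. u \<in> E \<and> act (minv A) u \<in> D}" using D_sub act_minv[OF A] by auto
  next
    fix u assume u: "u \<in> {u. u \<in> E \<and> act (minv A) u \<in> D}"
    then have "act A (act (minv A) u) = u" using E by (intro act_minv'[OF A]) auto
    with u show "u \<in> act A ` ?S" by (intro image_eqI[of _ _ "act (minv A) u"]) auto
  qed
  have meas: "{u. u \<in> E' \<and> act B u \<in> F} \<in> sets borel" if "E' \<in> sets borel" "F \<in> sets borel" for E' F B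
  proof -
    have "{u. u \<in> E' \<and> act B u \<in> F} = E' \<inter> act B -` F" by auto
    then show ?thesis using that measurable_sets_borel[OF act_measurable that(2)] by auto
  qed
  have "(\<integral>\<^sup>+u. ennreal (area_density u) * indicator (act A ` ?S) u \<partial>lborel) = (\<integral>\<^sup>+u. ennreal (area_density u) * indicator ?S u \<partial>lborel)"
  proof (rule nn_integral_change_of_variables)
    show "?S \<in> sets borel" using meas D_borel E by blast
    show "act A ` ?S \<in> sets borel" unfolding im using meas D_borel E by blast
    show "(act A has_derivative dact A x) (at x within ?S)" if "x \<in> ?S" for x
      by (rule has_derivative_at_withinI, rule act_derivative[OF A]) (use that D_sub in auto)
    show "inj_on (act A) ?S" using act_minv[OF A] D_sub by (intro inj_on_inverseI[of _ "act (minv A)"]) auto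
    show "\<bar>det (matrix (dact A x))\<bar> * area_density (act A x) = area_density x" if "x \<in> ?S" for x
      using area_density_dact[OF A, of x] that D_sub by auto
    show "area_density x \<ge> 0" for x by (simp add: area_density_def)
  qed (rule area_density_measurable)
  then show ?thesis by (simp only: im)
qed

section \<open>Cocompactness of the thick part\<close>

lemma countable_G: "countable G"
proof -
  obtain u where u: "u \<in> U" using ne_U by blast
  then have uC: "hat u \<in> cone_over U" by simp
  have "G \<subseteq> (\<Union>n::nat. {A\<in>G. comparable (real n) (hat u) (A *v hat u)})"
  proof
    fix A assume A: "A \<in> G"
    obtain R where R: "comparable R (hat u) (A *v hat u)" using ex_comparable[OF uC map_C[OF A uC]] by blast
    obtain n :: nat where "R \<le> real n" using real_arch_simple by blast
    from comparable_mono[OF R this] C_K uC map_C[OF A uC] A show "A \<in> (\<Union>n::nat. {A\<in>G. comparable (real n) (hat u) (A *v hat u)})" by auto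
  qed
  moreover have "countable (\<Union>n::nat. {A\<in>G. comparable (real n) (hat u) (A *v hat u)})"
    using proper[OF uC] by (intro countable_UN) (auto intro: countable_finite)
  ultimately show ?thesis by (rule countable_subset)
qed

text \<open>Relative to one such element \<open>A0\<close>, the others correspond to
  \<open>A ** minv A0\<close>. This moves \<open>hat y\<close> by a factor
  \<open>(4/3)\<^sup>2 = 16/9\<close> up to scale, hence by at most
  \<open>(16/9)\<^sup>2 \<le> 4\<close> after normalisation, and \<open>packing\<close>
  applies.\<close>

lemma patch_count: assumes y: "y \<in> U" "thick k (hat y)" "k > 0" and x: "x \<in> U"
  shows "finite {A\<in>G. act A x \<in> patch y}" "real (card {A\<in>G. act A x \<in> patch y}) \<le> (1 + 2 * 4\<^sup>2 / k) ^ 9"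
proof -
  let ?T = "{A\<in>G. act A x \<in> patch y}" and ?S = "{B\<in>G. comparable 4 (hat y) (B *v hat y)}"
  have yC: "hat y \<in> cone_over U" using y by simp
  have fS: "finite ?S" by (rule proper[OF yC])
  have "finite ?T \<and> card ?T \<le> card ?S"
  proof (cases "?T = {}")
    case False
    then obtain A0 where A0: "A0 \<in> G" "act A0 x \<in> patch y" by blast
    let ?f = "\<lambda>A. A ** minv A0"
    have inj: "inj_on ?f ?T"
    proof (rule inj_onI)
      fix A B assume "A ** minv A0 = B ** minv A0"
      then have "A ** (minv A0 ** A0) = B ** (minv A0 ** A0)" by (simp add: matrix_mul_assoc)
      then show "A = B" using minv[OF A0(1)] by simp
    qed
    have "?f A \<in> ?S" if A: "A \<in> ?T" for A
    proof -
      let ?B = "A ** minv A0"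
      define t0 t1 where "t0 = (A0 *v hat x) $ 3" and "t1 = (A *v hat x) $ 3"
      have t: "t0 > 0" "t1 > 0" using act_3 A A0 x by (auto simp: t0_def t1_def)
      have B: "?B \<in> G" using A A0 minv(1) mult_G by simp
      have l: "A0 *v hat x = t0 *\<^sub>R hat (act A0 x)" "A *v hat x = t1 *\<^sub>R hat (act A x)"
        using act_lift[OF A0(1) x] act_lift[of A x] A x by (auto simp: t0_def t1_def)
      have "t0 *\<^sub>R (?B *v hat (act A0 x)) = A *v (minv A0 *v (A0 *v hat x))"
        by (simp add: l(1) matrix_vector_mult_scaleR matrix_vector_mul_assoc[symmetric])
      also have "\<dots> = t1 *\<^sub>R hat (act A x)" by (simp add: minv_vec[OF A0(1)] l(2))
      finally have "(1 / t0) *\<^sub>R (t0 *\<^sub>R (?B *v hat (act A0 x))) = (1 / t0) *\<^sub>R (t1 *\<^sub>R hat (act A x))" by simp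
      then have Bx: "?B *v hat (act A0 x) = (t1 / t0) *\<^sub>R hat (act A x)" using t by simp
      have c1: "comparable (4/3) ((t1 / t0) *\<^sub>R hat y) ((t1 / t0) *\<^sub>R hat (act A x))"
        using patch_comparable[OF y(1)] A t by (intro comparable_scale) auto
      have "comparable (4/3) (?B *v hat y) (?B *v hat (act A0 x))" by (rule map_comparable[OF B patch_comparable[OF y(1) A0(2)]])
      then have "comparable (4/3) ((t1 / t0) *\<^sub>R hat (act A x)) (?B *v hat y)" using comparable_sym Bx by simp
      from comparable_trans[OF c1 this] have "comparable (16/9) ((t1 / t0) *\<^sub>R hat y) (?B *v hat y)" by simp
      from comparable_normalize[OF B yC _ _ this] t have "comparable ((16/9)\<^sup>2) (hat y) (?B *v hat y)" by simp
      then have "comparable 4 (hat y) (?B *v hat y)"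
        by (rule comparable_mono) (use C_K yC map_C[OF B yC] in \<open>auto simp: power2_eq_square\<close>)
      with B show ?thesis by simp
    qed
    then have "?f ` ?T \<subseteq> ?S" by blast
    from inj_on_finite[OF inj this fS] card_inj_on_le[OF inj this fS] show ?thesis by simp
  qed (simp only: finite.emptyI card.empty le0)
  moreover have "real (card ?S) \<le> (1 + 2 * 4\<^sup>2 / k) ^ 9" by (rule packing[OF y(2,3)]) simp
  ultimately show "finite ?T" "real (card ?T) \<le> (1 + 2 * 4\<^sup>2 / k) ^ 9" by auto
qed

text \<open>The condition on \<open>x\<close>, \<open>A\<close> and \<open>B\<close> says that the
  patches have pairwise disjoint images in the quotient.\<close>

definition separated :: "real \<Rightarrow> (real^2) set \<Rightarrow> bool" where
  "separated k Y \<longleftrightarrow> finite Y \<and> Y \<subseteq> U \<and> (\<forall>y\<in>Y. thick k (hat y)) \<and>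
    (\<forall>y\<in>Y. \<forall>y'\<in>Y. \<forall>x\<in>U. \<forall>A\<in>G. \<forall>B\<in>G. act A x \<in> patch y \<longrightarrow> act B x \<in> patch y' \<longrightarrow> y = y')"

text \<open>Group elements distribute each patch over \<open>D\<close>, where its pieces have total
  area at least \<open>pi / 100\<close>. By separation a point of \<open>D\<close> is covered by
  pieces of only one patch, and by \<open>patch_count\<close> at most \<open>N\<close> times; so the
  sum over \<open>Y\<close> is at most \<open>N\<close> times the area of \<open>D\<close>.\<close>

lemma separated_card: assumes Y: "separated k Y" and k: "k > 0"
  shows "real (card Y) * (pi / 100) \<le> (1 + 2 * 4\<^sup>2 / k) ^ 9 * enn2real (\<integral>\<^sup>+x. ennreal (area_density x) * indicator D x \<partial>lborel)"
proof -
  define N where "N = (1 + 2 * 4\<^sup>2 / k) ^ 9"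
  have N: "N \<ge> 0" using k by (simp add: N_def)
  have YU: "Y \<subseteq> U" "finite Y" and thick: "\<And>y. y \<in> Y \<Longrightarrow> thick k (hat y)"
    and sep: "\<And>y y' x A B. y \<in> Y \<Longrightarrow> y' \<in> Y \<Longrightarrow> x \<in> U \<Longrightarrow> A \<in> G \<Longrightarrow> B \<in> G \<Longrightarrow> act A x \<in> patch y \<Longrightarrow> act B x \<in> patch y' \<Longrightarrow> y = y'"
    using Y unfolding separated_def by blast+
  let ?I = "\<integral>\<^sup>+x. ennreal (area_density x) * indicator D x \<partial>lborel"
  have bor: "patch y \<in> sets borel" if "y \<in> Y" for y using open_patch[of y] that YU by auto
  define F where "F y A x = ennreal (area_density x) * indicator {u. u \<in> D \<and> act A u \<in> patch y} x" for y A x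
  have meas: "{u. u \<in> E' \<and> act B u \<in> F} \<in> sets borel" if "E' \<in> sets borel" "F \<in> sets borel" for E' F B
  proof -
    have "{u. u \<in> E' \<and> act B u \<in> F} = E' \<inter> act B -` F" by auto
    then show ?thesis using that measurable_sets_borel[OF act_measurable that(2)] by auto
  qed
  have edens: "(\<lambda>x. ennreal (area_density x)) \<in> borel_measurable lborel" using area_density_measurable by simp
  have Fm: "F y A \<in> borel_measurable lborel" if "y \<in> Y" for y A
    unfolding F_def[abs_def] using meas[OF D_borel bor[OF that]] edens by (intro borel_measurable_times_ennreal borel_measurable_indicator) auto
  have one: "ennreal (pi / 100) \<le> (\<integral>\<^sup>+A. \<integral>\<^sup>+x. F y A x \<partial>lborel \<partial>count_space G)" if y: "y \<in> Y" for y
  proof -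
    let ?H = "\<lambda>A u. ennreal (area_density u) * indicator {u. u \<in> patch y \<and> act (minv A) u \<in> D} u"
    have yU: "y \<in> U" using y YU by blast
    have Hm: "?H A \<in> borel_measurable lborel" for A
      using meas[OF bor[OF y] D_borel] edens by (intro borel_measurable_times_ennreal borel_measurable_indicator) auto
    have "ennreal (pi / 100) \<le> (\<integral>\<^sup>+u. ennreal (area_density u) * indicator (patch y) u \<partial>lborel)"
      using patch_area[OF yU] by (simp add: area_density_def)
    also have "\<dots> \<le> (\<integral>\<^sup>+u. \<integral>\<^sup>+A. ?H A u \<partial>count_space G \<partial>lborel)"
    proof (rule nn_integral_mono)
      fix u
      show "ennreal (area_density u) * indicator (patch y) u \<le> (\<integral>\<^sup>+A. ?H A u \<partial>count_space G)"
      proof (cases "u \<in> patch y")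
        case True
        then have "u \<in> U" using patch_subset[OF yU] by blast
        then obtain A where A: "A \<in> G" "act A u \<in> D" using D_meets unfolding act_def by blast
        \<comment> \<open>The index is \<open>minv A\<close>, since \<open>?H\<close> is indexed by
          the element leading from \<open>D\<close> to the patch.\<close>
        have "ennreal (area_density u) * indicator (patch y) u = ?H (minv A) u" using True A by (simp add: minv_minv)
        also have "\<dots> \<le> (\<integral>\<^sup>+A. ?H A u \<partial>count_space G)" by (rule nn_integral_ge_point) (rule minv(1)[OF A(1)])
        finally show ?thesis .
      qed simp
    qed
    also have "\<dots> = (\<integral>\<^sup>+A. \<integral>\<^sup>+u. ?H A u \<partial>lborel \<partial>count_space G)"
      by (rule nn_integral_count_space_nn_integral[OF countable_G Hm])
    also have "\<dots> = (\<integral>\<^sup>+A. \<integral>\<^sup>+u. F y A u \<partial>lborel \<partial>count_space G)"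
      unfolding F_def by (intro nn_integral_cong area_shift bor y patch_subset yU) simp
    finally show ?thesis .
  qed
  have "ennreal (real (card Y) * (pi / 100)) = (\<Sum>y\<in>Y. ennreal (pi / 100))"
    by (simp add: ennreal_mult[symmetric] ennreal_of_nat_eq_real_of_nat)
  also have "\<dots> \<le> (\<Sum>y\<in>Y. \<integral>\<^sup>+A. \<integral>\<^sup>+x. F y A x \<partial>lborel \<partial>count_space G)" by (intro sum_mono one)
  also have "\<dots> = (\<integral>\<^sup>+A. (\<Sum>y\<in>Y. \<integral>\<^sup>+x. F y A x \<partial>lborel) \<partial>count_space G)"
    by (rule nn_integral_sum[symmetric]) simp
  also have "\<dots> = (\<integral>\<^sup>+A. \<integral>\<^sup>+x. (\<Sum>y\<in>Y. F y A x) \<partial>lborel \<partial>count_space G)"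
    by (intro nn_integral_cong nn_integral_sum[symmetric] Fm)
  also have "\<dots> = (\<integral>\<^sup>+x. \<integral>\<^sup>+A. (\<Sum>y\<in>Y. F y A x) \<partial>count_space G \<partial>lborel)"
    by (rule nn_integral_count_space_nn_integral[OF countable_G borel_measurable_sum[OF Fm], symmetric])
  also have "\<dots> = (\<integral>\<^sup>+x. (\<Sum>y\<in>Y. \<integral>\<^sup>+A. F y A x \<partial>count_space G) \<partial>lborel)"
    by (intro nn_integral_cong nn_integral_sum) simp
  also have "\<dots> \<le> (\<integral>\<^sup>+x. ennreal N * (ennreal (area_density x) * indicator D x) \<partial>lborel)"
  proof (rule nn_integral_mono)
    fix x
    show "(\<Sum>y\<in>Y. \<integral>\<^sup>+A. F y A x \<partial>count_space G) \<le> ennreal N * (ennreal (area_density x) * indicator D x)"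
    proof (cases "x \<in> D")
      case True
      then have xU: "x \<in> U" using D_sub by blast
      define T where "T y = {A\<in>G. act A x \<in> patch y}" for y
      have eq: "(\<integral>\<^sup>+A. F y A x \<partial>count_space G) = ennreal (area_density x) * ennreal (card (T y))" if y: "y \<in> Y" for y
      proof -
        have T: "finite (T y)" using patch_count(1)[OF _ thick[OF y] k xU] y YU by (auto simp: T_def)
        have "(\<integral>\<^sup>+A. F y A x \<partial>count_space G) = (\<integral>\<^sup>+A. ennreal (area_density x) * indicator (T y) A \<partial>count_space G)"
          using True by (intro nn_integral_cong) (auto simp: F_def T_def indicator_def)
        also have "\<dots> = ennreal (area_density x) * emeasure (count_space G) (T y)"
          by (rule nn_integral_cmult_indicator) (auto simp: T_def)
        also have "emeasure (count_space G) (T y) = ennreal (card (T y))"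
          using T by (subst emeasure_count_space_finite) (auto simp: T_def ennreal_of_nat_eq_real_of_nat)
        finally show ?thesis .
      qed
      have "(\<Sum>y\<in>Y. real (card (T y))) \<le> N"
      proof (cases "\<exists>y\<in>Y. T y \<noteq> {}")
        case True
        then obtain y0 where y0: "y0 \<in> Y" "T y0 \<noteq> {}" by blast
        have "T y = {}" if "y \<in> Y" "y \<noteq> y0" for y using sep[OF that(1) y0(1) xU] y0(2) that(2) unfolding T_def by blast
        then have "(\<Sum>y\<in>Y. real (card (T y))) = (\<Sum>y\<in>Y. if y = y0 then real (card (T y0)) else 0)"
          by (intro sum.cong) auto
        also have "\<dots> = real (card (T y0))" using y0 YU by simp
        also have "\<dots> \<le> N" unfolding N_def T_def using patch_count(2)[OF _ thick[OF y0(1)] k xU] y0 YU by blast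
        finally show ?thesis .
      next
        case False
        then show ?thesis using N by simp
      qed
      then have le: "(\<Sum>y\<in>Y. ennreal (real (card (T y)))) \<le> ennreal N"
        by (subst sum_ennreal) (auto intro: ennreal_leI)
      have "(\<Sum>y\<in>Y. \<integral>\<^sup>+A. F y A x \<partial>count_space G) = ennreal (area_density x) * (\<Sum>y\<in>Y. ennreal (real (card (T y))))"
        by (subst sum_distrib_left) (intro sum.cong refl eq)
      also have "\<dots> \<le> ennreal (area_density x) * ennreal N" using le by (intro mult_left_mono) auto
      finally show ?thesis using True by (simp add: mult.commute)
    next
      case False
      then show ?thesis by (simp add: F_def)
    qed
  qed
  also have "\<dots> = ennreal N * ?I" using edens D_borel by (intro nn_integral_cmult) auto
  also have "?I = ennreal (enn2real ?I)" using D_area by (simp add: area_density_def)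
  also have "ennreal N * ennreal (enn2real ?I) = ennreal (N * enn2real ?I)" using N by (simp add: ennreal_mult)
  finally show ?thesis using N by (simp add: N_def)
qed

lemma op_bound_scale: assumes "op_bound y k f" "t > 0" shows "op_bound (t *\<^sub>R y) k f"
  unfolding op_bound_def
proof (intro allI impI)
  fix l v assume "order_ball (t *\<^sub>R y) l v"
  then have "order_ball y (l * t) v" by (simp add: order_ball_def)
  then have "order_ball y (k * (l * t)) (f v)" using assms(1) by (simp add: op_bound_def)
  then show "order_ball (t *\<^sub>R y) (k * l) (f v)" by (simp add: order_ball_def mult.assoc)
qed

text \<open>\<open>separated_card\<close> allows a separated set of largest size. A thick point
  outside it cannot be added, so its patch and one of the chosen patches meet in the quotient; two
  factors \<open>4/3\<close> give \<open>16/9\<close>.\<close>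

lemma thick_cover: assumes k: "k > 0"
  shows "\<exists>Y R. finite Y \<and> Y \<subseteq> cone_over U \<and> R \<ge> 1 \<and>
      (\<forall>y. thick k y \<longrightarrow> (\<exists>g\<in>G. \<exists>s>0. \<exists>z\<in>Y. comparable R (s *\<^sub>R (g *v y)) z))"
proof -
  let ?b = "(1 + 2 * 4\<^sup>2 / k) ^ 9 * enn2real (\<integral>\<^sup>+x. ennreal (area_density x) * indicator D x \<partial>lborel) / (pi / 100)"
  have s0: "separated k {}" by (simp add: separated_def)
  have sb: "\<forall>Y. separated k Y \<longrightarrow> card Y < Suc (nat \<lfloor>?b\<rfloor>)"
  proof (intro allI impI)
    fix Y assume "separated k Y"
    from separated_card[OF this k] have "real (card Y) \<le> ?b" by (simp add: field_simps)
    then show "card Y < Suc (nat \<lfloor>?b\<rfloor>)" by (simp add: le_nat_floor less_Suc_eq_le)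
  qed
  obtain Y where Y: "separated k Y" "\<And>Z. separated k Z \<Longrightarrow> card Z \<le> card Y"
    using ex_has_greatest_nat[OF s0 sb] by auto
  have fY: "finite Y" "Y \<subseteq> U" using Y(1) by (auto simp: separated_def)
  have "\<exists>g\<in>G. \<exists>s>0. \<exists>z\<in>hat ` Y. comparable (16/9) (s *\<^sub>R (g *v y)) z" if y: "thick k y" for y
  proof -
    have "y \<in> cone_over U" using y by (simp add: thick_def)
    then obtain t u where u: "t > 0" "u \<in> U" "y = t *\<^sub>R hat u" by (auto simp: cone_over_iff)
    have phu: "hat u = (1 / t) *\<^sub>R y" using u by simp
    have tu: "thick k (hat u)"
    proof -
      have "small y k A" if "small (hat u) k A" for A
        using that op_bound_scale[of "hat u" k "\<lambda>v. A *v v - v" t] u by (simp add: small_def)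
      then show ?thesis using y u by (auto simp: thick_def)
    qed
    show ?thesis
    proof (cases "u \<in> Y")
      case True
      have "comparable 1 (hat u) (hat u)" by (simp add: comparable_def)
      then have "comparable (16/9) (hat u) (hat u)" by (rule comparable_mono) (use u C_K in auto)
      then have "comparable (16/9) ((1 / t) *\<^sub>R (mat 1 *v y)) (hat u)" using u(1) by (simp add: u(3))
      then show ?thesis using True one_G u(1) by (intro bexI[of _ "mat 1"] exI[of _ "1 / t"] conjI bexI[of _ "hat u"]) auto
    next
      case False
      then have "card (insert u Y) > card Y" using fY by simp
      then have "\<not> separated k (insert u Y)" using Y(2) by fastforce
      then have "\<exists>y0\<in>Y. \<exists>x\<in>U. \<exists>A\<in>G. \<exists>B\<in>G. act A x \<in> patch u \<and> act B x \<in> patch y0"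
        using Y(1) u(2) tu unfolding separated_def by blast
      then obtain y0 x A B where h: "y0 \<in> Y" "x \<in> U" "A \<in> G" "B \<in> G" "act A x \<in> patch u" "act B x \<in> patch y0" by blast
      let ?g = "B ** minv A"
      have g: "?g \<in> G" using h minv(1) mult_G by simp
      define t0 t1 where "t0 = (A *v hat x) $ 3" and "t1 = (B *v hat x) $ 3"
      have t: "t0 > 0" "t1 > 0" using act_3 h by (auto simp: t0_def t1_def)
      have l: "A *v hat x = t0 *\<^sub>R hat (act A x)" "B *v hat x = t1 *\<^sub>R hat (act B x)"
        using act_lift h by (auto simp: t0_def t1_def)
      have "t0 *\<^sub>R (?g *v hat (act A x)) = B *v (minv A *v (A *v hat x))"
        by (simp add: l(1) matrix_vector_mult_scaleR matrix_vector_mul_assoc[symmetric])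
      also have "\<dots> = t1 *\<^sub>R hat (act B x)" by (simp add: minv_vec[OF h(3)] l(2))
      finally have "(1 / t1) *\<^sub>R (t0 *\<^sub>R (?g *v hat (act A x))) = (1 / t1) *\<^sub>R (t1 *\<^sub>R hat (act B x))" by simp
      then have gx: "(t0 / t1) *\<^sub>R (?g *v hat (act A x)) = hat (act B x)" using t by simp
      have "comparable (4/3) ((t0 / t1) *\<^sub>R (?g *v hat u)) ((t0 / t1) *\<^sub>R (?g *v hat (act A x)))"
        using t by (intro comparable_scale map_comparable g patch_comparable u h) auto
      then have c1: "comparable (4/3) ((t0 / t1) *\<^sub>R (?g *v hat u)) (hat (act B x))" by (simp only: gx)
      have "y0 \<in> U" using h fY by blast
      then have "comparable (4/3) (hat (act B x)) (hat y0)" using patch_comparable h(6) comparable_sym by blast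
      from comparable_trans[OF c1 this] have "comparable (16/9) ((t0 / t1) *\<^sub>R (?g *v hat u)) (hat y0)" by simp
      then have "comparable (16/9) ((t0 / t1 / t) *\<^sub>R (?g *v y)) (hat y0)" using u by (simp add: matrix_vector_mult_scaleR)
      moreover have "t0 / t1 / t > 0" using t u by simp
      ultimately show ?thesis using g h(1) by blast
    qed
  qed
  moreover have "hat ` Y \<subseteq> cone_over U" "finite (hat ` Y)" using fY by auto
  ultimately show ?thesis by (intro exI[of _ "hat ` Y"] exI[of _ "16/9"]) auto
qed

text \<open>The factor \<open>k\<close> in \<open>eq\<close> may depend on \<open>s\<close>. In the
  variable \<open>u = exp (2 * s)\<close> the chord is \<open>hat p + u *\<^sub>R hat q\<close> up
  to scale; the values at \<open>u = 1, 2, 3\<close> overdetermine the linear map on this plane and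
  force equal factors, which makes both ends eigenvectors.\<close>

lemma chord_hyperbolic: assumes F: "p \<in> frontier U" "q \<in> frontier U" "p \<noteq> q" and A: "A \<in> G" and l: "l > 0"
    and eq: "\<And>s. \<exists>k. A *v chord p q s = k *\<^sub>R chord p q (s + l)"
  shows "\<exists>a. hyperbolic A (hat p) (hat q) a (a * exp (2 * l))"
proof -
  let ?P = "hat p" and ?Q = "hat q" and ?E = "exp (2 * l)"
  have ind: "x = 0 \<and> y = 0" if xy: "x *\<^sub>R ?P + y *\<^sub>R ?Q = 0" for x y
  proof -
    have "(x *\<^sub>R ?P + y *\<^sub>R ?Q) $ 3 = 0" using xy by simp
    then have y: "y = - x" by simp
    have "x *\<^sub>R (p - q) = first_two (x *\<^sub>R ?P + y *\<^sub>R ?Q)" by (simp add: y vec_eq_iff forall_2 algebra_simps)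
    also have "\<dots> = 0" unfolding xy by (rule linear_0[OF linear_first_two])
    finally have "x = 0" using F(3) by simp
    with y show ?thesis by simp
  qed
  have u: "\<exists>k. A *v ?P + u *\<^sub>R (A *v ?Q) = k *\<^sub>R (?P + (u * ?E) *\<^sub>R ?Q)" if "u > 0" for u
  proof -
    define s where "s = ln u / 2"
    have s: "exp s * exp s = u" using that by (simp add: s_def exp_add[symmetric])
    have ch: "exp r *\<^sub>R chord p q r = ?P + (exp r * exp r) *\<^sub>R ?Q" for r
      by (simp add: chord_def scaleR_add_right exp_add[symmetric])
    obtain k where k: "A *v chord p q s = k *\<^sub>R chord p q (s + l)" using eq by blast
    have "A *v ?P + u *\<^sub>R (A *v ?Q) = A *v (exp s *\<^sub>R chord p q s)"
      unfolding ch s by (simp add: matrix_vector_right_distrib matrix_vector_mult_scaleR)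
    also have "\<dots> = (exp s * k) *\<^sub>R chord p q (s + l)" by (simp add: matrix_vector_mult_scaleR k)
    also have "\<dots> = (exp s * k / exp (s + l)) *\<^sub>R (exp (s + l) *\<^sub>R chord p q (s + l))" by simp
    also have "\<dots> = (exp s * k / exp (s + l)) *\<^sub>R (?P + (exp (s + l) * exp (s + l)) *\<^sub>R ?Q)" by (simp only: ch)
    also have "exp (s + l) * exp (s + l) = u * ?E" by (simp add: s[symmetric] exp_add[symmetric])
    finally show ?thesis by blast
  qed
  obtain k1 where k1: "A *v ?P + 1 *\<^sub>R (A *v ?Q) = k1 *\<^sub>R (?P + (1 * ?E) *\<^sub>R ?Q)" using u[of 1] by auto
  obtain k2 where k2: "A *v ?P + 2 *\<^sub>R (A *v ?Q) = k2 *\<^sub>R (?P + (2 * ?E) *\<^sub>R ?Q)" using u[of 2] by auto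
  obtain k3 where k3: "A *v ?P + 3 *\<^sub>R (A *v ?Q) = k3 *\<^sub>R (?P + (3 * ?E) *\<^sub>R ?Q)" using u[of 3] by auto
  have "A *v ?Q = (A *v ?P + 2 *\<^sub>R (A *v ?Q)) - (A *v ?P + 1 *\<^sub>R (A *v ?Q))" by (simp add: scaleR_2)
  then have AQ: "A *v ?Q = (k2 - k1) *\<^sub>R ?P + (?E * (2 * k2 - k1)) *\<^sub>R ?Q" unfolding k1 k2 by (simp add: algebra_simps)
  have "A *v ?P = k1 *\<^sub>R (?P + (1 * ?E) *\<^sub>R ?Q) - A *v ?Q" using k1 by (simp add: eq_diff_eq)
  also have "\<dots> = (2 * k1 - k2) *\<^sub>R ?P + (?E * (2 * k1 - 2 * k2)) *\<^sub>R ?Q" unfolding AQ by (simp add: vec_eq_iff algebra_simps)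
  finally have AP: "A *v ?P = (2 * k1 - k2) *\<^sub>R ?P + (?E * (2 * k1 - 2 * k2)) *\<^sub>R ?Q" .
  have "(2 * k2 - k1 - k3) *\<^sub>R ?P + (?E * (4 * k2 - k1 - 3 * k3)) *\<^sub>R ?Q =
      (A *v ?P + 3 *\<^sub>R (A *v ?Q)) - k3 *\<^sub>R (?P + (3 * ?E) *\<^sub>R ?Q)"
    unfolding AP AQ by (simp add: vec_eq_iff algebra_simps)
  also have "\<dots> = 0" using k3 by simp
  finally have "(2 * k2 - k1 - k3) *\<^sub>R ?P + (?E * (4 * k2 - k1 - 3 * k3)) *\<^sub>R ?Q = 0" .
  then have "2 * k2 - k1 - k3 = 0" "?E * (4 * k2 - k1 - 3 * k3) = 0" using ind by blast+
  \<comment> \<open>Three times the first equation subtracted from the second, after division by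
    \<open>?E\<close>, leaves \<open>2 * k1 = 2 * k2\<close>.\<close>
  then have kk: "k2 = k1" by auto
  have AP': "A *v ?P = k1 *\<^sub>R ?P" and AQ': "A *v ?Q = (k1 * ?E) *\<^sub>R ?Q"
    using AP AQ by (simp_all add: kk mult.commute)
  have PQ: "?P + ?Q \<in> cone_over U" using chord_cone[OF F, of 0] by (simp add: chord_def)
  have "A *v (?P + ?Q) \<in> cone_over U" by (rule map_C[OF A PQ])
  then have "k1 *\<^sub>R ?P + (k1 * ?E) *\<^sub>R ?Q \<in> cone_over U" by (simp add: matrix_vector_right_distrib AP' AQ')
  then have "k1 * (1 + ?E) > 0" by (simp add: cone_over_def algebra_simps)
  moreover have "1 + ?E > 0" by (simp add: add_pos_pos)
  ultimately have "k1 > 0" by (simp add: zero_less_mult_iff)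
  moreover have "k1 < k1 * ?E" using \<open>k1 > 0\<close> l by simp
  ultimately have "hyperbolic A ?P ?Q k1 (k1 * ?E)"
    using A PQ AP' AQ' hat_frontier F by (simp add: hyperbolic_def)
  then show ?thesis by blast
qed

end

section \<open>The projective plane and the fundamental group\<close>

lemma path_class_eq: assumes "homotopic_paths S p q" shows "path_class S p = path_class S q"
  using homotopic_paths_trans[OF assms] homotopic_paths_trans[OF homotopic_paths_sym[OF assms]]
  unfolding path_class_def by blast

definition loop_at :: "'a::topological_space set \<Rightarrow> 'a \<Rightarrow> (real \<Rightarrow> 'a) \<Rightarrow> bool" where
  "loop_at S b p \<longleftrightarrow> path p \<and> path_image p \<subseteq> S \<and> pathstart p = b \<and> pathfinish p = b"

lemma fundamental_group_carrier: "carrier (fundamental_group S b) = path_class S ` {p. loop_at S b p}"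
  by (simp add: fundamental_group_def loop_at_def)

lemma fundamental_group_mult:
  assumes p: "loop_at S b p" and q: "loop_at S b q"
  shows "path_class S p \<otimes>\<^bsub>fundamental_group S b\<^esub> path_class S q = path_class S (p +++ q)"
proof -
  have 1: "path_class S (p' +++ q') = path_class S (p +++ q)" if "p' \<in> path_class S p" "q' \<in> path_class S q" for p' q'
  proof -
    have "homotopic_paths S (p +++ q) (p' +++ q')"
      using that p q by (intro homotopic_paths_join) (auto simp: path_class_def loop_at_def)
    then show ?thesis using path_class_eq by metis
  qed
  have 2: "p \<in> path_class S p" "q \<in> path_class S q" using p q by (auto simp: path_class_def loop_at_def homotopic_paths_refl)
  have "(\<Union>p'\<in>path_class S p. \<Union>q'\<in>path_class S q. path_class S (p' +++ q')) = path_class S (p +++ q)"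
  proof (intro equalityI subsetI)
    fix r assume "r \<in> (\<Union>p'\<in>path_class S p. \<Union>q'\<in>path_class S q. path_class S (p' +++ q'))"
    then obtain p' q' where "p' \<in> path_class S p" "q' \<in> path_class S q" "r \<in> path_class S (p' +++ q')" by blast
    with 1 show "r \<in> path_class S (p +++ q)" by blast
  next
    fix r assume "r \<in> path_class S (p +++ q)"
    with 2 show "r \<in> (\<Union>p'\<in>path_class S p. \<Union>q'\<in>path_class S q. path_class S (p' +++ q'))" by blast
  qed
  then show ?thesis by (simp add: fundamental_group_def)
qed

text \<open>At stage \<open>fst z\<close> the path runs along \<open>p\<close> only up to time
  \<open>fst z\<close> and back again, following the tent function
  \<open>1 - \<bar>2 * snd z - 1\<bar>\<close>.\<close>

lemma homotopic_paths_reversepath_const: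
  fixes p :: "real \<Rightarrow> 'a::topological_space"
  assumes "path p" "path_image p \<subseteq> S"
  shows "homotopic_paths S (\<lambda>_. pathstart p) (p +++ reversepath p)"
  unfolding homotopic_paths
proof (intro exI conjI ballI)
  let ?h = "\<lambda>z::real \<times> real. p (fst z * (1 - \<bar>2 * snd z - 1\<bar>))"
  have in01: "fst z * (1 - \<bar>2 * snd z - 1\<bar>) \<in> {0..1}" if "z \<in> {0..1} \<times> {0..1}" for z :: "real \<times> real"
    using that by (auto intro!: mult_nonneg_nonneg mult_le_one)
  show "continuous_on ({0..1} \<times> {0..1}) ?h"
  proof (rule continuous_on_compose2[of "{0..1}" p])
    show "continuous_on ({0..1} \<times> {0..1}) (\<lambda>z::real \<times> real. fst z * (1 - \<bar>2 * snd z - 1\<bar>))"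
      by (intro continuous_intros)
  qed (use assms(1) in01 in \<open>auto simp only: path_def image_subset_iff\<close>)
  show "?h \<in> {0..1} \<times> {0..1} \<rightarrow> S" using in01 assms(2) unfolding path_image_def by blast
  show "?h (0, x) = pathstart p" for x by (simp add: pathstart_def)
  show "?h (1, x) = (p +++ reversepath p) x" for x
  proof (cases "x \<le> 1/2")
    case True
    then have "1 - \<bar>2 * x - 1\<bar> = 2 * x" by simp
    then show ?thesis using True by (simp add: joinpaths_def)
  next
    case False
    then have "1 - \<bar>2 * x - 1\<bar> = 1 - (2 * x - 1)" by simp
    then show ?thesis using False by (simp add: joinpaths_def reversepath_def)
  qed
  show "pathstart (?h \<circ> Pair t) = pathstart (\<lambda>_. pathstart p)"
    "pathfinish (?h \<circ> Pair t) = pathfinish (\<lambda>_. pathstart p)" for t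
    by (simp_all add: pathstart_def pathfinish_def)
qed

text \<open>Closure of loop classes, the idempotent constant class and right inverses are enough;
  all other group laws are inherited from \<open>H\<close>.\<close>

lemma hom_image_subgroup:
  assumes b: "b \<in> S" and hom: "\<rho> \<in> hom (fundamental_group S b) H" and H: "group H"
  shows "subgroup (\<rho> ` carrier (fundamental_group S b)) H"
proof -
  interpret H: group H by (rule H)
  let ?\<pi> = "fundamental_group S b"
  define e where "e = path_class S (\<lambda>_::real. b)"
  have c: "loop_at S b (\<lambda>_. b)" using b by (auto simp: loop_at_def path_def path_image_def pathstart_def pathfinish_def)
  have e: "e \<in> carrier ?\<pi>" using c by (auto simp: fundamental_group_carrier e_def)
  have closed: "\<alpha> \<otimes>\<^bsub>?\<pi>\<^esub> \<beta> \<in> carrier ?\<pi>" if ab: "\<alpha> \<in> carrier ?\<pi>" "\<beta> \<in> carrier ?\<pi>" for \<alpha> \<beta>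
  proof -
    obtain p q where pq: "loop_at S b p" "loop_at S b q" "\<alpha> = path_class S p" "\<beta> = path_class S q"
      using ab by (auto simp: fundamental_group_carrier)
    have "loop_at S b (p +++ q)" using pq by (auto simp: loop_at_def path_image_join)
    then show ?thesis using fundamental_group_mult[OF pq(1,2)] pq by (auto simp: fundamental_group_carrier)
  qed
  have inv: "\<exists>\<beta>\<in>carrier ?\<pi>. \<alpha> \<otimes>\<^bsub>?\<pi>\<^esub> \<beta> = e" if al: "\<alpha> \<in> carrier ?\<pi>" for \<alpha>
  proof -
    obtain p where p: "loop_at S b p" "\<alpha> = path_class S p" using al by (auto simp: fundamental_group_carrier)
    have r: "loop_at S b (reversepath p)" using p by (auto simp: loop_at_def)
    have "homotopic_paths S (\<lambda>_. b) (p +++ reversepath p)"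
      using homotopic_paths_reversepath_const[of p S] p by (auto simp: loop_at_def)
    from path_class_eq[OF this] have "\<alpha> \<otimes>\<^bsub>?\<pi>\<^esub> path_class S (reversepath p) = e"
      using fundamental_group_mult[OF p(1) r] p(2) by (simp add: e_def)
    then show ?thesis using r by (auto simp: fundamental_group_carrier)
  qed
  have in_H: "\<rho> \<alpha> \<in> carrier H" if "\<alpha> \<in> carrier ?\<pi>" for \<alpha> using hom that by (auto simp: hom_def)
  have mult: "\<rho> (\<alpha> \<otimes>\<^bsub>?\<pi>\<^esub> \<beta>) = \<rho> \<alpha> \<otimes>\<^bsub>H\<^esub> \<rho> \<beta>" if "\<alpha> \<in> carrier ?\<pi>" "\<beta> \<in> carrier ?\<pi>" for \<alpha> \<beta>
    using hom that by (simp add: hom_def)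
  have "e \<otimes>\<^bsub>?\<pi>\<^esub> e = e"
  proof -
    have "homotopic_paths S ((\<lambda>_. b) +++ (\<lambda>_. b)) (\<lambda>_. b)"
    proof -
      have "(\<lambda>_. b) +++ (\<lambda>_. b) = (\<lambda>_::real. b)" by (auto simp: joinpaths_def)
      then show ?thesis using c by (simp add: loop_at_def homotopic_paths_refl)
    qed
    from path_class_eq[OF this] show ?thesis using fundamental_group_mult[OF c c] by (simp add: e_def)
  qed
  then have "\<rho> e \<otimes>\<^bsub>H\<^esub> \<rho> e = \<rho> e" using mult[OF e e] by simp
  then have \<rho>e: "\<rho> e = \<one>\<^bsub>H\<^esub>" using in_H[OF e] H.r_cancel_one by blast
  show ?thesis
  proof (rule H.subgroupI)
    show "\<rho> ` carrier ?\<pi> \<subseteq> carrier H" using in_H by blast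
    show "\<rho> ` carrier ?\<pi> \<noteq> {}" using e by blast
  next
    fix x assume "x \<in> \<rho> ` carrier ?\<pi>"
    then obtain \<alpha> where \<alpha>: "\<alpha> \<in> carrier ?\<pi>" "x = \<rho> \<alpha>" by blast
    obtain \<beta> where \<beta>: "\<beta> \<in> carrier ?\<pi>" "\<alpha> \<otimes>\<^bsub>?\<pi>\<^esub> \<beta> = e" using inv[OF \<alpha>(1)] by blast
    have "\<rho> \<alpha> \<otimes>\<^bsub>H\<^esub> \<rho> \<beta> = \<one>\<^bsub>H\<^esub>" using mult[OF \<alpha>(1) \<beta>(1)] \<beta>(2) \<rho>e by simp
    then have "inv\<^bsub>H\<^esub> x = \<rho> \<beta>" using H.inv_equality H.inv_comm in_H \<alpha> \<beta>(1) by (metis H.inv_inv)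
    then show "inv\<^bsub>H\<^esub> x \<in> \<rho> ` carrier ?\<pi>" using \<beta> by blast
  next
    fix x y assume "x \<in> \<rho> ` carrier ?\<pi>" "y \<in> \<rho> ` carrier ?\<pi>"
    then show "x \<otimes>\<^bsub>H\<^esub> y \<in> \<rho> ` carrier ?\<pi>" using mult closed by (smt (verit) imageE imageI)
  qed
qed

section \<open>The projective plane and its group\<close>

lemma in_proj_point [simp]: "v \<in> proj_point v"
  by (auto simp: proj_point_def intro!: exI[of _ 1])

lemma proj_point_scale: "c \<noteq> 0 \<Longrightarrow> proj_point (c *\<^sub>R v) = proj_point v"
proof -
  assume c: "c \<noteq> 0"
  show ?thesis unfolding proj_point_def
  proof (intro equalityI subsetI, goal_cases)
    case (1 x)
    then obtain d where "d \<noteq> 0" "x = d *\<^sub>R c *\<^sub>R v" by blast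
    then show ?case using c by (intro CollectI exI[of _ "d * c"]) simp
  next
    case (2 x)
    then obtain d where "d \<noteq> 0" "x = d *\<^sub>R v" by blast
    then show ?case using c by (intro CollectI exI[of _ "d / c"]) simp
  qed
qed

lemma proj_point_eq: "proj_point v = proj_point w \<longleftrightarrow> (\<exists>c. c \<noteq> 0 \<and> v = c *\<^sub>R w)"
proof
  assume "proj_point v = proj_point w"
  then have "v \<in> proj_point w" using in_proj_point[of v] by simp
  then show "\<exists>c. c \<noteq> 0 \<and> v = c *\<^sub>R w" by (auto simp: proj_point_def)
qed (auto simp: proj_point_scale)

lemma affine_chart_hat: "affine_chart M u = proj_point (M *v hat u)"
  by (simp add: affine_chart_def hat_def)

lemma openin_RP2: "openin RP2_topology V \<longleftrightarrow> V \<subseteq> RP2 \<and> open (\<Union>V)"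
  unfolding RP2_topology_def by (rule openin_class_topology[OF disjoint_RP2])

lemma Union_RP2: assumes "V \<subseteq> RP2" "v \<noteq> 0" shows "v \<in> \<Union>V \<longleftrightarrow> proj_point v \<in> V"
proof
  assume "v \<in> \<Union>V"
  then obtain l where l: "l \<in> V" "v \<in> l" by blast
  then obtain w where "l = proj_point w" using assms by (auto simp: RP2_def)
  then have "proj_point v = proj_point w" using l(2) unfolding proj_point_eq by (auto simp: proj_point_def)
  with l \<open>l = proj_point w\<close> show "proj_point v \<in> V" by simp
qed (metis UnionI in_proj_point)

lemma topspace_RP2: "topspace RP2_topology = RP2"
proof -
  have "\<Union>RP2 = - {0}"
    by (auto simp: RP2_def proj_point_def intro!: bexI[of _ "_ :: real^3"] exI[of _ 1])
  then have "openin RP2_topology RP2" by (simp add: openin_RP2 open_Compl)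
  moreover have "topspace RP2_topology \<subseteq> RP2" unfolding topspace_def by (auto simp: openin_RP2)
  ultimately show ?thesis using openin_subset by blast
qed

lemma closure_RP2: assumes "\<Omega> \<subseteq> RP2" "w \<noteq> 0" "w \<in> closure (\<Union>\<Omega>)" shows "proj_point w \<in> RP2_topology closure_of \<Omega>"
  unfolding in_closure_of
proof (intro conjI allI impI)
  show "proj_point w \<in> topspace RP2_topology" using assms by (simp add: topspace_RP2 RP2_def)
  fix V assume V: "proj_point w \<in> V \<and> openin RP2_topology V"
  then have o: "open (\<Union>V)" "V \<subseteq> RP2" by (auto simp: openin_RP2)
  have "w \<in> \<Union>V" using V in_proj_point by blast
  then have "\<Union>V \<inter> \<Union>\<Omega> \<noteq> {}" using assms(3) o(1) by (metis closure_iff_nhds_not_empty open_Int_closure_eq_empty disjoint_iff)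
  then obtain x l l' where x: "l \<in> \<Omega>" "l' \<in> V" "x \<in> l" "x \<in> l'" by blast
  have "l = l'" using disjointD[OF disjoint_RP2, of l l'] x o(2) assms(1) by blast
  with x show "\<exists>y. y \<in> \<Omega> \<and> y \<in> V" by blast
qed

lemma compactin_RP2: assumes "compact K" "0 \<notin> K" shows "compactin RP2_topology (proj_point ` K)"
proof -
  have "continuous_map (top_of_set (- {0})) RP2_topology proj_point"
    unfolding continuous_map
  proof (intro conjI allI impI)
    show "proj_point ` topspace (top_of_set (- {0})) \<subseteq> topspace RP2_topology" by (auto simp: topspace_RP2 RP2_def)
    fix V assume "openin RP2_topology V"
    then have V: "V \<subseteq> RP2" "open (\<Union>V)" by (auto simp: openin_RP2)
    have "{x \<in> topspace (top_of_set (- {0})). proj_point x \<in> V} = (- {0}) \<inter> \<Union>V" using Union_RP2[OF V(1)] by auto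
    then show "openin (top_of_set (- {0})) {x \<in> topspace (top_of_set (- {0})). proj_point x \<in> V}"
      using V(2) by (simp add: openin_open_Int)
  qed
  moreover have "compactin (top_of_set (- {0})) K" using assms by (auto simp: compactin_subtopology)
  ultimately show ?thesis by (rule image_compactin[rotated])
qed

lemma PGL3_class: assumes "c \<in> carrier PGL3" shows "\<exists>B. invertible B \<and> c = {k *\<^sub>R B |k. k \<noteq> 0}"
proof -
  obtain B where B: "B \<in> carrier GL3" "c = scalars3 #>\<^bsub>GL3\<^esub> B"
    using assms by (auto simp: PGL3_def FactGroup_def RCOSETS_def)
  have "c = {k *\<^sub>R B |k. k \<noteq> 0}"
    unfolding B(2) r_coset_def scalars3_def by (auto simp: GL3_def scalar_matrix_mult)
  with B(1) show ?thesis by (auto simp: GL3_def)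
qed

lemma PGL3_scale: assumes "c \<in> carrier PGL3" "B \<in> c" shows "k \<noteq> 0 \<Longrightarrow> k *\<^sub>R B \<in> c" "B' \<in> c \<Longrightarrow> \<exists>k. k \<noteq> 0 \<and> B' = k *\<^sub>R B"
proof -
  obtain B0 where B0: "c = {k *\<^sub>R B0 |k. k \<noteq> 0}" using PGL3_class[OF assms(1)] by blast
  obtain k0 where k0: "k0 \<noteq> 0" "B = k0 *\<^sub>R B0" using assms(2) B0 by auto
  show "k *\<^sub>R B \<in> c" if "k \<noteq> 0" using that k0 unfolding B0 by (auto intro!: exI[of _ "k * k0"])
  show "\<exists>k. k \<noteq> 0 \<and> B' = k *\<^sub>R B" if b: "B' \<in> c"
  proof -
    obtain k' where "k' \<noteq> 0" "B' = k' *\<^sub>R B0" using b B0 by auto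
    then show ?thesis using k0 by (intro exI[of _ "k' / k0"]) simp
  qed
qed

lemma PGL3_invertible: "c \<in> carrier PGL3 \<Longrightarrow> B \<in> c \<Longrightarrow> invertible B"
proof -
  assume c: "c \<in> carrier PGL3" "B \<in> c"
  obtain B0 k where "invertible B0" "k \<noteq> 0" "B = k *\<^sub>R B0" using PGL3_class[OF c(1)] c(2) by auto
  then show ?thesis by (simp add: scalar_invertible)
qed

lemma PGL3_mult: "A \<in> c \<Longrightarrow> B \<in> d \<Longrightarrow> A ** B \<in> c \<otimes>\<^bsub>PGL3\<^esub> d"
  by (auto simp: PGL3_def FactGroup_def set_mult_def GL3_def)

lemma PGL3_one: "\<one>\<^bsub>PGL3\<^esub> = scalars3"
  by (simp add: PGL3_def FactGroup_def)

lemma PGL3_nonempty: "c \<in> carrier PGL3 \<Longrightarrow> \<exists>B. B \<in> c"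
  using PGL3_class by (metis (mono_tags, lifting) mem_Collect_eq zero_neq_one)

lemma proj_act_point: assumes "c \<in> carrier PGL3" "B \<in> c" shows "proj_act c (proj_point v) = proj_point (B *v v)"
proof -
  have "c = {k *\<^sub>R B |k. k \<noteq> 0}" using PGL3_scale[OF assms] by blast
  then show ?thesis unfolding proj_act_def proj_point_def
  proof (intro equalityI subsetI, goal_cases)
    case (1 x)
    then obtain k r where "k \<noteq> 0" "r \<noteq> 0" "x = (k *\<^sub>R B) *v (r *\<^sub>R v)" by auto
    then show ?case by (auto simp: scaleR_matrix_vector_assoc[symmetric] matrix_vector_mult_scaleR intro!: exI[of _ "k * r"])
  next
    case (2 x)
    then obtain r where "r \<noteq> 0" "x = r *\<^sub>R (B *v v)" by auto
    then show ?case using assms(2) by (auto simp: matrix_vector_mult_scaleR intro!: bexI[of _ B] image_eqI[of _ _ "r *\<^sub>R v"])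
  qed
qed

lemma det_scaleR3: "det (k *\<^sub>R (A::real^3^3)) = k ^ 3 * det A"
  by (simp add: det_3 algebra_simps power3_eq_cube)

lemma invertible_inj: "invertible (M::real^3^3) \<Longrightarrow> M *v x = M *v y \<Longrightarrow> x = y"
  by (metis invertible_def matrix_vector_mul_assoc matrix_vector_mul_lid)

lemma neg_matrix_vector: "(- A) *v w = - ((A::real^3^3) *v w)"
  by (simp add: vec_eq_iff matrix_vector_mult_def sum_negf)

lemma proj_point_inj: assumes "invertible (M::real^3^3)" "proj_point (M *v v) = proj_point (M *v w)"
  shows "\<exists>k. k \<noteq> 0 \<and> v = k *\<^sub>R w"
proof -
  obtain k where k: "k \<noteq> 0" "M *v v = k *\<^sub>R (M *v w)" using assms(2) by (auto simp: proj_point_eq)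
  then have "M *v v = M *v (k *\<^sub>R w)" by (simp add: matrix_vector_mult_scaleR)
  with k invertible_inj[OF assms(1)] show ?thesis by blast
qed

lemma norm_hat_ge: "norm (hat u) \<ge> norm u"
proof -
  have "(norm (hat u))\<^sup>2 = (norm u)\<^sup>2 + 1"
    by (simp add: norm_vec_def L2_set_def sum_3 sum_2 real_sqrt_pow2 add_nonneg_nonneg)
  then have "(norm u)\<^sup>2 \<le> (norm (hat u))\<^sup>2" by simp
  then show ?thesis by (rule power2_le_imp_le) simp
qed

text \<open>If the domain were unbounded in the chart, normalised lifts would accumulate at a
  nonzero vector of height 0; its projective point would lie in the closure of
  \<open>\<Omega>\<close> but at infinity for the chart. Strictness carries over because frontier
  points in the chart are frontier points of \<open>\<Omega>\<close>.\<close>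

lemma chart_domain_convex_domain:
  assumes "strictly_convex_domain M \<Omega>"
  shows "convex_domain (affine_chart M -` \<Omega>)"
proof -
  let ?U = "affine_chart M -` \<Omega>"
  have M: "invertible M" and op: "openin RP2_topology \<Omega>" and ne: "\<Omega> \<noteq> {}"
    and cl: "RP2_topology closure_of \<Omega> \<subseteq> range (affine_chart M)" and cv: "convex ?U"
    and st: "\<And>x y. x \<noteq> y \<Longrightarrow> \<not> affine_chart M ` closed_segment x y \<subseteq> RP2_topology frontier_of \<Omega>"
    using assms by (auto simp: strictly_convex_domain_def)
  have \<Omega>: "\<Omega> \<subseteq> RP2" "open (\<Union>\<Omega>)" using op by (auto simp: openin_RP2)
  have nz: "M *v v \<noteq> 0" if "v \<noteq> 0" for v using invertible_inj[OF M, of v 0] that by auto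
  have ph0: "hat u \<noteq> 0" for u by (metis hat_nth(3) zero_index zero_neq_one)
  have U: "u \<in> ?U \<longleftrightarrow> M *v hat u \<in> \<Union>\<Omega>" for u
    using Union_RP2[OF \<Omega>(1) nz[OF ph0]] by (simp add: affine_chart_hat)
  have cont: "continuous_on UNIV (\<lambda>u. M *v hat u)"
    by (intro continuous_intros bounded_linear.continuous_on[OF matrix_vector_mul_bounded_linear])
  have sub: "\<Omega> \<subseteq> range (affine_chart M)"
    using cl closure_of_subset[of \<Omega> RP2_topology] \<Omega>(1) by (simp add: topspace_RP2)
  have eq: "?U = (\<lambda>u. M *v hat u) -` \<Union>\<Omega>" using U by auto
  have cls: "affine_chart M u \<in> RP2_topology closure_of \<Omega>" if "u \<in> closure ?U" for u
  proof -
    have "(\<lambda>u. M *v hat u) ` closure ?U \<subseteq> closure (\<Union>\<Omega>)"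
    proof (rule image_closure_subset)
      show "continuous_on (closure ?U) (\<lambda>u. M *v hat u)" using cont continuous_on_subset by blast
      show "(\<lambda>u. M *v hat u) ` ?U \<subseteq> closure (\<Union>\<Omega>)" using U closure_subset by blast
    qed simp
    then have "M *v hat u \<in> closure (\<Union>\<Omega>)" using that by blast
    from closure_RP2[OF \<Omega>(1) nz[OF ph0] this] show ?thesis by (simp add: affine_chart_hat)
  qed
  show ?thesis
  proof
    show oU: "open ?U" unfolding eq by (rule open_vimage[OF \<Omega>(2) cont])
    show "?U \<noteq> {}" using ne sub by blast
    show "convex ?U" by (rule cv)
    show "bounded ?U"
    proof (rule ccontr)
      assume "\<not> bounded ?U"
      then have "\<exists>u. u \<in> ?U \<and> norm u \<ge> real (Suc n)" for n
        unfolding bounded_iff by (meson linorder_le_cases)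
      then obtain u where u: "\<And>n. u n \<in> ?U" "\<And>n. norm (u n) \<ge> real (Suc n)" by metis
      define w where "w n = (1 / norm (hat (u n))) *\<^sub>R hat (u n)" for n
      have big: "norm (hat (u n)) \<ge> real (Suc n)" for n using u(2)[of n] norm_hat_ge[of "u n"] by linarith
      have pos: "norm (hat (u n)) > 0" for n using ph0 by simp
      have "\<forall>n. w n \<in> sphere 0 1" using ph0 by (simp add: w_def)
      then obtain e r where e: "e \<in> sphere 0 1" "strict_mono r" "(w \<circ> r) \<longlonglongrightarrow> e"
        using compact_sphere[of "0::real^3" 1] unfolding compact_def by metis
      have "(\<lambda>n. 1 / norm (hat (u n))) \<longlonglongrightarrow> 0"
      proof (rule tendsto_sandwich[of "\<lambda>_. 0" _ _ "\<lambda>n. inverse (real (Suc n))"])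
        show "\<forall>\<^sub>F n in sequentially. 1 / norm (hat (u n)) \<le> inverse (real (Suc n))"
          using big pos by (intro always_eventually allI) (simp add: inverse_eq_divide frac_le)
      qed (use LIMSEQ_inverse_real_of_nat in auto)
      from LIMSEQ_subseq_LIMSEQ[OF this e(2)] have "(\<lambda>n. (w \<circ> r) n $ 3) \<longlonglongrightarrow> 0"
        by (simp add: w_def o_def)
      moreover have "(\<lambda>n. (w \<circ> r) n $ 3) \<longlonglongrightarrow> e $ 3" by (intro tendsto_intros e)
      ultimately have e3: "e $ 3 = 0" using LIMSEQ_unique by blast
      have e0: "e \<noteq> 0" using e(1) by auto
      have "M *v w n \<in> \<Union>\<Omega>" for n
      proof -
        have "proj_point (M *v w n) = affine_chart M (u n)"
          using pos[of n] by (simp add: w_def matrix_vector_mult_scaleR proj_point_scale affine_chart_hat)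
        then have "proj_point (M *v w n) \<in> \<Omega>" using u(1)[of n] by simp
        then show ?thesis using in_proj_point by blast
      qed
      moreover have "(\<lambda>n. M *v (w \<circ> r) n) \<longlonglongrightarrow> M *v e"
        by (intro bounded_linear.tendsto[OF matrix_vector_mul_bounded_linear] e)
      ultimately have "M *v e \<in> closure (\<Union>\<Omega>)"
        unfolding closure_sequential by (intro exI[of _ "\<lambda>n. M *v (w \<circ> r) n"]) simp
      from closure_RP2[OF \<Omega>(1) nz[OF e0] this] cl obtain v where "proj_point (M *v e) = proj_point (M *v hat v)"
        by (auto simp: affine_chart_hat)
      from proj_point_inj[OF M this] obtain k where "k \<noteq> 0" "e = k *\<^sub>R hat v" by blast
      with e3 show False by simp
    qed
    show "\<not> closed_segment x y \<subseteq> frontier ?U" if "x \<noteq> y" for x y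
    proof
      assume f: "closed_segment x y \<subseteq> frontier ?U"
      have "affine_chart M ` closed_segment x y \<subseteq> RP2_topology frontier_of \<Omega>"
      proof
        fix l assume "l \<in> affine_chart M ` closed_segment x y"
        then obtain u where u: "u \<in> closed_segment x y" "l = affine_chart M u" by blast
        then have "u \<in> closure ?U" "u \<notin> ?U" using f by (auto simp: frontier_def interior_open[OF oU])
        then show "l \<in> RP2_topology frontier_of \<Omega>"
          using cls u(2) interior_of_subset[of RP2_topology \<Omega>] by (auto simp: frontier_of_def)
      qed
      with st[OF that] show False by blast
    qed
  qed
qed

text \<open>\<open>G\<close> consists of the representatives, in the coordinates of the chart, of the classes in
  \<open>\<Gamma>\<close> that preserve the cone over the domain and have determinant \<open>\<plusminus>1\<close>; every class has exactly
  one.\<close>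

definition cone_lifts :: "real^3^3 \<Rightarrow> (real^3) set set \<Rightarrow> (real^3^3) set set \<Rightarrow> (real^3^3) set" where
  "cone_lifts M \<Omega> \<Gamma> = {A. (\<exists>c\<in>\<Gamma>. M ** A ** matrix_inv M \<in> c) \<and>
     (\<forall>w\<in>cone_over (affine_chart M -` \<Omega>). A *v w \<in> cone_over (affine_chart M -` \<Omega>)) \<and> \<bar>det A\<bar> = 1}"

section \<open>Lifting the projective group to the cone\<close>

locale projective_quotient =
  fixes M :: "real^3^3" and \<Omega> :: "(real^3) set set" and \<Gamma> :: "(real^3^3) set set"
  assumes dom: "strictly_convex_domain M \<Omega>" and sub: "subgroup \<Gamma> PGL3"
    and pres: "c \<in> \<Gamma> \<Longrightarrow> proj_act c ` \<Omega> = \<Omega>" and pd: "properly_discontinuous \<Omega> \<Gamma>"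
    and fin: "finite_area_quotient M \<Omega> \<Gamma>"
begin

abbreviation "U \<equiv> affine_chart M -` \<Omega>"
abbreviation "G \<equiv> cone_lifts M \<Omega> \<Gamma>"
abbreviation "N \<equiv> matrix_inv M"

lemma inv_M: "invertible M" "M ** N = mat 1" "N ** M = mat 1"
proof -
  show M: "invertible M" using dom by (simp add: strictly_convex_domain_def)
  then have "\<exists>A'. M ** A' = mat 1 \<and> A' ** M = mat 1" by (simp add: invertible_def)
  then have "M ** N = mat 1 \<and> N ** M = mat 1" unfolding matrix_inv_def by (rule someI_ex)
  then show "M ** N = mat 1" "N ** M = mat 1" by auto
qed

lemma conj_vec: "(M ** A ** N) *v (M *v v) = M *v (A *v v)"
proof -
  have "M ** A ** N ** M = M ** A" using inv_M by (simp add: matrix_mul_assoc[symmetric])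
  then show ?thesis by (simp add: matrix_vector_mul_assoc)
qed

lemma \<Gamma>_PGL3: "c \<in> \<Gamma> \<Longrightarrow> c \<in> carrier PGL3"
  using subgroup.mem_carrier[OF sub] .

lemma cone_iff: "proj_point (M *v w) \<in> \<Omega> \<longleftrightarrow> w \<in> cone_over U \<or> - w \<in> cone_over U"
proof
  have \<Omega>: "\<Omega> \<subseteq> RP2" using dom by (auto simp: strictly_convex_domain_def openin_RP2)
  then have "\<Omega> \<subseteq> range (affine_chart M)"
    using dom closure_of_subset[of \<Omega> RP2_topology] by (auto simp: strictly_convex_domain_def topspace_RP2)
  moreover assume a: "proj_point (M *v w) \<in> \<Omega>"
  ultimately obtain u where u: "proj_point (M *v w) = proj_point (M *v hat u)" unfolding affine_chart_hat by blast
  then have uU: "u \<in> U" using a by (simp add: affine_chart_hat)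
  obtain k where k: "k \<noteq> 0" "w = k *\<^sub>R hat u" using proj_point_inj[OF inv_M(1) u] by blast
  show "w \<in> cone_over U \<or> - w \<in> cone_over U"
  proof (cases "k > 0")
    case True
    then show ?thesis using k uU by (auto simp: cone_over_iff)
  next
    case False
    then have "- w = (- k) *\<^sub>R hat u" "- k > 0" using k by auto
    then show ?thesis using uU unfolding cone_over_iff by blast
  qed
next
  have *: "proj_point (M *v w) \<in> \<Omega>" if w: "w \<in> cone_over U" for w
  proof -
    obtain t u where "t > 0" "u \<in> U" "w = t *\<^sub>R hat u" using w by (auto simp: cone_over_iff)
    then show ?thesis by (simp add: matrix_vector_mult_scaleR proj_point_scale affine_chart_hat)
  qed
  assume "w \<in> cone_over U \<or> - w \<in> cone_over U"
  then show "proj_point (M *v w) \<in> \<Omega>"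
  proof
    assume "- w \<in> cone_over U"
    from *[OF this] have "proj_point (M *v ((-1) *\<^sub>R w)) \<in> \<Omega>" by simp
    then show ?thesis unfolding matrix_vector_mult_scaleR by (subst (asm) proj_point_scale) auto
  qed (rule *)
qed

sublocale convex_domain U
  by (rule chart_domain_convex_domain[OF dom])

lemma not_both: "w \<in> cone_over U \<Longrightarrow> - w \<notin> cone_over U"
  by (auto simp: cone_over_def)

lemma class_maps_cone: assumes "c \<in> \<Gamma>" "M ** A ** N \<in> c" "w \<in> cone_over U"
  shows "A *v w \<in> cone_over U \<or> - (A *v w) \<in> cone_over U"
proof -
  have "proj_act c (proj_point (M *v w)) = proj_point (M *v (A *v w))"
    using proj_act_point[OF \<Gamma>_PGL3[OF assms(1)] assms(2), of "M *v w"] by (simp add: conj_vec)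
  moreover have "proj_point (M *v w) \<in> \<Omega>" using cone_iff assms(3) by blast
  ultimately have "proj_point (M *v (A *v w)) \<in> \<Omega>" using pres[OF assms(1)] by blast
  then show ?thesis using cone_iff by blast
qed

text \<open>If both signs occurred, a positive combination of two vectors of the cone would be
  mapped to height 0, which is met neither by the cone nor by its negative.\<close>

lemma class_sign: assumes "c \<in> \<Gamma>" "M ** A ** N \<in> c"
  shows "(\<forall>w\<in>cone_over U. A *v w \<in> cone_over U) \<or> (\<forall>w\<in>cone_over U. (- A) *v w \<in> cone_over U)"
proof (rule ccontr)
  assume "\<not> ?thesis"
  then obtain w w' where w: "w \<in> cone_over U" "A *v w \<notin> cone_over U" "w' \<in> cone_over U" "- (A *v w') \<notin> cone_over U"
    by (auto simp: neg_matrix_vector)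
  then have "- (A *v w) \<in> cone_over U" "A *v w' \<in> cone_over U" using class_maps_cone[OF assms] by blast+
  then have n: "(A *v w) $ 3 < 0" "(A *v w') $ 3 > 0" by (auto simp: cone_over_def)
  let ?a = "(A *v w') $ 3" and ?b = "- ((A *v w) $ 3)"
  let ?v = "?a *\<^sub>R w + ?b *\<^sub>R w'"
  have "?v \<in> cone_over U" using n w by (intro add_C scale_C) auto
  then have "(A *v ?v) $ 3 \<noteq> 0" using class_maps_cone[OF assms] by (fastforce simp: cone_over_def)
  moreover have "(A *v ?v) $ 3 = 0"
    by (simp add: matrix_vector_right_distrib matrix_vector_mult_diff_distrib matrix_vector_mult_scaleR)
  ultimately show False by contradiction
qed

lemma lift_exists: assumes c: "c \<in> \<Gamma>" shows "\<exists>A\<in>G. M ** A ** N \<in> c"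
proof -
  have cP: "c \<in> carrier PGL3" by (rule \<Gamma>_PGL3[OF c])
  obtain B where B: "B \<in> c" using PGL3_nonempty[OF cP] by blast
  define A0 where "A0 = N ** B ** M"
  have "M ** A0 ** N = (M ** N) ** B ** (M ** N)" by (simp add: A0_def matrix_mul_assoc)
  then have A0: "M ** A0 ** N = B" using inv_M by simp
  have "invertible (N ** B ** M)"
    using inv_M PGL3_invertible[OF cP B] by (intro invertible_mult) (auto simp: invertible_def)
  then have d: "det A0 \<noteq> 0" by (simp add: A0_def invertible_det_nz)
  \<comment> \<open>The cube root, because scaling by \<open>r\<close> multiplies the determinant by
    \<open>r ^ 3\<close>; the sign \<open>e\<close> below selects the cone instead of its
    negative.\<close>
  define r where "r = root 3 (1 / \<bar>det A0\<bar>)"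
  have r: "r > 0" "r ^ 3 = 1 / \<bar>det A0\<bar>" using d by (auto simp: r_def real_root_pow_pos2)
  have "\<exists>e\<in>{1, -1}. \<forall>w\<in>cone_over U. (e *\<^sub>R A0) *v w \<in> cone_over U"
    using class_sign[OF c, of A0] A0 B by auto
  then obtain e :: real where e: "e \<in> {1, -1}" "\<And>w. w \<in> cone_over U \<Longrightarrow> (e *\<^sub>R A0) *v w \<in> cone_over U" by blast
  let ?A = "(r * e) *\<^sub>R A0"
  have "M ** ?A ** N = (r * e) *\<^sub>R B"
    unfolding A0[symmetric] by (simp add: matrix_mult_scaleR)
  moreover have re: "r * e \<noteq> 0" using e r by auto
  ultimately have mem: "M ** ?A ** N \<in> c" using PGL3_scale(1)[OF cP B re] by simp
  have "?A *v w \<in> cone_over U" if "w \<in> cone_over U" for w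
  proof -
    have "?A *v w = r *\<^sub>R ((e *\<^sub>R A0) *v w)" by (simp add: scaleR_matrix_vector_assoc[symmetric])
    then show ?thesis using scale_C[OF e(2)[OF that] r(1)] by simp
  qed
  moreover have "\<bar>det ?A\<bar> = 1"
  proof -
    have "\<bar>e\<bar> = 1" using e by auto
    then have "\<bar>(r * e) ^ 3\<bar> = r ^ 3" using r by (simp add: power_mult_distrib abs_mult power_abs)
    then show ?thesis using d r(2) by (simp add: det_scaleR3 abs_mult)
  qed
  ultimately have "?A \<in> G" using mem c unfolding cone_lifts_def by blast
  with mem show ?thesis by blast
qed

text \<open>Two lifts differ by a scalar whose cube is 1 or -1, and preserving the cone excludes
  -1.\<close>

lemma lift_unique: assumes "A \<in> G" "B \<in> G" "c \<in> \<Gamma>" "M ** A ** N \<in> c" "M ** B ** N \<in> c" shows "A = B"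
proof -
  obtain k where k: "k \<noteq> 0" "M ** B ** N = k *\<^sub>R (M ** A ** N)"
    using PGL3_scale(2)[OF \<Gamma>_PGL3[OF assms(3)] assms(4,5)] by blast
  have "N ** (M ** B ** N) ** M = N ** (k *\<^sub>R (M ** A ** N)) ** M" using k by simp
  moreover have "N ** (M ** X ** N) ** M = X" for X
  proof -
    have "N ** (M ** X ** N) ** M = (N ** M) ** X ** (N ** M)" by (simp add: matrix_mul_assoc)
    then show ?thesis using inv_M by simp
  qed
  ultimately have B: "B = k *\<^sub>R A" by (simp add: matrix_mult_scaleR)
  have "\<bar>k ^ 3\<bar> = 1" using assms(1,2) by (simp add: cone_lifts_def B det_scaleR3 abs_mult)
  then have "\<bar>k\<bar> ^ 3 = 1 ^ 3" by (simp add: power_abs)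
  then have k1: "\<bar>k\<bar> = 1" using power_eq_iff_eq_base[of 3 "\<bar>k\<bar>" 1] by simp
  obtain w where w: "w \<in> cone_over U" using ne_C by blast
  then have "A *v w \<in> cone_over U" "k *\<^sub>R (A *v w) \<in> cone_over U"
    using assms(1,2) by (auto simp: cone_lifts_def B scaleR_matrix_vector_assoc[symmetric])
  then have "k \<noteq> -1" using not_both by auto
  then have "k = 1" using k1 by linarith
  with B show ?thesis by simp
qed

lemma G_act: assumes "A \<in> G" shows "\<exists>c\<in>\<Gamma>. M ** A ** N \<in> c \<and> (\<forall>v. proj_act c (proj_point (M *v v)) = proj_point (M *v (A *v v)))"
proof -
  obtain c where c: "c \<in> \<Gamma>" "M ** A ** N \<in> c" using assms by (auto simp: cone_lifts_def)
  have "proj_act c (proj_point (M *v v)) = proj_point (M *v (A *v v))" for v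
    using proj_act_point[OF \<Gamma>_PGL3[OF c(1)] c(2), of "M *v v"] by (simp add: conj_vec)
  with c show ?thesis by blast
qed

lemma \<Gamma>_act: assumes "c \<in> \<Gamma>"
  shows "\<exists>A\<in>G. M ** A ** N \<in> c \<and> (\<forall>v. proj_act c (proj_point (M *v v)) = proj_point (M *v (A *v v)))"
proof -
  obtain A where A: "A \<in> G" "M ** A ** N \<in> c" using lift_exists[OF assms] by blast
  have "proj_act c (proj_point (M *v v)) = proj_point (M *v (A *v v))" for v
    using proj_act_point[OF \<Gamma>_PGL3[OF assms] A(2), of "M *v v"] by (simp add: conj_vec)
  with A show ?thesis by blast
qed

lemma orbit_eq: "proj_orbit \<Gamma> (proj_point (M *v v)) = (\<lambda>A. proj_point (M *v (A *v v))) ` G"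
  unfolding proj_orbit_def using G_act \<Gamma>_act by (auto simp: image_iff) metis+

text \<open>Provides the compact subsets of \<open>\<Omega>\<close> to which proper discontinuity is
  applied.\<close>

lemma order_interval: assumes y: "y \<in> cone_over U" and R: "R > 0"
  shows "compact {v. comparable R y v}" "{v. comparable R y v} \<subseteq> cone_over U"
proof -
  have c: "v \<in> cone_over U" if "comparable R y v" for v
  proof -
    have "R *\<^sub>R v \<in> cone_over U" by (rule le_C[OF y]) (use that in \<open>simp add: comparable_def\<close>)
    from scale_C[OF this, of "1 / R"] R show ?thesis by simp
  qed
  then show "{v. comparable R y v} \<subseteq> cone_over U" by blast
  have "{v. comparable R y v} \<subseteq> {v. order_ball y R v}"
  proof
    fix v assume v: "v \<in> {v. comparable R y v}"
    have "R *\<^sub>R y + v \<in> K" using c v y C_K R by (intro add_K scale_K) auto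
    then show "v \<in> {v. order_ball y R v}" using v by (simp add: comparable_def le_def order_ball_def)
  qed
  then have "bounded {v. comparable R y v}" using bounded_order_ball bounded_subset by blast
  moreover have "closed {v. comparable R y v}"
  proof -
    have "{v. comparable R y v} = (\<lambda>v. R *\<^sub>R v - y) -` K \<inter> (\<lambda>v. R *\<^sub>R y - v) -` K"
      by (auto simp: comparable_def le_def)
    then show ?thesis by (auto intro!: closed_Int closed_vimage continuous_intros)
  qed
  ultimately show "compact {v. comparable R y v}" by (simp add: compact_eq_bounded_closed)
qed

lemma M_vec_cont: "continuous_on S ((*v) M)"
  by (rule linear_continuous_on) (rule matrix_vector_mul_bounded_linear)

lemma cone_group_G: "cone_group (cone_over U) G"
proof -
  interpret P: group PGL3 by (rule group_PGL3)
  have one\<Gamma>: "\<one>\<^bsub>PGL3\<^esub> \<in> \<Gamma>" using subgroup.one_closed[OF sub] .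
  have m1: "M ** mat 1 ** N \<in> \<one>\<^bsub>PGL3\<^esub>" using inv_M by (auto simp: PGL3_one scalars3_def intro!: exI[of _ 1])
  have one: "mat 1 \<in> G" using m1 one\<Gamma> by (auto simp: cone_lifts_def)
  have split: "M ** (A ** B) ** N = (M ** A ** N) ** (M ** B ** N)" for A B
  proof -
    have "(M ** A ** N) ** (M ** B ** N) = M ** A ** (N ** M) ** B ** N" by (simp add: matrix_mul_assoc)
    then show ?thesis using inv_M by (simp add: matrix_mul_assoc)
  qed
  have mult: "A ** B \<in> G" if AB: "A \<in> G" "B \<in> G" for A B
  proof -
    obtain c d where cd: "c \<in> \<Gamma>" "M ** A ** N \<in> c" "d \<in> \<Gamma>" "M ** B ** N \<in> d" using AB by (auto simp: cone_lifts_def)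
    have "c \<otimes>\<^bsub>PGL3\<^esub> d \<in> \<Gamma>" using subgroup.m_closed[OF sub] cd by blast
    moreover have "M ** (A ** B) ** N \<in> c \<otimes>\<^bsub>PGL3\<^esub> d" unfolding split by (rule PGL3_mult[OF cd(2,4)])
    ultimately show ?thesis using AB by (auto simp: cone_lifts_def det_mul abs_mult matrix_vector_mul_assoc[symmetric])
  qed
  have inv: "\<exists>B\<in>G. A ** B = mat 1" if A: "A \<in> G" for A
  proof -
    obtain c where c: "c \<in> \<Gamma>" "M ** A ** N \<in> c" using A by (auto simp: cone_lifts_def)
    have "inv\<^bsub>PGL3\<^esub> c \<in> \<Gamma>" using subgroup.m_inv_closed[OF sub c(1)] .
    then obtain B where B: "B \<in> G" "M ** B ** N \<in> inv\<^bsub>PGL3\<^esub> c" using lift_exists by blast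
    have "M ** (A ** B) ** N \<in> c \<otimes>\<^bsub>PGL3\<^esub> inv\<^bsub>PGL3\<^esub> c" unfolding split by (rule PGL3_mult[OF c(2) B(2)])
    then have "M ** (A ** B) ** N \<in> \<one>\<^bsub>PGL3\<^esub>" using P.r_inv[OF \<Gamma>_PGL3[OF c(1)]] by simp
    from lift_unique[OF mult[OF A B(1)] one one\<Gamma> this m1] B show ?thesis by blast
  qed
  have finite_comparable: "finite {A\<in>G. comparable R y (A *v y)}" if y: "y \<in> cone_over U" for R y
  proof -
    \<comment> \<open>At least 1, so that the compact set contains \<open>y\<close> as well as its
      image.\<close>
    define S where "S = max 1 R"
    have S: "S > 0" "R \<le> S" "1 \<le> S" by (auto simp: S_def)
    let ?I = "{v. comparable S y v}"
    let ?J = "proj_point ` ((*v) M ` ?I)"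
    have I: "compact ?I" "?I \<subseteq> cone_over U" using order_interval[OF y S(1)] by auto
    have "compact ((*v) M ` ?I)" by (intro compact_continuous_image I M_vec_cont)
    moreover have "0 \<notin> (*v) M ` ?I"
    proof
      assume "0 \<in> (*v) M ` ?I"
      then obtain v where "v \<in> ?I" "M *v v = M *v 0" by auto
      then show False using invertible_inj[OF inv_M(1)] I(2) zero_notin by blast
    qed
    ultimately have "compactin RP2_topology ?J" by (rule compactin_RP2)
    moreover have "?J \<subseteq> \<Omega>" using I(2) cone_iff by blast
    ultimately have fin: "finite {c\<in>\<Gamma>. proj_act c ` ?J \<inter> ?J \<noteq> {}}" using pd unfolding properly_discontinuous_def by blast
    let ?T = "{A\<in>G. comparable R y (A *v y)}"
    have "\<forall>A\<in>?T. \<exists>c. c \<in> \<Gamma> \<and> M ** A ** N \<in> c \<and> proj_act c (proj_point (M *v y)) = proj_point (M *v (A *v y))"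
      using G_act by blast
    from bchoice[OF this] obtain f where f: "\<And>A. A \<in> ?T \<Longrightarrow> f A \<in> \<Gamma> \<and> M ** A ** N \<in> f A \<and>
        proj_act (f A) (proj_point (M *v y)) = proj_point (M *v (A *v y))" by blast
    have "inj_on f ?T"
    proof (rule inj_onI)
      fix A B assume AB: "A \<in> ?T" "B \<in> ?T" "f A = f B"
      show "A = B" by (rule lift_unique[of A B "f A"]) (use AB f[OF AB(1)] f[OF AB(2)] in auto)
    qed
    moreover have "f ` ?T \<subseteq> {c\<in>\<Gamma>. proj_act c ` ?J \<inter> ?J \<noteq> {}}"
    proof
      fix c assume "c \<in> f ` ?T"
      then obtain A where A: "A \<in> ?T" "c = f A" by blast
      have Ay: "A *v y \<in> cone_over U" using A y by (auto simp: cone_lifts_def)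
      have "comparable S y (A *v y)" using comparable_mono[of R y "A *v y" S] A S C_K y Ay by auto
      moreover have "comparable 1 y y" by (simp add: comparable_def)
      then have "comparable S y y" by (rule comparable_mono) (use S y C_K in auto)
      ultimately have "proj_point (M *v y) \<in> ?J" "proj_point (M *v (A *v y)) \<in> ?J" by auto
      then show "c \<in> {c\<in>\<Gamma>. proj_act c ` ?J \<inter> ?J \<noteq> {}}" using f[OF A(1)] A(2) by force
    qed
    ultimately show ?thesis using fin inj_on_finite by blast
  qed
  show ?thesis
  proof
    show "A *v x \<in> cone_over U" if "A \<in> G" "x \<in> cone_over U" for A x using that by (auto simp: cone_lifts_def)
    show "\<bar>det A\<bar> = 1" if "A \<in> G" for A using that by (simp add: cone_lifts_def)
  qed (use one mult inv finite_comparable in auto)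
qed

lemma chart_group_G: "\<exists>D. chart_group U G D"
proof -
  interpret cone_group "cone_over U" G by (rule cone_group_G)
  from fin obtain D where D1: "D \<in> sets borel" and D': "D \<subseteq> U \<and>
      (\<forall>x\<in>\<Omega>. \<exists>!y. y \<in> D \<and> affine_chart M y \<in> proj_orbit \<Gamma> x) \<and> hilbert_area U D < \<infinity>"
    unfolding finite_area_quotient_def by (rule bexE)
  have meets: "\<exists>y. y \<in> D \<and> affine_chart M y \<in> proj_orbit \<Gamma> x" if "x \<in> \<Omega>" for x
    using bspec[OF conjunct1[OF conjunct2[OF D']] that] by (rule ex1_implies_ex)
  note D = D1 conjunct1[OF D'] meets conjunct2[OF conjunct2[OF D']]
  have "chart_group U G D"
  proof
    show "\<exists>A\<in>G. unhat (A *v hat u) \<in> D" if u: "u \<in> U" for u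
    proof -
      have "affine_chart M u \<in> \<Omega>" using u by simp
      from D(3)[OF this] obtain y where y: "y \<in> D" "affine_chart M y \<in> proj_orbit \<Gamma> (affine_chart M u)" by blast
      then obtain A where A: "A \<in> G" "proj_point (M *v hat y) = proj_point (M *v (A *v hat u))"
        unfolding affine_chart_hat orbit_eq by blast
      from proj_point_inj[OF inv_M(1) A(2)] obtain k where k: "k \<noteq> 0" "hat y = k *\<^sub>R (A *v hat u)" by blast
      then have "unhat (hat y) = unhat (A *v hat u)" by (simp add: unhat_scale)
      then have "unhat (A *v hat u) = y" by simp
      with A(1) y(1) show ?thesis by auto
    qed
    have "hilbert_area U D = (\<integral>\<^sup>+x. ennreal (pi / measure lborel (finsler_ball x)) * indicator D x \<partial>lborel)"
      unfolding hilbert_area_def using D(2) hilbert_norm_ball by (intro nn_integral_cong) (auto simp: indicator_def)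
    then show "(\<integral>\<^sup>+x. ennreal (pi / measure lborel (finsler_ball x)) * indicator D x \<partial>lborel) < \<infinity>" using D(4) by simp
  qed (use D in auto)
  then show ?thesis by blast
qed

text \<open>The ends are arbitrary vectors, not lifts of chart points, so that the images of an axis
  under the group are of the same form.\<close>

definition curve :: "real^3 \<Rightarrow> real^3 \<Rightarrow> real \<Rightarrow> (real^3) set set" where
  "curve P Q t = proj_orbit \<Gamma> (proj_point (M *v (exp (- t) *\<^sub>R P + exp t *\<^sub>R Q)))"

definition shifts :: "(real \<Rightarrow> 'b) \<Rightarrow> (real \<Rightarrow> 'b) set" where
  "shifts \<gamma> = range (\<lambda>a t. \<gamma> (t + a))"

lemma shifts_shift: "shifts (\<lambda>t. \<gamma> (t + d)) = shifts \<gamma>"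
proof -
  have "shifts (\<lambda>t. \<gamma> (t + d)) = (\<lambda>a t. \<gamma> (t + a)) ` range (\<lambda>a. a + d)"
    unfolding shifts_def image_image by (simp add: add.assoc)
  also have "range (\<lambda>a. a + d) = UNIV" by (rule surjI[of _ "\<lambda>a. a - d"]) simp
  finally show ?thesis by (simp add: shifts_def)
qed

text \<open>Rescaling the ends changes the starting point by \<open>ln (t / s) / 2\<close> and the
  vectors by a scalar, which projective points do not see.\<close>

lemma curve_scale: assumes "s > 0" "t > 0" shows "shifts (curve (s *\<^sub>R P) (t *\<^sub>R Q)) = shifts (curve P Q)"
proof -
  define d where "d = ln (t / s) / 2"
  define r where "r = s * exp d"
  have r: "r > 0" using assms by (simp add: r_def)
  have ed: "exp d * exp d = t / s" using assms by (simp add: d_def exp_add[symmetric])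
  have 1: "r * exp (- d) = s" by (simp add: r_def exp_minus)
  have 2: "r * exp d = t" using ed assms by (simp add: r_def mult.assoc)
  have "exp (- \<tau>) *\<^sub>R (s *\<^sub>R P) + exp \<tau> *\<^sub>R (t *\<^sub>R Q) = r *\<^sub>R (exp (- (\<tau> + d)) *\<^sub>R P + exp (\<tau> + d) *\<^sub>R Q)" for \<tau>
  proof -
    have "exp (- \<tau>) * s = r * exp (- (\<tau> + d))" "exp \<tau> * t = r * exp (\<tau> + d)"
      unfolding 1[symmetric] 2[symmetric] by (simp_all add: exp_add exp_diff exp_minus field_simps)
    then show ?thesis by (simp add: scaleR_add_right)
  qed
  then have "curve (s *\<^sub>R P) (t *\<^sub>R Q) = (\<lambda>\<tau>. curve P Q (\<tau> + d))"
    using r by (simp add: curve_def fun_eq_iff matrix_vector_mult_scaleR proj_point_scale)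
  then show ?thesis by (simp add: shifts_shift)
qed

text \<open>By \<open>axis_unique\<close> a matrix \<open>A\<close> admits at most one
  \<open>X\<close> with \<open>geo A X\<close>, and the curve is unchanged under conjugation because
  it consists of orbits. So the finite set \<open>F\<close> of representatives bounds the number of
  closed geodesics.\<close>

lemma discrete_spectrum:
  assumes L: "L > 0"
  shows "finite {(l, shifts \<gamma>) |l \<gamma>. l > 0 \<and> l \<le> L \<and> (\<exists>c\<in>\<Gamma>. \<exists>\<sigma>. hilbert_geodesic M \<Omega> \<sigma> \<and>
        (\<forall>t. \<sigma> (t + l) = proj_act c (\<sigma> t)) \<and> (\<forall>t. \<gamma> t = proj_orbit \<Gamma> (\<sigma> t)))}"
proof -
  obtain D where "chart_group U G D" using chart_group_G by blast
  then interpret chart_group U G D .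
  \<comment> \<open>A translation by length \<open>l\<close> has eigenvalue ratio
    \<open>exp (2 * l)\<close>.\<close>
  have "\<exists>F. finite F \<and> F \<subseteq> G \<and> (\<forall>B p q a b. hyperbolic B p q a b \<and> b / a \<le> exp (2 * L) \<longrightarrow>
      (\<exists>g\<in>G. g ** B ** minv g \<in> F))"
    by (rule finite_conjugacy[OF thick_cover]) (use L in auto)
  then obtain F where F: "finite F" "F \<subseteq> G"
    "\<forall>B p q a b. hyperbolic B p q a b \<and> b / a \<le> exp (2 * L) \<longrightarrow> (\<exists>g\<in>G. g ** B ** minv g \<in> F)"
    by (elim exE conjE)
  define geo where "geo A X \<longleftrightarrow> (\<exists>P Q a l. hyperbolic A P Q a (a * exp (2 * l)) \<and> X = (l, shifts (curve P Q)))" for A and X :: "real \<times> (real \<Rightarrow> (real^3) set set) set"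
  have unique: "X = Y" if X: "geo A X" and Y: "geo A Y" for A X Y
  proof -
    obtain P Q a l where 1: "hyperbolic A P Q a (a * exp (2 * l))" "X = (l, shifts (curve P Q))" using X by (auto simp: geo_def)
    obtain P' Q' a' l' where 2: "hyperbolic A P' Q' a' (a' * exp (2 * l'))" "Y = (l', shifts (curve P' Q'))" using Y by (auto simp: geo_def)
    have a: "a > 0" using 1 by (auto simp: hyperbolic_def)
    have "l' = l" using axis_unique(1,2)[OF 1(1) 2(1)] a by simp
    obtain s t where "s > 0" "P' = s *\<^sub>R P" "t > 0" "Q' = t *\<^sub>R Q" using axis_unique(3,4)[OF 1(1) 2(1)] by blast
    with curve_scale 1(2) 2(2) \<open>l' = l\<close> show "X = Y" by simp
  qed
  have "finite {X. geo A X}" for A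
  proof (cases "\<exists>X. geo A X")
    case True
    then obtain X where "geo A X" by blast
    then have "{X. geo A X} \<subseteq> {X}" using unique by blast
    then show ?thesis by (rule finite_subset) simp
  next
    case False
    then have "{X. geo A X} = {}" by blast
    then show ?thesis by (simp only: finite.emptyI)
  qed
  then have "finite (\<Union>A\<in>F. {X. geo A X})" using F(1) by blast
  moreover have "(l, shifts \<gamma>) \<in> (\<Union>A\<in>F. {X. geo A X})"
    if l: "l > 0" "l \<le> L" and c: "c \<in> \<Gamma>" and \<sigma>: "hilbert_geodesic M \<Omega> \<sigma>"
      and per: "\<And>t. \<sigma> (t + l) = proj_act c (\<sigma> t)" and \<gamma>: "\<And>t. \<gamma> t = proj_orbit \<Gamma> (\<sigma> t)" for l \<gamma> c \<sigma>
  proof -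
    define u where "u t = inv_into UNIV (affine_chart M) (\<sigma> t)" for t
    have \<Omega>: "\<Omega> \<subseteq> range (affine_chart M)"
      using dom closure_of_subset[of \<Omega> RP2_topology] by (auto simp: strictly_convex_domain_def topspace_RP2 openin_RP2)
    have \<sigma>\<Omega>: "\<sigma> t \<in> \<Omega>" for t using \<sigma> by (auto simp: hilbert_geodesic_def)
    have u: "affine_chart M (u t) = \<sigma> t" for t unfolding u_def using \<sigma>\<Omega> \<Omega> by (intro f_inv_into_f) blast
    have uU: "u t \<in> U" for t using u \<sigma>\<Omega> by simp
    have "\<exists>e>0. \<forall>s\<in>ball t e. \<forall>s'\<in>ball t e. hilbert_dist U (u s) (u s') = \<bar>s - s'\<bar>" for t
      using \<sigma> by (simp add: hilbert_geodesic_def proj_dist_def u_def)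
    from geodesic_is_chord[OF uU this] obtain p q d where pq: "p \<in> frontier U" "q \<in> frontier U" "p \<noteq> q"
      and ch: "\<And>t. u t = unhat (chord p q (t + d))" by blast
    have \<sigma>ch: "\<sigma> t = proj_point (M *v chord p q (t + d))" for t
    proof -
      have c0: "exp (- (t + d)) + exp (t + d) \<noteq> 0" using exp_sum_pos[of "t + d"] by simp
      have "\<sigma> t = proj_point (M *v hat (unhat (chord p q (t + d))))" using u[of t] ch by (simp add: affine_chart_hat)
      also have "\<dots> = proj_point (M *v ((exp (- (t + d)) + exp (t + d)) *\<^sub>R hat (unhat (chord p q (t + d)))))"
        unfolding matrix_vector_mult_scaleR by (rule proj_point_scale[OF c0, symmetric])
      finally show ?thesis by (simp only: hat_unhat_chord[symmetric])
    qed
    obtain A where A: "A \<in> G" "\<And>v. proj_act c (proj_point (M *v v)) = proj_point (M *v (A *v v))"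
      using \<Gamma>_act[OF c] by blast
    have "\<exists>k. A *v chord p q s = k *\<^sub>R chord p q (s + l)" for s
    proof -
      have "proj_point (M *v (A *v chord p q s)) = proj_point (M *v chord p q (s + l))"
        using per[of "s - d"] by (simp add: \<sigma>ch A(2) algebra_simps)
      from proj_point_inj[OF inv_M(1) this] show ?thesis by blast
    qed
    from chord_hyperbolic[OF pq A(1) l(1) this] obtain a where h: "hyperbolic A (hat p) (hat q) a (a * exp (2 * l))" by blast
    then have a: "a > 0" by (simp add: hyperbolic_def)
    then have "a * exp (2 * l) / a \<le> exp (2 * L)" using l by simp
    from F(3)[rule_format, OF conjI[OF h this]] obtain g where g: "g \<in> G" "g ** A ** minv g \<in> F" by blast
    \<comment> \<open>Right translation permutes the group, so \<open>g *v x\<close> and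
      \<open>x\<close> have the same orbit.\<close>
    have Gg: "(\<lambda>B. B ** g) ` G = G"
    proof
      show "(\<lambda>B. B ** g) ` G \<subseteq> G" using mult_G g by blast
      show "G \<subseteq> (\<lambda>B. B ** g) ` G"
      proof
        fix B assume "B \<in> G"
        moreover have "B = B ** minv g ** g" using minv(3)[OF g(1)] by (simp add: matrix_mul_assoc[symmetric])
        ultimately show "B \<in> (\<lambda>B. B ** g) ` G" using mult_G minv(1)[OF g(1)] by blast
      qed
    qed
    have "curve (g *v hat p) (g *v hat q) t = curve (hat p) (hat q) t" for t
    proof -
      let ?x = "exp (- t) *\<^sub>R hat p + exp t *\<^sub>R hat q"
      have gx: "exp (- t) *\<^sub>R (g *v hat p) + exp t *\<^sub>R (g *v hat q) = g *v ?x"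
        by (simp add: matrix_vector_right_distrib matrix_vector_mult_scaleR)
      have "curve (g *v hat p) (g *v hat q) t = (\<lambda>B. proj_point (M *v (B *v (g *v ?x)))) ` G"
        by (simp only: curve_def gx orbit_eq)
      also have "\<dots> = (\<lambda>B. proj_point (M *v (B *v ?x))) ` ((\<lambda>B. B ** g) ` G)"
        by (simp only: image_image matrix_vector_mul_assoc)
      also have "\<dots> = curve (hat p) (hat q) t" by (simp only: Gg curve_def orbit_eq)
      finally show ?thesis .
    qed
    then have "curve (g *v hat p) (g *v hat q) = curve (hat p) (hat q)" by blast
    moreover have "\<gamma> = (\<lambda>t. curve (hat p) (hat q) (t + d))"
      using \<gamma> by (simp add: fun_eq_iff \<sigma>ch curve_def chord_def)
    then have "shifts \<gamma> = shifts (curve (hat p) (hat q))" by (simp only: shifts_shift)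
    ultimately have "geo (g ** A ** minv g) (l, shifts \<gamma>)"
      using hyperbolic_conj[OF h g(1)] unfolding geo_def by (metis (no_types))
    with g(2) show ?thesis by blast
  qed
  then have "{(l, shifts \<gamma>) |l \<gamma>. l > 0 \<and> l \<le> L \<and> (\<exists>c\<in>\<Gamma>. \<exists>\<sigma>. hilbert_geodesic M \<Omega> \<sigma> \<and>
        (\<forall>t. \<sigma> (t + l) = proj_act c (\<sigma> t)) \<and> (\<forall>t. \<gamma> t = proj_orbit \<Gamma> (\<sigma> t)))} \<subseteq> (\<Union>A\<in>F. {X. geo A X})"
    by blast
  ultimately show ?thesis by (rule finite_subset[rotated])
qed

end

theorem propositionB3:
  fixes g m :: nat
    and X P :: "'a::topological_space set" and b :: 'a
    and M :: "real^3^3" and \<Omega> :: "(real^3) set set"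
    and \<rho> :: "(real \<Rightarrow> 'a) set \<Rightarrow> (real^3^3) set"
  assumes "m \<ge> 1" and "2 * int g - 2 + int m > 0"
    and "punctured_surface g m X P" and "b \<in> X - P"
    and "cusped_convex_projective_surface X P b M \<Omega> \<rho>"
  shows "discrete_length_spectrum X P b M \<Omega> \<rho>"
proof -
  define \<Gamma> where "\<Gamma> = \<rho> ` carrier (fundamental_group (X - P) b)"
  have h: "strictly_convex_domain M \<Omega>" "\<rho> \<in> hom (fundamental_group (X - P) b) PGL3"
    "\<forall>c\<in>\<Gamma>. proj_act c ` \<Omega> = \<Omega>" "properly_discontinuous \<Omega> \<Gamma>" "finite_area_quotient M \<Omega> \<Gamma>"
    using assms(5) unfolding cusped_convex_projective_surface_def Let_def \<Gamma>_def by blast+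
  have "subgroup \<Gamma> PGL3" unfolding \<Gamma>_def by (rule hom_image_subgroup[OF assms(4) h(2) group_PGL3])
  then interpret projective_quotient M \<Omega> \<Gamma>
    using h by (intro projective_quotient.intro) auto
  show ?thesis unfolding discrete_length_spectrum_def
  proof (intro allI impI)
    fix L :: real assume "L > 0"
    show "finite {G \<in> closed_geodesics X P b M \<Omega> \<rho>. fst G \<le> L}"
    proof (rule finite_subset[OF _ discrete_spectrum[OF \<open>L > 0\<close>]], rule subsetI)
      fix Z assume "Z \<in> {Z \<in> closed_geodesics X P b M \<Omega> \<rho>. fst Z \<le> L}"
      then obtain l \<gamma> where Z: "Z = (l, range (\<lambda>a t. \<gamma> (t + a)))" "l \<le> L" "closed_geodesic_param X P b M \<Omega> \<rho> l \<gamma>"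
        by (auto simp: closed_geodesics_def)
      from Z(3) obtain \<alpha> \<sigma> where \<alpha>: "l > 0" "\<alpha> \<in> carrier (fundamental_group (X - P) b)" "hilbert_geodesic M \<Omega> \<sigma>"
        "\<forall>t. \<sigma> (t + l) = proj_act (\<rho> \<alpha>) (\<sigma> t)" "\<forall>t. \<gamma> t = proj_orbit \<Gamma> (\<sigma> t)"
        unfolding closed_geodesic_param_def \<Gamma>_def by blast
      have "\<rho> \<alpha> \<in> \<Gamma>" using \<alpha>(2) by (simp add: \<Gamma>_def)
      with \<alpha> Z(2) have "\<exists>c\<in>\<Gamma>. \<exists>\<sigma>. hilbert_geodesic M \<Omega> \<sigma> \<and>
        (\<forall>t. \<sigma> (t + l) = proj_act c (\<sigma> t)) \<and> (\<forall>t. \<gamma> t = proj_orbit \<Gamma> (\<sigma> t))" by blast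
      with Z(1,2) \<alpha>(1) show "Z \<in> {(l, shifts \<gamma>) |l \<gamma>. l > 0 \<and> l \<le> L \<and> (\<exists>c\<in>\<Gamma>. \<exists>\<sigma>. hilbert_geodesic M \<Omega> \<sigma> \<and>
        (\<forall>t. \<sigma> (t + l) = proj_act c (\<sigma> t)) \<and> (\<forall>t. \<gamma> t = proj_orbit \<Gamma> (\<sigma> t)))}"
        unfolding shifts_def by blast
    qed
  qed
qed

end
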